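(* Let $\{(\boldsymbol X(t),V(t)),t\ge 0\}$ be the cyclic random motion in $\mathbb R^3$ with the regular-tetrahedron directions described in the context, speed $c>0$, started from the origin with initial direction $\vec v_1$, with intertimes along $\vec v_j$ given by independent geometric counting processes with intensities $\lambda_j>0$, $1\le j\le4$, and let $p_1(\boldsymbol x,t)$ be the density of $\boldsymbol X(t)$ on $\mathrm{Int}(\mathcal T(t))$. Then for $t>0$ and $\boldsymbol x\in\mathrm{Int}(\mathcal T(t))$ $$\lim_{\substack{\forall j,\ \lambda_j\to+\infty\\ \forall i,\ \lambda_1/\lambda_i\to1}}p_1(\boldsymbol x,t)=\xi(\boldsymbol x,t),$$ where $\xi(\boldsymbol x,t)$ is the following probability density function: $$\xi(\boldsymbol x,t)=\frac{6t\,(\tau_1\tau_2\tau_3\tau_4)^2}{\det\boldsymbol A\,\big[(\tau_1\tau_2\tau_3)^4+(\tau_1\tau_2\tau_4)^4+(\tau_1\tau_3\tau_4)^4+(\tau_2\tau_3\tau_4)^4\big]},$$ with $\det\boldsymbol A=\frac{16\sqrt3}9c^3$ and $$\tau_1=\frac{ct+3x_1}{4c},\quad\tau_2=\frac{ct-x_1+2\sqrt2x_2}{4c},\quad\tau_3=\frac{ct-x_1-\sqrt2x_2+\sqrt6x_3}{4c},\quad\tau_4=\frac{ct-x_1-\sqrt2x_2-\sqrt6x_3}{4c}.$$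
   Context: Directions: $\vec v_1=(1,0,0)$, $\vec v_2=(-\tfrac13,\tfrac{2\sqrt2}3,0)$, $\vec v_3=(-\tfrac13,-\tfrac{\sqrt2}3,\sqrt{\tfrac23})$, $\vec v_4=(-\tfrac13,-\tfrac{\sqrt2}3,-\sqrt{\tfrac23})$. $\mathcal T(t)$ is the regular tetrahedron with vertices $ct\,\vec v_j$, $1\le j\le4$. $\boldsymbol A$ is the $4\times 4$ matrix with $j$-th column $(c\vec v_j,1)^T$. Durations. For each $j\in\{1,2,3,4\}$, $(D_{j,k})_{k\ge1}$ is the sequence of interarrival times of a geometric counting process (GCP) with intensity $\lambda_j>0$: a mixed Poisson process whose random intensity $\alpha_j$ is exponentially distributed with mean $\lambda_j$ (given $\alpha_j$, the $D_{j,k}$, $k\ge 1$, are i.i.d. exponential with rate $\alpha_j$). The four sequences are mutually independent. Put $D_j^{(0)}=0$, $D_j^{(k)}=\sum_{i=1}^kD_{j,i}$. Motion. The particle starts at the origin at time $0$ with direction $\vec v_1$ and takes directions cyclically $\vec v_1\to\vec v_2\to\vec v_3\to\vec v_4\to\vec v_1\to\cdots$; during the $k$-th cycle it moves along $\vec v_j$ for a time $D_{j,k}$. Thus the switching times are $T_0=0$ and $T_{4n+j}=\sum_{r=1}^{j}D_r^{(n+1)}+\sum_{r=j+1}^{4}D_r^{(n)}$ for $n\ge0$, $1\le j\le4$; $V(t)=\vec v_j$ for $T_{4n+j-1}\le t<T_{4n+j}$; and $\boldsymbol X(t)=c\int_0^tV(s)\,ds$. $\mathbb P_1$ denotes probability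 conditional on $\{\boldsymbol X(0)=\boldsymbol 0, V(0)=\vec v_1\}$. Density: $p_1(\boldsymbol x,t)=\sum_{j=1}^4p_{1j}(\boldsymbol x,t)$, where $p_{1j}(\boldsymbol x,t)\,d\boldsymbol x=\mathbb P_1\{\boldsymbol X(t)\in d\boldsymbol x,V(t)=\vec v_j\}$ on $\mathrm{Int}(\mathcal T(t))$ (the absolutely continuous component of the law, in its continuous version). It depends on $(\lambda_1,\dots,\lambda_4)$. The limit is pointwise in $(\boldsymbol x,t)$, taken as all $\lambda_j\to+\infty$ with $\lambda_1/\lambda_i\to1$ for all $i$.
   Formalization: The bracket in the denominator of ξ is corrected to (τ1τ2τ3+τ1τ2τ4+τ1τ3τ4+τ2τ3τ4)^4; the printed sum of fourth powers is 64 times too large at x=0 and does not give a probability density. *)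

theory Defs
  imports "HOL-Probability.Probability"
begin

text \<open>
  Directions are indexed by the numeral type \<open>4\<close>, whose elements are written
  \<open>1, 2, 3, 4\<close> (with \<open>4 = 0\<close> and \<open>of_nat\<close> reducing modulo 4, so the index arithmetic is cyclic).
\<close>

definition dir :: "4 \<Rightarrow> real ^ 3" where
  "dir j =
     (if j = 1 then vector [1, 0, 0]
      else if j = 2 then vector [- 1/3, 2 * sqrt 2 / 3, 0]
      else if j = 3 then vector [- 1/3, - sqrt 2 / 3, sqrt (2/3)]
      else vector [- 1/3, - sqrt 2 / 3, - sqrt (2/3)])"

definition tetra :: "real \<Rightarrow> real \<Rightarrow> (real ^ 3) set" where
  "tetra c t = convex hull (range (\<lambda>j. (c * t) *\<^sub>R dir j))"

definition matA :: "real \<Rightarrow> real ^ 4 ^ 4" where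
  "matA c = (\<chi> i j. if i = 1 then c * dir j $ 1
                     else if i = 2 then c * dir j $ 2
                     else if i = 3 then c * dir j $ 3
                     else 1)"

text \<open>
  Interarrival times of a geometric counting process with intensity \<open>l\<close>: conditionally on an
  exponential random intensity \<open>\<alpha>\<close> of mean \<open>l\<close>, they are i.i.d. exponential with rate \<open>\<alpha>\<close>.
  Sequences are indexed from 0, so \<open>D k\<close> is the \<open>(k+1)\<close>-st interarrival time.
\<close>

definition gcp_interarrivals :: "'a measure \<Rightarrow> real \<Rightarrow> (nat \<Rightarrow> 'a \<Rightarrow> real) \<Rightarrow> bool" where
  "gcp_interarrivals M l D \<longleftrightarrow>
     (\<forall>k. D k \<in> borel_measurable M) \<and>
     (\<exists>\<alpha>. distributed M lborel \<alpha> (\<lambda>a. ennreal (exponential_density (1 / l) a)) \<and>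
        (\<forall>n (B :: nat \<Rightarrow> real set). (\<forall>k<n. B k \<in> sets borel) \<longrightarrow>
           (AE \<omega> in M.
              real_cond_exp M (vimage_algebra (space M) \<alpha> borel)
                (indicator {\<omega> \<in> space M. \<forall>k<n. D k \<omega> \<in> B k}) \<omega> =
              (\<Prod>k<n. measure (density lborel (\<lambda>s. ennreal (exponential_density (\<alpha> \<omega>) s))) (B k)))))"

text \<open>Here \<open>D j k\<close> is the duration of the displacement along \<open>dir j\<close> in the \<open>(k+1)\<close>-st cycle.\<close>

definition gcp_durations :: "'a measure \<Rightarrow> real ^ 4 \<Rightarrow> (4 \<Rightarrow> nat \<Rightarrow> 'a \<Rightarrow> real) \<Rightarrow> bool" where
  "gcp_durations M l D \<longleftrightarrow>
     prob_space M \<and>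
     (\<forall>j. gcp_interarrivals M (l $ j) (D j)) \<and>
     prob_space.indep_vars M (\<lambda>_. Pi\<^sub>M UNIV (\<lambda>_::nat. borel)) (\<lambda>j \<omega> k. D j k \<omega>) UNIV"

definition total_dur :: "(4 \<Rightarrow> nat \<Rightarrow> 'a \<Rightarrow> real) \<Rightarrow> 4 \<Rightarrow> nat \<Rightarrow> 'a \<Rightarrow> real" where
  "total_dur D j k \<omega> = (\<Sum>i<k. D j i \<omega>)"

text \<open>A positive index \<open>m\<close> is decomposed as \<open>m = 4 * n + j\<close> with \<open>1 \<le> j \<le> 4\<close>.\<close>

definition switch_time :: "(4 \<Rightarrow> nat \<Rightarrow> 'a \<Rightarrow> real) \<Rightarrow> nat \<Rightarrow> 'a \<Rightarrow> real" where
  "switch_time D m \<omega> =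
     (if m = 0 then 0
      else let n = (m - 1) div 4; j = (m - 1) mod 4 + 1 in
        (\<Sum>r = 1..j. total_dur D (of_nat r) (n + 1) \<omega>) +
        (\<Sum>r = j + 1..4. total_dur D (of_nat r) n \<omega>))"

text \<open>
  Almost surely the switching times increase strictly to infinity, so that \<open>m\<close> below is the
  unique index with \<open>T m \<le> t < T (m + 1)\<close>.
\<close>

definition velocity :: "(4 \<Rightarrow> nat \<Rightarrow> 'a \<Rightarrow> real) \<Rightarrow> real \<Rightarrow> 'a \<Rightarrow> real ^ 3" where
  "velocity D t \<omega> =
     (let m = (LEAST m. switch_time D m \<omega> \<le> t \<and> t < switch_time D (m + 1) \<omega>)
      in dir (of_nat (m mod 4 + 1)))"

definition position :: "real \<Rightarrow> (4 \<Rightarrow> nat \<Rightarrow> 'a \<Rightarrow> real) \<Rightarrow> real \<Rightarrow> 'a \<Rightarrow> real ^ 3" where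
  "position c D t \<omega> = c *\<^sub>R (LINT s:{0..t}|lborel. velocity D s \<omega>)"

text \<open>
  The continuous density of \<open>B \<mapsto> P\<^sub>1 (X(t) \<in> B, V(t) = dir j)\<close> on the interior of the
  tetrahedron. Extending it by 0 makes it unique as a function on the whole space.
\<close>

definition is_dens1 ::
  "'a measure \<Rightarrow> real \<Rightarrow> (4 \<Rightarrow> nat \<Rightarrow> 'a \<Rightarrow> real) \<Rightarrow> 4 \<Rightarrow> real \<Rightarrow> (real ^ 3 \<Rightarrow> real) \<Rightarrow> bool" where
  "is_dens1 M c D j t f \<longleftrightarrow>
     continuous_on (interior (tetra c t)) f \<and>
     (\<forall>x \<in> interior (tetra c t). 0 \<le> f x) \<and>
     (\<forall>x. x \<notin> interior (tetra c t) \<longrightarrow> f x = 0) \<and>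
     (\<forall>B \<in> sets borel. B \<subseteq> interior (tetra c t) \<longrightarrow>
        ennreal (\<P>(\<omega> in M. position c D t \<omega> \<in> B \<and> velocity D t \<omega> = dir j
                    \<bar> position c D 0 \<omega> = 0 \<and> velocity D 0 \<omega> = dir 1)) =
        (\<integral>\<^sup>+ x \<in> B. ennreal (f x) \<partial>lborel))"

definition dens1j ::
  "'a measure \<Rightarrow> real \<Rightarrow> (4 \<Rightarrow> nat \<Rightarrow> 'a \<Rightarrow> real) \<Rightarrow> 4 \<Rightarrow> real ^ 3 \<Rightarrow> real \<Rightarrow> real" where
  "dens1j M c D j x t = (THE f. is_dens1 M c D j t f) x"

definition dens1 ::
  "'a measure \<Rightarrow> real \<Rightarrow> (4 \<Rightarrow> nat \<Rightarrow> 'a \<Rightarrow> real) \<Rightarrow> real ^ 3 \<Rightarrow> real \<Rightarrow> real" where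
  "dens1 M c D x t = (\<Sum>j\<in>UNIV. dens1j M c D j x t)"

text \<open>The filter of \<open>l\<close> with every \<open>l\<^sub>j \<rightarrow> \<infinity>\<close> and every ratio \<open>l\<^sub>1 / l\<^sub>i \<rightarrow> 1\<close>.\<close>

definition intensities_at_top :: "(real ^ 4) filter" where
  "intensities_at_top =
     inf (INF j. filtercomap (\<lambda>l. l $ j) at_top)
         (INF i. filtercomap (\<lambda>l. l $ 1 / l $ i) (nhds 1))"

definition tau :: "real \<Rightarrow> 4 \<Rightarrow> real ^ 3 \<Rightarrow> real \<Rightarrow> real" where
  "tau c j x t =
     (if j = 1 then (c * t + 3 * x $ 1) / (4 * c)
      else if j = 2 then (c * t - x $ 1 + 2 * sqrt 2 * x $ 2) / (4 * c)
      else if j = 3 then (c * t - x $ 1 - sqrt 2 * x $ 2 + sqrt 6 * x $ 3) / (4 * c)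
      else (c * t - x $ 1 - sqrt 2 * x $ 2 - sqrt 6 * x $ 3) / (4 * c))"

text \<open>
  The fourth power is that of the whole sum of triple products. With each triple product raised
  separately to the fourth power, the function would neither integrate to 1 over the interior of
  the tetrahedron nor be the limit of the densities (at the origin it would be 64 times too large).
\<close>

definition xi :: "real \<Rightarrow> real ^ 3 \<Rightarrow> real \<Rightarrow> real" where
  "xi c x t =
     (let t1 = tau c 1 x t; t2 = tau c 2 x t; t3 = tau c 3 x t; t4 = tau c 4 x t in
      6 * t * (t1 * t2 * t3 * t4)\<^sup>2 /
      (det (matA c) * (t1 * t2 * t3 + t1 * t2 * t4 + t1 * t3 * t4 + t2 * t3 * t4) ^ 4))"

definition pdf_on :: "(real ^ 3) set \<Rightarrow> (real ^ 3 \<Rightarrow> real) \<Rightarrow> bool" where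
  "pdf_on S f \<longleftrightarrow>
     set_borel_measurable lborel S f \<and> (\<forall>x \<in> S. 0 \<le> f x) \<and>
     (\<integral>\<^sup>+ x \<in> S. ennreal (f x) \<partial>lborel) = 1"

end

theory Submission
  imports Defs "HOL-Real_Asymp.Real_Asymp"
begin

text \<open>
  The position at time \<open>t\<close> is determined by the times \<open>\<tau>\<^sub>i\<close> spent in the four directions:
  \<open>x = \<Sum>\<^sub>i c \<tau>\<^sub>i v\<^sub>i\<close> with \<open>\<Sum>\<^sub>i \<tau>\<^sub>i = t\<close>. Since \<open>v\<^sub>i \<bullet> v\<^sub>j = -1/3\<close> for \<open>i \<noteq> j\<close>, the map
  \<open>(\<tau>\<^sub>i) \<mapsto> x\<close> is inverted by the affine functions \<^const>\<open>tau\<close>, the tetrahedron is the image of the simplex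
  \<open>\<tau>\<^sub>i \<ge> 0\<close> (\<open>interior_tetra\<close>), and any three of the \<open>\<tau>\<^sub>i\<close> are coordinates of space with
  Jacobian \<open>1 / det A\<close> (\<open>nn_integral_tau123\<close>, \<open>nn_integral_tau_triples\<close>).

  Mixing the Erlang distributions over the exponential intensity makes the law of the \<open>n\<close>-th arrival
  time of a geometric counting process explicit: its distribution function is
  \<open>(\<lambda> s / (1 + \<lambda> s))\<^sup>n\<close> (\<open>emeasure_gcp_arrival_le\<close>). Fix the number \<open>m\<close> of completed displacements. Then
  three of the \<open>\<tau>\<^sub>i\<close> are independent arrival times, and the fourth one, that of the current direction,
  is \<open>t\<close> minus their sum; it only has to lie between two consecutive arrival times of the fourth
  process. Independence and the change of coordinates give the density of the position on this event
  (\<open>path_law\<close>). With \<open>y\<^sub>i = \<lambda>\<^sub>i \<tau>\<^sub>i / (1 + \<lambda>\<^sub>i \<tau>\<^sub>i)\<close> and \<open>Y = y\<^sub>1 y\<^sub>2 y\<^sub>3 y\<^sub>4\<close> these densities are, for each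
  current direction and up to a factor independent of the cycle, a cubic polynomial in the number of cycles
  times a power of \<open>Y\<close>, so that their sum
  is a combination of \<open>1 / (1 - Y)\<^sup>4\<close>, \<open>1 / (1 - Y)\<^sup>3\<close> and \<open>1 / (1 - Y)\<^sup>2\<close> (\<open>path_density_sums\<close>). It is continuous,
  hence it is the density that the definite description in \<^const>\<open>dens1j\<close> selects
  (\<open>dens1_eq_sum_direction_density\<close>).

  When all intensities are asymptotic to the same large \<open>\<lambda>\<close>, one has \<open>\<lambda> (1 - Y) \<rightarrow> \<Sum>\<^sub>i 1 / \<tau>\<^sub>i\<close>, and the pole of order
  four dominates. It leaves \<open>6 \<tau>\<^sub>j / ((\<Prod>\<^sub>i \<tau>\<^sub>i)\<^sup>2 (\<Sum>\<^sub>i 1 / \<tau>\<^sub>i)\<^sup>4 det A)\<close> for the current direction \<open>j\<close>, and summing over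
  \<open>j\<close> replaces \<open>\<tau>\<^sub>j\<close> by \<open>t\<close>, which is \<^const>\<open>xi\<close> (\<open>tendsto_sum_direction_density\<close>).

  That \<^const>\<open>xi\<close> has integral 1 comes from its own probabilistic meaning: if \<open>E\<^sub>i\<close> are independent
  standard exponential variables and \<open>W\<^sub>i = 1 / E\<^sub>i\<close>, then \<open>t W\<^sub>i / \<Sum>\<^sub>k W\<^sub>k\<close> has the density of the limiting
  occupation times. The substitution \<open>W\<^sub>i = s \<tau>\<^sub>i\<close> with \<open>\<Sum>\<^sub>i \<tau>\<^sub>i = t\<close> turns the total mass of \<open>(W\<^sub>i)\<close>, which is 1,
  into the integral of \<^const>\<open>xi\<close> (\<open>nn_integral_simplex_density\<close>, \<open>pdf_on_xi\<close>).
\<close>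

section \<open>The tetrahedron in barycentric coordinates\<close>

lemma sqrt_two_thirds: "sqrt (2/3) = sqrt 6 / 3"
proof -
  have "sqrt (2/3) = sqrt (6 / 3\<^sup>2)" by simp
  also have "\<dots> = sqrt 6 / 3" unfolding real_sqrt_divide by simp
  finally show ?thesis .
qed

text \<open>
  This form makes the four coordinates symmetric, so that the barycentric description of the tetrahedron
  below only uses the inner products of the directions.
\<close>
lemma tau_eq_inner: "tau c j x t = (c * t + 3 * (dir j \<bullet> x)) / (4 * c)"
  using exhaust_4[of j]
  by (elim disjE; simp add: tau_def dir_def inner_vec_def sum_3 sqrt_two_thirds algebra_simps)

lemma inner_dir: "dir i \<bullet> dir j = (if i = j then 1 else - 1 / 3)"
  using exhaust_4[of i] exhaust_4[of j]
  by (elim disjE; simp add: dir_def inner_vec_def sum_3 sqrt_two_thirds field_simps)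

lemma sum_dir: "(\<Sum>j\<in>UNIV. dir j) = 0"
  by (simp add: vec_eq_iff forall_3 sum_4 dir_def)

lemma frame_dir: "(\<Sum>j\<in>UNIV. (dir j \<bullet> x) *\<^sub>R dir j) = (4 / 3) *\<^sub>R x"
  by (simp add: vec_eq_iff forall_3 sum_4 dir_def inner_vec_def sum_3 sqrt_two_thirds) (simp add: field_simps)

lemma det_matA: "det (matA c) = 16 * sqrt 3 / 9 * c ^ 3"
proof -
  have f1234: "finite {2::4, 3, 4}" "1 \<notin> {2::4, 3, 4}" by auto
  have f234: "finite {3::4, 4}" "2 \<notin> {3::4, 4}" by auto
  have f34: "finite {4::4}" "3 \<notin> {4::4}" by auto
  have s: "sqrt 6 = sqrt 2 * sqrt 3" by (simp flip: real_sqrt_mult)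
  show ?thesis
    unfolding det_def UNIV_4
    unfolding sum_over_permutations_insert[OF f1234] sum_over_permutations_insert[OF f234]
        sum_over_permutations_insert[OF f34]
    unfolding permutes_sing
    apply (simp add: sign_swap_id sign_compose permutation_compose permutation_swap_id  swap_id_eq matA_def
        dir_def sqrt_two_thirds)
    apply (simp add: s power3_eq_cube field_simps)
    done
qed

lemma sum_tau: "c \<noteq> 0 \<Longrightarrow> (\<Sum>j\<in>UNIV. tau c j x t) = t"
  by (simp add: sum_4 tau_def field_simps)

text \<open>
  The four directions form a tight frame of vanishing sum (\<open>frame_dir\<close>, \<open>sum_dir\<close>):
  the constant parts of the coordinates cancel and the linear parts reproduce \<open>x\<close>.
\<close>
lemma sum_tau_dir:
  assumes "c \<noteq> 0"
  shows "(\<Sum>j\<in>UNIV. (c * tau c j x t) *\<^sub>R dir j) = x"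
proof -
  have "(c * tau c j x t) *\<^sub>R dir j = (c * t / 4) *\<^sub>R dir j + (3 / 4) *\<^sub>R ((dir j \<bullet> x) *\<^sub>R dir j)" for j
    using assms by (simp add: tau_eq_inner algebra_simps add_divide_distrib flip: scaleR_add_left)
  then have "(\<Sum>j\<in>UNIV. (c * tau c j x t) *\<^sub>R dir j)
      = (c * t / 4) *\<^sub>R (\<Sum>j\<in>UNIV. dir j) + (3 / 4) *\<^sub>R (\<Sum>j\<in>UNIV. (dir j \<bullet> x) *\<^sub>R dir j)"
    by (simp add: sum.distrib scaleR_sum_right)
  then show ?thesis by (simp add: sum_dir frame_dir)
qed

text \<open>
  Conversely the coordinates recover the weights of any combination of the directions; this is what
  identifies them with occupation times later on.
\<close>
lemma tau_barycentric:
  assumes "c \<noteq> 0" "(\<Sum>j\<in>UNIV. u j) = t"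
  shows "tau c i (\<Sum>j\<in>UNIV. (c * u j) *\<^sub>R dir j) t = u i"
proof -
  have "dir i \<bullet> (\<Sum>j\<in>UNIV. (c * u j) *\<^sub>R dir j) = (\<Sum>j\<in>UNIV. c * u j * (if i = j then 1 else - 1 / 3))"
    by (simp add: inner_sum_right inner_dir)
  also have "\<dots> = (\<Sum>j\<in>UNIV. (4 / 3) * (if i = j then c * u j else 0) - c * u j / 3)"
    by (intro sum.cong) auto
  also have "\<dots> = 4 / 3 * (\<Sum>j\<in>UNIV. if i = j then c * u j else 0) - c * (\<Sum>j\<in>UNIV. u j) / 3"
    by (simp only: sum_subtractf sum_distrib_left sum_divide_distrib)
  also have "\<dots> = 4 / 3 * c * u i - c * t / 3"
    using assms(2) by simp
  finally show ?thesis using assms(1) by (simp add: tau_eq_inner field_simps)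
qed

lemma tetra_eq_tau_nonneg:
  assumes "c > 0" "t > 0"
  shows "tetra c t = {x. \<forall>j. 0 \<le> tau c j x t}"
proof -
  have inj: "inj (\<lambda>j. (c * t) *\<^sub>R dir j)"
  proof (rule injI)
    fix i j assume "(c * t) *\<^sub>R dir i = (c * t) *\<^sub>R dir j"
    then have "dir i = dir j" using assms by simp
    then show "i = j" using inner_dir[of i j] inner_dir[of j j] by (auto split: if_splits)
  qed
  show ?thesis
  proof (intro set_eqI iffI)
    fix x assume "x \<in> tetra c t"
    then obtain u where u: "\<And>j. 0 \<le> u ((c * t) *\<^sub>R dir j)" "sum u (range (\<lambda>j. (c * t) *\<^sub>R dir j)) = 1"
       "(\<Sum>v\<in>range (\<lambda>j. (c * t) *\<^sub>R dir j). u v *\<^sub>R v) = x"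
      unfolding tetra_def convex_hull_finite[OF finite_imageI[OF finite]] by auto
    define w where "w j = t * u ((c * t) *\<^sub>R dir j)" for j
    have "(\<Sum>j\<in>UNIV. w j) = t"
      using u(2) unfolding w_def sum.reindex[OF inj] o_def by (simp flip: sum_distrib_left)
    moreover have "x = (\<Sum>j\<in>UNIV. (c * w j) *\<^sub>R dir j)"
      using u(3) unfolding w_def sum.reindex[OF inj] o_def by (simp add: ac_simps)
    ultimately have "tau c i x t = w i" for i
      using tau_barycentric[of c w t i] assms by simp
    then show "x \<in> {x. \<forall>j. 0 \<le> tau c j x t}" using u(1) assms by (simp add: w_def)
  next
    fix x assume x: "x \<in> {x. \<forall>j. 0 \<le> tau c j x t}"
    have "(\<Sum>j\<in>UNIV. (tau c j x t / t) *\<^sub>R ((c * t) *\<^sub>R dir j)) \<in> tetra c t"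
      unfolding tetra_def
    proof (rule convex_sum)
      show "(\<Sum>j\<in>UNIV. tau c j x t / t) = 1"
        using sum_tau[of c x t] assms by (simp flip: sum_divide_distrib)
    qed (use x assms in \<open>auto intro: hull_inc\<close>)
    also have "(\<Sum>j\<in>UNIV. (tau c j x t / t) *\<^sub>R ((c * t) *\<^sub>R dir j)) = x"
      using sum_tau_dir[of c x t] assms by (simp add: ac_simps)
    finally show "x \<in> tetra c t" .
  qed
qed

lemma continuous_tau: "continuous_on S (\<lambda>x. tau c j x t)"
  unfolding tau_eq_inner by (cases "c = 0") (auto intro!: continuous_intros)

lemma borel_measurable_tau [measurable]: "(\<lambda>x. tau c j x t) \<in> borel_measurable borel"
  by (rule borel_measurable_continuous_onI[OF continuous_tau])

text \<open>
  A point with \<open>\<tau>\<^sub>j = 0\<close> is not interior: a small step against \<open>dir j\<close> makes that coordinate negative.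
\<close>
lemma interior_tetra:
  assumes "c > 0" "t > 0"
  shows "interior (tetra c t) = {x. \<forall>j. 0 < tau c j x t}"
proof (rule interior_unique)
  show "{x. \<forall>j. 0 < tau c j x t} \<subseteq> tetra c t"
    unfolding tetra_eq_tau_nonneg[OF assms] by (auto intro: less_imp_le)
  have "open {x. 0 < tau c j x t}" for j
    by (intro open_Collect_less continuous_tau continuous_on_const)
  then have "open (\<Inter>j. {x. 0 < tau c j x t})" by (intro open_INT) auto
  then show "open {x. \<forall>j. 0 < tau c j x t}" by (simp add: Collect_all_eq)
next
  fix T assume T: "T \<subseteq> tetra c t" "open T"
  show "T \<subseteq> {x. \<forall>j. 0 < tau c j x t}"
  proof safe
    fix x j assume x: "x \<in> T"
    obtain e where e: "e > 0" "ball x e \<subseteq> T" using T x openE by blast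
    \<comment> \<open>the half keeps \<open>y\<close> inside the open ball\<close>
    define y where "y = x - (e / 2) *\<^sub>R dir j"
    have "norm (dir j) = 1" using inner_dir[of j j] by (simp add: norm_eq_sqrt_inner)
    then have "y \<in> ball x e" using e by (simp add: y_def dist_norm)
    then have "y \<in> tetra c t" using e T by blast
    then have "0 \<le> tau c j y t" unfolding tetra_eq_tau_nonneg[OF assms] by auto
    moreover have "tau c j y t = tau c j x t - 3 * e / (8 * c)"
      using assms unfolding y_def by (simp add: tau_eq_inner inner_diff_right inner_dir field_simps)
    moreover have "3 * e / (8 * c) > 0" using e assms by simp
    ultimately show "0 < tau c j x t" by linarith
  qed
qed

section \<open>Occupation times as coordinates of space\<close>

lemma nn_integral_lborel_vec3:
  fixes f :: "real ^ 3 \<Rightarrow> ennreal"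
  assumes [measurable]: "f \<in> borel_measurable borel"
  shows "(\<integral>\<^sup>+ x. f x \<partial>lborel) = (\<integral>\<^sup>+ a. \<integral>\<^sup>+ b. \<integral>\<^sup>+ d. f (vector [a, b, d]) \<partial>lborel \<partial>lborel \<partial>lborel)"
proof -
  have v: "(vector [a, b, d] :: real ^ 3) = a *\<^sub>R axis 1 1 + b *\<^sub>R axis 2 1
      + d *\<^sub>R axis 3 1" for a b d :: real
    by (simp add: vec_eq_iff forall_3 axis_def)
  have m[measurable]: "(\<lambda>(a, b, d). vector [a, b, d] :: real ^ 3) \<in> borel_measurable (lborel \<Otimes>\<^sub>M lborel \<Otimes>\<^sub>M
      lborel)"
    unfolding v by measurable
  have "lborel = distr (lborel \<Otimes>\<^sub>M lborel \<Otimes>\<^sub>M lborel) borel (\<lambda>(a, b, d). vector [a, b, d] :: real ^ 3)"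
  proof (rule lborel_eqI)
    fix l u :: "real ^ 3" assume le: "\<And>b. b \<in> Basis \<Longrightarrow> l \<bullet> b \<le> u \<bullet> b"
    have le': "l $ i \<le> u $ i" for i using le[of "axis i 1"] by (simp add: axis_in_Basis_iff inner_axis)
    have "(\<lambda>(a, b, d). vector [a, b, d] :: real ^ 3) -` box l u \<inter> space (lborel \<Otimes>\<^sub>M lborel \<Otimes>\<^sub>M lborel)
       = {l $ 1<..<u $ 1} \<times> ({l $ 2<..<u $ 2} \<times> {l $ 3<..<u $ 3})"
      by (auto simp: mem_box_cart forall_3 space_pair_measure)
    moreover have "emeasure (lborel \<Otimes>\<^sub>M lborel \<Otimes>\<^sub>M lborel) ({l $ 1<..<u $ 1} \<times> ({l $ 2<..<u $ 2} \<times> {l $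
        3<..<u $ 3}))
       = ennreal (u $ 1 - l $ 1) * emeasure (lborel \<Otimes>\<^sub>M lborel) ({l $ 2<..<u $ 2} \<times> {l $ 3<..<u $ 3})"
      unfolding lborel_prod[where ?'a = real and ?'b = real]
      using le'[of 1] by (subst lborel.emeasure_pair_measure_Times) (auto intro: borel_Times)
    moreover have "emeasure (lborel \<Otimes>\<^sub>M lborel) ({l $ 2<..<u $ 2} \<times> {l $ 3<..<u $ 3})
       = ennreal (u $ 2 - l $ 2) * ennreal (u $ 3 - l $ 3)"
      using le' by (subst lborel.emeasure_pair_measure_Times) auto
    ultimately have "emeasure (distr (lborel \<Otimes>\<^sub>M lborel \<Otimes>\<^sub>M lborel) borel (\<lambda>(a, b, d). vector [a, b, d] ::
        real ^ 3)) (box l u)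
       = ennreal (u $ 1 - l $ 1) * (ennreal (u $ 2 - l $ 2) * ennreal (u $ 3 - l $ 3))"
      by (subst emeasure_distr[OF m]) auto
    also have "\<dots> = ennreal (\<Prod>i\<in>UNIV. (u - l) $ i)"
    proof -
      have "(\<Prod>i\<in>UNIV. (u - l) $ i) = (\<Prod>i\<in>{1, 2, 3}. (u - l) $ i)"
        by (simp only: UNIV_3)
      also have "\<dots> = (u $ 1 - l $ 1) * ((u $ 2 - l $ 2) * (u $ 3 - l $ 3))"
        by simp
      finally show ?thesis
        using le' by (simp only: ennreal_mult diff_ge_0_iff_ge mult_nonneg_nonneg)
    qed
    also have "(\<Prod>i\<in>UNIV. (u - l) $ i) = (\<Prod>b\<in>Basis. (u - l) \<bullet> b)"
    proof -
      have B: "(Basis :: (real ^ 3) set) = range (\<lambda>i. axis i 1)" by (auto simp: Basis_vec_def)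
      have "inj (\<lambda>i :: 3. axis i (1 :: real))" by (auto intro!: injI simp: axis_eq_axis)
      then show ?thesis unfolding B by (simp add: prod.reindex inner_axis)
    qed
    finally show "emeasure (distr (lborel \<Otimes>\<^sub>M lborel \<Otimes>\<^sub>M lborel) borel (\<lambda>(a, b, d). vector [a, b, d] :: real
        ^ 3)) (box l u)
       = ennreal (\<Prod>b\<in>Basis. (u - l) \<bullet> b)" .
  qed simp
  then have "(\<integral>\<^sup>+ x. f x \<partial>lborel)
      = (\<integral>\<^sup>+ x. f x \<partial>distr (lborel \<Otimes>\<^sub>M lborel \<Otimes>\<^sub>M lborel) borel (\<lambda>(a, b, d). vector [a, b, d] :: real ^ 3))"
    by (rule arg_cong)
  also have "\<dots> = (\<integral>\<^sup>+ p. f (case p of (a, b, d) \<Rightarrow> vector [a, b, d]) \<partial>(lborel \<Otimes>\<^sub>M lborel \<Otimes>\<^sub>M lborel))"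
    by (subst nn_integral_distr[OF m]) simp_all
  also have "\<dots> = (\<integral>\<^sup>+ a. \<integral>\<^sup>+ q. f (case (a, q) of (a, b, d) \<Rightarrow> vector [a, b, d]) \<partial>(lborel \<Otimes>\<^sub>M lborel) \<partial>lborel)"
  proof -
    have "(\<lambda>p. f (case p of (a, b, d) \<Rightarrow> vector [a, b, d])) \<in> borel_measurable (lborel \<Otimes>\<^sub>M (lborel :: (real \<times>
        real) measure))"
      using measurable_compose[OF m assms] unfolding lborel_prod .
    from lborel.nn_integral_fst[OF this] show ?thesis
      unfolding lborel_prod[where ?'a = real and ?'b = real] by (rule sym)
  qed
  also have "\<dots> = (\<integral>\<^sup>+ a. \<integral>\<^sup>+ b. \<integral>\<^sup>+ d. f (vector [a, b, d]) \<partial>lborel \<partial>lborel \<partial>lborel)"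
  proof (rule nn_integral_cong)
    fix a :: real
    have "(\<lambda>q. f (case (a, q) of (a, b, d) \<Rightarrow> vector [a, b, d])) \<in> borel_measurable (lborel \<Otimes>\<^sub>M lborel)"
      by (rule measurable_compose[OF measurable_compose[OF measurable_Pair1' m] assms]) simp
    from lborel.nn_integral_fst[OF this]
    show "(\<integral>\<^sup>+ q. f (case (a, q) of (a, b, d) \<Rightarrow> vector [a, b, d]) \<partial>(lborel \<Otimes>\<^sub>M lborel))
        = (\<integral>\<^sup>+ b. \<integral>\<^sup>+ d. f (vector [a, b, d]) \<partial>lborel \<partial>lborel)"
      by simp
  qed
  finally show ?thesis .
qed

lemma nn_integral_reflect:
  fixes f :: "real \<Rightarrow> ennreal"
  assumes [measurable]: "f \<in> borel_measurable borel"
  shows "(\<integral>\<^sup>+ x. f (s - x) \<partial>lborel) = (\<integral>\<^sup>+ x. f x \<partial>lborel)"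
  using nn_integral_real_affine[OF assms, of "- 1" s] by simp

text \<open>
  The first three coordinates are triangular: \<open>\<tau>\<^sub>1\<close> depends on \<open>x\<^sub>1\<close> only and \<open>\<tau>\<^sub>2\<close> on \<open>x\<^sub>1\<close> and \<open>x\<^sub>2\<close> only. Hence three
  one-dimensional affine substitutions suffice, and the product of their factors is the determinant.
\<close>
lemma nn_integral_tau123:
  fixes G :: "real \<times> real \<times> real \<Rightarrow> ennreal"
  assumes [measurable]: "G \<in> borel_measurable borel" and c: "c > 0"
  shows "(\<integral>\<^sup>+ x. G (tau c 1 x t, tau c 2 x t, tau c 3 x t) \<partial>lborel) =
     ennreal (det (matA c)) * (\<integral>\<^sup>+ a. \<integral>\<^sup>+ b. \<integral>\<^sup>+ d. G (a, b, d) \<partial>lborel \<partial>lborel \<partial>lborel)"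
proof -
  have scale: "(\<integral>\<^sup>+ x. f (s + k * x) \<partial>lborel) = ennreal (1 / k) * (\<integral>\<^sup>+ x. f x \<partial>lborel)"
    if [measurable]: "f \<in> borel_measurable borel" and k: "k > 0" for f :: "real \<Rightarrow> ennreal" and s k
  proof -
    have "(\<integral>\<^sup>+ x. f x \<partial>lborel) = ennreal k * (\<integral>\<^sup>+ x. f (s + k * x) \<partial>lborel)"
      using nn_integral_real_affine[OF that(1), of k s] k by simp
    then have "ennreal (1 / k) * (\<integral>\<^sup>+ x. f x \<partial>lborel)
        = (ennreal (1 / k) * ennreal k) * (\<integral>\<^sup>+ x. f (s + k * x) \<partial>lborel)"
      by (simp add: mult.assoc)
    then show ?thesis using k by (simp flip: ennreal_mult)
  qed
  \<comment> \<open>each coordinate is affine in one new variable, so that \<open>scale\<close> applies from the inside out\<close>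
  have t1: "tau c 1 (vector [a, b, d]) t = t / 4 + (3 / (4 * c)) * a" for a b d
    using c by (simp add: tau_def field_simps)
  have t2: "tau c 2 (vector [a, b, d]) t = (c * t - a) / (4 * c) + (2 * sqrt 2 / (4 * c)) * b" for a b d
    using c by (simp add: tau_def field_simps)
  have t3: "tau c 3 (vector [a, b, d]) t = (c * t - a - sqrt 2 * b) / (4 * c) + (sqrt 6 / (4 * c))
      * d" for a b d
    using c by (simp add: tau_def field_simps)
  have jac: "1 / (sqrt 6 / (4 * c)) * (1 / (2 * sqrt 2 / (4 * c)) * (1 / (3 / (4 * c)))) = det (matA c)"
  proof -
    have "1 / (sqrt 6 / (4 * c)) * (1 / (2 * sqrt 2 / (4 * c)) * (1 / (3 / (4 * c))))
        = 64 * c ^ 3 / (6 * (sqrt 6 * sqrt 2))"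
      by (simp add: power3_eq_cube)
    also have "sqrt 6 * sqrt 2 = 2 * sqrt 3"
    proof -
      have "sqrt 6 * sqrt 2 = sqrt (2\<^sup>2 * 3)" unfolding real_sqrt_mult[symmetric] by simp
      then show ?thesis unfolding real_sqrt_mult by simp
    qed
    also have "64 * c ^ 3 / (6 * (2 * sqrt 3)) = 16 * (1 / sqrt 3) * c ^ 3 / 3"
      by simp
    also have "1 / sqrt 3 = sqrt 3 / 3"
      by (simp add: field_simps)
    finally show ?thesis by (simp add: det_matA)
  qed
  have "(\<integral>\<^sup>+ x. G (tau c 1 x t, tau c 2 x t, tau c 3 x t) \<partial>lborel) =
     (\<integral>\<^sup>+ a. \<integral>\<^sup>+ b. \<integral>\<^sup>+ d. G (t / 4 + (3 / (4 * c)) * a, (c * t - a) / (4 * c) + (2 * sqrt 2 / (4 * c)) * b,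
        (c * t - a - sqrt 2 * b) / (4 * c) + (sqrt 6 / (4 * c)) * d) \<partial>lborel \<partial>lborel \<partial>lborel)"
    by (subst nn_integral_lborel_vec3) (measurable, simp only: t1 t2 t3)
  also have "\<dots> = (\<integral>\<^sup>+ a. \<integral>\<^sup>+ b. ennreal (1 / (sqrt 6 / (4 * c))) * (\<integral>\<^sup>+ d. G (t / 4 + (3 / (4 * c)) * a, (c
      * t - a) / (4 * c) + (2 * sqrt 2 / (4 * c)) * b,
        d) \<partial>lborel) \<partial>lborel \<partial>lborel)"
    using c by (intro nn_integral_cong scale) auto
  also have "\<dots> = ennreal (1 / (sqrt 6 / (4 * c))) * (\<integral>\<^sup>+ a. \<integral>\<^sup>+ b. (\<integral>\<^sup>+ d. G (t / 4 + (3 / (4 * c)) * a, (c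
      * t - a) / (4 * c) + (2 * sqrt 2 / (4 * c)) * b,
        d) \<partial>lborel) \<partial>lborel \<partial>lborel)"
    by (simp add: nn_integral_cmult)
  also have "(\<integral>\<^sup>+ a. \<integral>\<^sup>+ b. (\<integral>\<^sup>+ d. G (t / 4 + (3 / (4 * c)) * a, (c * t - a) / (4 * c) + (2 * sqrt 2 / (4
      * c)) * b,
        d) \<partial>lborel) \<partial>lborel \<partial>lborel) = (\<integral>\<^sup>+ a. ennreal (1 / (2 * sqrt 2 / (4 * c)))
            * (\<integral>\<^sup>+ b. (\<integral>\<^sup>+ d. G (t / 4 + (3 / (4 * c)) * a, b,
        d) \<partial>lborel) \<partial>lborel) \<partial>lborel)"
    using c by (intro nn_integral_cong scale) auto
  also have "\<dots> = ennreal (1 / (2 * sqrt 2 / (4 * c))) * (\<integral>\<^sup>+ a. (\<integral>\<^sup>+ b. (\<integral>\<^sup>+ d. G (t / 4 + (3 / (4 * c))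
      * a, b,
        d) \<partial>lborel) \<partial>lborel) \<partial>lborel)"
    by (simp add: nn_integral_cmult)
  also have "(\<integral>\<^sup>+ a. (\<integral>\<^sup>+ b. (\<integral>\<^sup>+ d. G (t / 4 + (3 / (4 * c)) * a, b, d) \<partial>lborel) \<partial>lborel) \<partial>lborel) =
      ennreal (1 / (3 / (4 * c))) * (\<integral>\<^sup>+ a. \<integral>\<^sup>+ b. \<integral>\<^sup>+ d. G (a, b, d) \<partial>lborel \<partial>lborel \<partial>lborel)"
    using c by (intro scale) auto
  finally have *: "(\<integral>\<^sup>+ x. G (tau c 1 x t, tau c 2 x t, tau c 3 x t) \<partial>lborel) =
     ennreal (1 / (sqrt 6 / (4 * c))) * (ennreal (1 / (2 * sqrt 2 / (4 * c))) * (ennreal (1 / (3 / (4 * c))) *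
       (\<integral>\<^sup>+ a. \<integral>\<^sup>+ b. \<integral>\<^sup>+ d. G (a, b, d) \<partial>lborel \<partial>lborel \<partial>lborel)))" .
  have mult3: "ennreal (p * (q * r)) * I = ennreal p * (ennreal q * (ennreal r * I))"
    if "p \<ge> 0" "q \<ge> 0" "r \<ge> 0" for p q r I
    using that by (simp add: ennreal_mult mult.assoc)
  show ?thesis
    unfolding * jac[symmetric] by (rule mult3[symmetric]) (use c in simp_all)
qed

text \<open>
  On the hyperplane \<open>\<Sum>\<^sub>i \<tau>\<^sub>i = t\<close> any coordinate may be exchanged for the missing one by a reflection
  \<open>w \<mapsto> r - w\<close> of the innermost variable, which preserves Lebesgue measure.
\<close>
lemma nn_integral_tau_triples:
  fixes G :: "real \<times> real \<times> real \<Rightarrow> ennreal"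
  assumes [measurable]: "G \<in> borel_measurable borel" and c: "c > 0"
  shows nn_integral_tau124: "(\<integral>\<^sup>+ x. G (tau c 1 x t, tau c 2 x t, tau c 4 x t) \<partial>lborel) =
     ennreal (det (matA c)) * (\<integral>\<^sup>+ a. \<integral>\<^sup>+ b. \<integral>\<^sup>+ d. G (a, b, d) \<partial>lborel \<partial>lborel \<partial>lborel)" (is ?A)
  and nn_integral_tau134: "(\<integral>\<^sup>+ x. G (tau c 1 x t, tau c 3 x t, tau c 4 x t) \<partial>lborel) =
     ennreal (det (matA c)) * (\<integral>\<^sup>+ a. \<integral>\<^sup>+ b. \<integral>\<^sup>+ d. G (a, b, d) \<partial>lborel \<partial>lborel \<partial>lborel)" (is ?B)
  and nn_integral_tau234: "(\<integral>\<^sup>+ x. G (tau c 2 x t, tau c 3 x t, tau c 4 x t) \<partial>lborel) =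
     ennreal (det (matA c)) * (\<integral>\<^sup>+ a. \<integral>\<^sup>+ b. \<integral>\<^sup>+ d. G (a, b, d) \<partial>lborel \<partial>lborel \<partial>lborel)" (is ?C)
proof -
  have t4: "tau c 4 x t = t - tau c 1 x t - tau c 2 x t - tau c 3 x t" for x
    using sum_tau[of c x t] c by (simp add: sum_4)
  have r: "(\<integral>\<^sup>+ d. G (a, b, s - d) \<partial>lborel) = (\<integral>\<^sup>+ d. G (a, b, d) \<partial>lborel)" for a b s
    by (rule nn_integral_reflect[of "\<lambda>d. G (a, b, d)"]) simp
  have Gp: "G \<in> borel_measurable (borel \<Otimes>\<^sub>M (borel \<Otimes>\<^sub>M borel))"
    using assms(1) by (simp only: borel_prod)
  have [measurable]: "(\<lambda>p. G (f p, g p, h p)) \<in> borel_measurable N"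
    if [measurable]: "f \<in> borel_measurable N" "g \<in> borel_measurable N" "h \<in> borel_measurable N"
    for f g h and N :: "'x measure"
    by (rule measurable_compose[OF _ Gp]) simp
  have m: "(\<lambda>(a, b, d). G (a, b, t - a - b - d)) \<in> borel_measurable (borel \<Otimes>\<^sub>M (borel \<Otimes>\<^sub>M borel))"
    "(\<lambda>(a, b, d). G (a, d, t - a - b - d)) \<in> borel_measurable (borel \<Otimes>\<^sub>M (borel \<Otimes>\<^sub>M borel))"
    "(\<lambda>(a, b, d). G (b, d, t - a - b - d)) \<in> borel_measurable (borel \<Otimes>\<^sub>M (borel \<Otimes>\<^sub>M borel))"
    by simp_all
  note base = nn_integral_tau123[OF m(1)[unfolded borel_prod] c, of t]
    nn_integral_tau123[OF m(2)[unfolded borel_prod] c, of t] nn_integral_tau123[OF m(3)[unfolded borel_prod]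
        c, of t]
  show ?A
    using base(1) unfolding t4 prod.case r .
  have "(\<integral>\<^sup>+ b. \<integral>\<^sup>+ d. G (a, d, t - a - b - d) \<partial>lborel \<partial>lborel)
     = (\<integral>\<^sup>+ d. \<integral>\<^sup>+ b. G (a, d, t - a - b - d) \<partial>lborel \<partial>lborel)" for a
    by (rule lborel_pair.Fubini') simp
  also have "(\<integral>\<^sup>+ d. \<integral>\<^sup>+ b. G (a, d, t - a - b - d) \<partial>lborel \<partial>lborel)
     = (\<integral>\<^sup>+ d. \<integral>\<^sup>+ b. G (a, d, (t - a - d) - b) \<partial>lborel \<partial>lborel)" for a
    by (intro nn_integral_cong arg_cong[where f=G]) simp
  finally have swap: "(\<integral>\<^sup>+ b. \<integral>\<^sup>+ d. G (a, d, t - a - b - d) \<partial>lborel \<partial>lborel)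
     = (\<integral>\<^sup>+ d. \<integral>\<^sup>+ b. G (a, d, b) \<partial>lborel \<partial>lborel)" for a
    unfolding r .
  show ?B
    using base(2) unfolding t4 prod.case swap .
  have "(\<integral>\<^sup>+ a. \<integral>\<^sup>+ b. \<integral>\<^sup>+ d. G (b, d, t - a - b - d) \<partial>lborel \<partial>lborel \<partial>lborel)
     = (\<integral>\<^sup>+ b. \<integral>\<^sup>+ a. \<integral>\<^sup>+ d. G (b, d, t - a - b - d) \<partial>lborel \<partial>lborel \<partial>lborel)"
    by (rule lborel_pair.Fubini') measurable
  also have "\<dots> = (\<integral>\<^sup>+ b. \<integral>\<^sup>+ d. \<integral>\<^sup>+ a. G (b, d, t - a - b - d) \<partial>lborel \<partial>lborel \<partial>lborel)"
    by (intro nn_integral_cong lborel_pair.Fubini') simp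
  also have "\<dots> = (\<integral>\<^sup>+ b. \<integral>\<^sup>+ d. \<integral>\<^sup>+ a. G (b, d, (t - b - d) - a) \<partial>lborel \<partial>lborel \<partial>lborel)"
    by (intro nn_integral_cong arg_cong[where f=G]) simp
  finally show ?C
    using base(3) unfolding t4 prod.case r by simp
qed

section \<open>Arrival times of a geometric counting process\<close>

abbreviation exp_law :: "real \<Rightarrow> real measure" where
  "exp_law a \<equiv> density lborel (\<lambda>s. ennreal (exponential_density a s))"

lemma borel_measurable_exponential_density2 [measurable (raw)]:
  assumes [measurable]: "f \<in> borel_measurable N" "g \<in> borel_measurable N"
  shows "(\<lambda>x. exponential_density (f x) (g x)) \<in> borel_measurable N"
  unfolding exponential_density_def by measurable

lemma borel_measurable_exp_law [measurable]:
  assumes B: "B \<in> sets borel"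
  shows "(\<lambda>a. emeasure (exp_law a) B) \<in> borel_measurable borel"
proof -
  have [measurable]: "B \<in> sets borel" by fact
  have "emeasure (exp_law a) B = (\<integral>\<^sup>+ s. ennreal (exponential_density a s) * indicator B s \<partial>lborel)" for a
    using B by (simp add: emeasure_density)
  moreover have "(\<lambda>a. \<integral>\<^sup>+ s. ennreal (exponential_density a s)
      * indicator B s \<partial>lborel) \<in> borel_measurable borel"
    by measurable
  ultimately show ?thesis by simp
qed

lemma emeasure_exp_law_scale:
  assumes a: "a > 0" and B[measurable]: "B \<in> sets borel"
  shows "emeasure (exp_law a) B = emeasure (exp_law 1) {z. z / a \<in> B}"
proof -
  have "emeasure (exp_law 1) {z. z / a \<in> B}
      = (\<integral>\<^sup>+ z. ennreal (exponential_density 1 z) * indicator B (z / a) \<partial>lborel)"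
    using a by (subst emeasure_density) (auto simp: indicator_def intro!: nn_integral_cong)
  also have "\<dots> = ennreal a * (\<integral>\<^sup>+ s. ennreal (exponential_density 1 (a * s)) * indicator B s \<partial>lborel)"
    using a by (subst nn_integral_real_affine[where c = a and t = 0]) auto
  also have "\<dots> = (\<integral>\<^sup>+ s. ennreal a * (ennreal (exponential_density 1 (a * s)) * indicator B s) \<partial>lborel)"
    by (rule nn_integral_cmult[symmetric]) measurable
  also have "\<dots> = (\<integral>\<^sup>+ s. ennreal (exponential_density a s) * indicator B s \<partial>lborel)"
    using a by (intro nn_integral_cong)
      (auto simp: exponential_density_def mult_less_0_iff ennreal_mult[symmetric] mult.commute split:
          split_indicator)
  also have "\<dots> = emeasure (exp_law a) B"
    by (subst emeasure_density) auto
  finally show ?thesis ..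
qed

lemma AE_exp_law_pos: "AE a in exp_law l. 0 < a"
proof (subst AE_density)
  have "AE a :: real in lborel. a \<noteq> 0" by (rule AE_lborel_singleton)
  then show "AE a in lborel. 0 < ennreal (exponential_density l a) \<longrightarrow> 0 < a"
    by eventually_elim (simp add: exponential_density_def)
qed simp

text \<open>
  Integrating the conditional probabilities against the law of the random intensity removes the
  conditioning: the joint law of the durations is a mixture of products of exponential laws.
\<close>
lemma emeasure_gcp_box:
  assumes M: "prob_space M" and l: "l > 0" and D: "gcp_interarrivals M l D"
    and B: "\<And>k. k < n \<Longrightarrow> B k \<in> sets borel"
  shows "emeasure M {\<omega> \<in> space M. \<forall>k<n. D k \<omega> \<in> B k} =
     (\<integral>\<^sup>+ a. (\<Prod>k<n. emeasure (exp_law a) (B k)) \<partial>exp_law (1 / l))"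
proof -
  interpret prob_space M by fact
  from D obtain \<alpha> where D_meas[measurable]: "\<And>k. D k \<in> borel_measurable M"
    and \<alpha>: "distributed M lborel \<alpha> (\<lambda>a. ennreal (exponential_density (1 / l) a))"
    and ce: "\<And>n (B :: nat \<Rightarrow> real set). (\<forall>k<n. B k \<in> sets borel) \<Longrightarrow>
           (AE \<omega> in M. real_cond_exp M (vimage_algebra (space M) \<alpha> borel)
                (indicator {\<omega> \<in> space M. \<forall>k<n. D k \<omega> \<in> B k}) \<omega> =
              (\<Prod>k<n. measure (exp_law (\<alpha> \<omega>)) (B k)))"
    unfolding gcp_interarrivals_def by blast
  let ?F = "vimage_algebra (space M) \<alpha> borel"
  have [measurable]: "\<alpha> \<in> borel_measurable M" using distributed_measurable[OF \<alpha>] by simp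
  have "subalgebra M ?F"
    by (auto simp: subalgebra_def sets_vimage_algebra2)
  then interpret finite_measure_subalgebra M ?F by unfold_locales
  define A where "A = {\<omega> \<in> space M. \<forall>k<n. D k \<omega> \<in> B k}"
  have A[measurable]: "A \<in> sets M"
  proof -
    have "{\<omega> \<in> space M. D k \<omega> \<in> B k} \<in> sets M" if "k < n" for k
      using measurable_sets[OF D_meas B[OF that]] by (simp add: vimage_def Int_def conj_commute)
    then have "{\<omega> \<in> space M. \<forall>k\<in>{..<n}. D k \<omega> \<in> B k} \<in> sets M"
      by (intro sets.sets_Collect_finite_All finite_lessThan) (simp only: lessThan_iff)
    then show ?thesis by (simp only: A_def lessThan_iff Ball_def)
  qed
  have ceA: "AE \<omega> in M. real_cond_exp M ?F (indicator A) \<omega> = (\<Prod>k<n. measure (exp_law (\<alpha> \<omega>)) (B k))"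
    unfolding A_def by (rule ce) (use B in blast)
  have int: "integrable M (indicator A :: _ \<Rightarrow> real)"
    by (rule integrable_real_indicator[OF A]) (simp add: emeasure_eq_measure)
  have null: "AE \<omega> in M. 0 < \<alpha> \<omega>"
  proof -
    have "AE a in distr M lborel \<alpha>. 0 < a"
      unfolding distributed_distr_eq_density[OF \<alpha>] by (rule AE_exp_law_pos)
    then show ?thesis by (subst (asm) AE_distr_iff) auto
  qed
  have prod_meas: "(\<lambda>a. \<Prod>k<n. emeasure (exp_law a) (B k)) \<in> borel_measurable borel"
    by (intro borel_measurable_prod_ennreal borel_measurable_exp_law) (simp add: B)
  have "emeasure M A = ennreal (\<integral>\<omega>. indicator A \<omega> \<partial>M)"
    using has_bochner_integral_integral_eq[OF has_bochner_integral_real_indicator[OF A]]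
    by (simp add: emeasure_eq_measure)
  also have "(\<integral>\<omega>. indicator A \<omega> \<partial>M) = (\<integral>\<omega>. real_cond_exp M ?F (indicator A) \<omega> \<partial>M)"
    by (rule real_cond_exp_int(2)[OF int, symmetric])
  also have "ennreal \<dots> = (\<integral>\<^sup>+ \<omega>. ennreal (real_cond_exp M ?F (indicator A) \<omega>) \<partial>M)"
  proof (rule nn_integral_eq_integral[symmetric])
    show "integrable M (real_cond_exp M ?F (indicator A))" by (rule real_cond_exp_int(1)[OF int])
    show "AE \<omega> in M. 0 \<le> real_cond_exp M ?F (indicator A) \<omega>"
      using ceA by eventually_elim (simp add: prod_nonneg)
  qed
  also have "\<dots> = (\<integral>\<^sup>+ \<omega>. (\<Prod>k<n. emeasure (exp_law (\<alpha> \<omega>)) (B k)) \<partial>M)"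
  proof (rule nn_integral_cong_AE)
    have eq: "ennreal (measure (exp_law a) X) = emeasure (exp_law a) X" if "a > 0" for a X
    proof -
      interpret E: prob_space "exp_law a" by (rule prob_space_exponential_density[OF that])
      show ?thesis by (simp add: E.emeasure_eq_measure)
    qed
    from null ceA show "AE \<omega> in M. ennreal (real_cond_exp M ?F (indicator A) \<omega>)
        = (\<Prod>k<n. emeasure (exp_law (\<alpha> \<omega>)) (B k))"
      by eventually_elim (simp add: eq flip: prod_ennreal)
  qed
  also have "\<dots> = (\<integral>\<^sup>+ a. ennreal (exponential_density (1 / l) a)
      * (\<Prod>k<n. emeasure (exp_law a) (B k)) \<partial>lborel)"
    by (rule distributed_nn_integral[OF \<alpha>, symmetric]) (simp add: prod_meas)
  also have "\<dots> = (\<integral>\<^sup>+ a. (\<Prod>k<n. emeasure (exp_law a) (B k)) \<partial>exp_law (1 / l))"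
    by (rule nn_integral_density[symmetric]) (simp_all add: prod_meas)
  finally show ?thesis by (simp only: A_def)
qed

lemma AE_gcp_positive:
  assumes M: "prob_space M" and l: "l > 0" and D: "gcp_interarrivals M l D"
  shows "AE \<omega> in M. 0 < D k \<omega>"
proof -
  interpret prob_space M by fact
  have [measurable]: "D k \<in> borel_measurable M" using D by (simp add: gcp_interarrivals_def)
  \<comment> \<open>constrain only the \<open>k\<close>-th duration; a single factor 0 annihilates the product\<close>
  define B :: "nat \<Rightarrow> real set" where "B i = (if i = k then {..0} else UNIV)" for i
  have "{\<omega> \<in> space M. \<forall>i<Suc k. D i \<omega> \<in> B i} = {\<omega> \<in> space M. D k \<omega> \<le> 0}"
    by (auto simp: B_def)
  then have "emeasure M {\<omega> \<in> space M. D k \<omega> \<le> 0}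
      = (\<integral>\<^sup>+ a. (\<Prod>i<Suc k. emeasure (exp_law a) (B i)) \<partial>exp_law (1 / l))"
    using emeasure_gcp_box[OF assms, of "Suc k" B] by (simp add: B_def)
  also have "\<dots> = (\<integral>\<^sup>+ a. 0 \<partial>exp_law (1 / l))"
  proof (rule nn_integral_cong_AE)
    show "AE a in exp_law (1 / l). (\<Prod>i<Suc k. emeasure (exp_law a) (B i)) = 0"
      using AE_exp_law_pos
      by (rule eventually_mono) (simp add: B_def emeasure_erlang_density erlang_CDF_at0)
  qed
  finally have zero: "emeasure M {\<omega> \<in> space M. D k \<omega> \<le> 0} = 0" by simp
  show ?thesis
    by (rule AE_I[OF _ zero]) auto
qed

lemma measure_eqI_PiM_borel:
  fixes P Q :: "('i \<Rightarrow> real) measure"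
  assumes "finite I" "finite_measure P" "sets P = sets (PiM I (\<lambda>_. borel))" "sets Q
      = sets (PiM I (\<lambda>_. borel))"
    and "\<And>B. (\<And>i. i \<in> I \<Longrightarrow> B i \<in> sets borel) \<Longrightarrow> emeasure P (Pi\<^sub>E I B) = emeasure Q (Pi\<^sub>E I B)"
  shows "P = Q"
proof (rule measure_eqI_PiM_finite[where M = "\<lambda>_. borel" and A = "\<lambda>_ :: nat. Pi\<^sub>E I (\<lambda>_. UNIV)"])
  show "range (\<lambda>_ :: nat. Pi\<^sub>E I (\<lambda>_. UNIV :: real set)) \<subseteq> prod_algebra I (\<lambda>_. borel)"
    using prod_algebraI_finite[OF assms(1), of "\<lambda>_. UNIV" "\<lambda>_. borel :: real measure"]
        by (simp add: image_subset_iff)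
  show "(\<Union>i :: nat. Pi\<^sub>E I (\<lambda>_. UNIV :: real set)) = space (PiM I (\<lambda>_. borel))"
    by (simp add: space_PiM)
  show "emeasure P (Pi\<^sub>E I (\<lambda>_. UNIV)) \<noteq> \<infinity>"
    using finite_measure.emeasure_finite[OF assms(2)] by simp
  show "finite I" "sets P = sets (PiM I (\<lambda>_. borel))" "sets Q = sets (PiM I (\<lambda>_. borel))"
    by fact+
  show "emeasure P (Pi\<^sub>E I B) = emeasure Q (Pi\<^sub>E I B)" if "\<And>i. i \<in> I \<Longrightarrow> B i \<in> sets borel" for B
    by (rule assms(5)) (rule that)
qed

text \<open>
  The coordinates of the product space are independent exponential variables, so their sum is an Erlang variable.
\<close>
lemma emeasure_exp_sum_le:
  assumes "n > 0" "s \<ge> 0"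
  shows "emeasure (PiM {..<n} (\<lambda>_. exp_law 1)) {z \<in> space (PiM {..<n} (\<lambda>_. exp_law 1)). (\<Sum>k<n. z k) \<le> s}
     = ennreal (erlang_CDF (n - 1) 1 s)"
proof -
  let ?P = "PiM {..<n} (\<lambda>_. exp_law 1)"
  interpret E: prob_space "exp_law 1" by (rule prob_space_exponential_density) simp
  interpret P: prob_space ?P by (intro prob_space_PiM E.prob_space_axioms)
  have comp: "distr ?P (exp_law 1) (\<lambda>z. z k) = exp_law 1" if "k < n" for k
    by (rule distr_PiM_component) (use that E.prob_space_axioms in auto)
  have comp': "distr ?P borel (\<lambda>z. z k) = exp_law 1" if "k < n" for k
  proof -
    have "distr ?P borel (\<lambda>z. z k) = distr ?P (exp_law 1) (\<lambda>z. z k)" by (rule distr_cong) auto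
    then show ?thesis using comp[OF that] by simp
  qed
  have dist: "distributed ?P lborel (\<lambda>z. z k) (exponential_density 1)" if "k < n" for k
    unfolding distributed_def
  proof (intro conjI)
    have "distr ?P lborel (\<lambda>z. z k) = distr ?P (exp_law 1) (\<lambda>z. z k)" by (rule distr_cong) auto
    then show "distr ?P lborel (\<lambda>z. z k) = density lborel (exponential_density 1)" using comp[OF that] by simp
  qed (use that in auto)
  have ind: "P.indep_vars (\<lambda>k. borel) (\<lambda>k z. z k) {..<n}"
  proof (subst P.indep_vars_iff_distr_eq_PiM')
    have "distr ?P (PiM {..<n} (\<lambda>_. borel)) (\<lambda>z. \<lambda>k\<in>{..<n}. z k) = distr ?P ?P (\<lambda>z. z)"
    proof (rule distr_cong)
      show "sets (PiM {..<n} (\<lambda>_. borel)) = sets ?P" by (rule sets_PiM_cong) simp_all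
    qed (simp_all add: space_PiM PiE_restrict)
    also have "\<dots> = ?P" by (rule distr_id2) simp
    also have "\<dots> = PiM {..<n} (\<lambda>k. distr ?P borel (\<lambda>z. z k))"
      by (rule PiM_cong) (use comp' in auto)
    finally show "distr ?P (PiM {..<n} (\<lambda>_. borel)) (\<lambda>z. \<lambda>k\<in>{..<n}. z k)
       = PiM {..<n} (\<lambda>k. distr ?P borel (\<lambda>z. z k))" .
  qed (use assms in auto)
  have "distributed ?P lborel (\<lambda>z. \<Sum>k<n. z k) (erlang_density (card {..<n} - 1) 1)"
    by (rule P.exponential_distributed_sum) (use assms dist ind in auto)
  then have "distributed ?P lborel (\<lambda>z. \<Sum>k<n. z k) (erlang_density (n - 1) 1)" by simp
  from P.erlang_distributed_le[OF this _ assms(2)] show ?thesis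
    by (simp add: P.emeasure_eq_measure)
qed

text \<open>
  Each Poisson term of the Erlang distribution function, multiplied by the exponential density, is a
  multiple of another Erlang density. The integral is therefore \<open>1 - \<Sum>\<^sub>k\<^sub>\<le>\<^sub>n b s\<^sup>k / (b + s)\<^sup>k\<^sup>+\<^sup>1\<close> with \<open>b = 1 / l\<close>, a
  geometric sum.
\<close>
lemma nn_integral_mixed_erlang_CDF:
  assumes l: "l > 0" and s: "s \<ge> 0"
  shows "(\<integral>\<^sup>+ a. ennreal (erlang_CDF n 1 (a * s)) \<partial>exp_law (1 / l)) = ennreal ((l * s / (1 + l * s)) ^ Suc n)"
proof -
  define b where "b = 1 / l"
  have b: "b > 0" using l by (simp add: b_def)
  \<comment> \<open>Erlang densities are normalised\<close>
  have er: "has_bochner_integral lborel (erlang_density k r) 1" if "r > 0" for k and r :: real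
  proof (rule has_bochner_integral_nn_integral)
    show "(\<integral>\<^sup>+ x. ennreal (erlang_density k r x) \<partial>lborel) = ennreal 1"
      using nn_integral_erlang_ith_moment[OF that, of k 0] by simp
  qed (use that in auto)
  have "has_bochner_integral lborel
      (\<lambda>a. erlang_density 0 b a - (\<Sum>k\<le>n. (b * s ^ k / (b + s) ^ Suc k) * erlang_density k (b + s) a))
      (1 - (\<Sum>k\<le>n. (b * s ^ k / (b + s) ^ Suc k) * 1))"
    using b s by (intro has_bochner_integral_diff has_bochner_integral_sum has_bochner_integral_mult_right
        er) auto
  also have "(\<lambda>a. erlang_density 0 b a - (\<Sum>k\<le>n. (b * s ^ k / (b + s) ^ Suc k) * erlang_density k (b + s) a))
     = (\<lambda>a. exponential_density b a * erlang_CDF n 1 (a * s))"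
  proof
    fix a
    show "erlang_density 0 b a - (\<Sum>k\<le>n. (b * s ^ k / (b + s) ^ Suc k) * erlang_density k (b + s) a)
       = exponential_density b a * erlang_CDF n 1 (a * s)"
    proof (cases "a < 0")
      case True
      then show ?thesis by (simp add: erlang_density_def)
    next
      case False
      have "(b * s ^ k / (b + s) ^ Suc k) * erlang_density k (b + s) a
          = exponential_density b a * ((1 * (a * s)) ^ k * exp (- 1 * (a * s)) / fact k)" for k
      proof -
        have "exp (- (b + s) * a) = exp (- a * b) * exp (- 1 * (a * s))"
          by (simp add: exp_add[symmetric] algebra_simps)
        moreover have "b + s > 0" using b s by simp
        ultimately show ?thesis
          using False by (simp add: erlang_density_def power_mult_distrib)
      qed
      moreover have "0 \<le> a * s" using False s by simp
      ultimately show ?thesis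
        by (simp add: erlang_CDF_def right_diff_distrib sum_distrib_left)
    qed
  qed
  also have "1 - (\<Sum>k\<le>n. (b * s ^ k / (b + s) ^ Suc k) * 1) = (s / (b + s)) ^ Suc n"
  proof (induction n)
    case 0
    show ?case using b s by (simp add: field_simps)
  next
    case (Suc n)
    have "1 - (\<Sum>k\<le>Suc n. (b * s ^ k / (b + s) ^ Suc k) * 1)
        = (s / (b + s)) ^ Suc n - b * s ^ Suc n / (b + s) ^ Suc (Suc n)"
      using Suc by simp
    also have "b * s ^ Suc n / (b + s) ^ Suc (Suc n) = (s / (b + s)) ^ Suc n * (b / (b + s))"
      unfolding power_divide power_Suc2[of "b + s" "Suc n"] times_divide_times_eq by (simp only: mult.commute)
    also have "(s / (b + s)) ^ Suc n - (s / (b + s)) ^ Suc n * (b / (b + s))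
        = (s / (b + s)) ^ Suc n * (1 - b / (b + s))"
      by (simp only: right_diff_distrib mult_1_right)
    also have "1 - b / (b + s) = s / (b + s)" using b s by (simp add: field_simps)
    finally show ?case by (simp add: mult.commute)
  qed
  also have "s / (b + s) = l * s / (1 + l * s)"
    using l s by (simp add: b_def field_simps)
  finally have I: "has_bochner_integral lborel (\<lambda>a. exponential_density b a * erlang_CDF n 1 (a * s))
     ((l * s / (1 + l * s)) ^ Suc n)" .
  have meas: "(\<lambda>a. erlang_CDF n 1 (a * s)) \<in> borel_measurable borel"
    unfolding erlang_CDF_def by measurable
  have "(\<integral>\<^sup>+ a. ennreal (erlang_CDF n 1 (a * s)) \<partial>exp_law (1 / l))
     = (\<integral>\<^sup>+ a. ennreal (exponential_density b a * erlang_CDF n 1 (a * s)) \<partial>lborel)"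
    using meas b by (subst nn_integral_density) (auto simp: b_def[symmetric] ennreal_mult)
  also have "\<dots> = ennreal ((l * s / (1 + l * s)) ^ Suc n)"
    using I b by (subst nn_integral_eq_integral) (auto simp: has_bochner_integral_iff)
  finally show ?thesis .
qed

lemma emeasure_distr_pair:
  assumes P: "sigma_finite_measure P" and Y: "(\<lambda>(a, z). Y a z) \<in> A \<Otimes>\<^sub>M P \<rightarrow>\<^sub>M N" and S: "S \<in> sets N"
  shows "emeasure (distr (A \<Otimes>\<^sub>M P) N (\<lambda>(a, z). Y a z)) S = (\<integral>\<^sup>+ a. emeasure P {z \<in> space P. Y a z \<in> S} \<partial>A)"
proof -
  interpret P: sigma_finite_measure P by fact
  define W where "W = (\<lambda>(a, z). Y a z) -` S \<inter> space (A \<Otimes>\<^sub>M P)"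
  have "W \<in> sets (A \<Otimes>\<^sub>M P)" unfolding W_def by (rule measurable_sets[OF Y S])
  then have "emeasure (A \<Otimes>\<^sub>M P) W = (\<integral>\<^sup>+ a. emeasure P (Pair a -` W) \<partial>A)"
    by (rule P.emeasure_pair_measure_alt)
  also have "\<dots> = (\<integral>\<^sup>+ a. emeasure P {z \<in> space P. Y a z \<in> S} \<partial>A)"
    by (rule nn_integral_cong) (auto simp: W_def space_pair_measure intro!: arg_cong[where f = "emeasure P"])
  finally show ?thesis
    by (simp add: emeasure_distr[OF Y S] W_def)
qed

text \<open>
  The mixture of products is realised without kernels: if \<open>a\<close> is exponential with mean \<open>l\<close> and the \<open>z\<^sub>k\<close> are
  independent standard exponential variables, then the \<open>z\<^sub>k / a\<close> have the joint law of the durations. Their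
  partial sum is at most \<open>s\<close> iff \<open>\<Sum>\<^sub>k z\<^sub>k \<le> a s\<close>, an Erlang event for fixed \<open>a\<close>.
\<close>
lemma emeasure_gcp_arrival_le:
  assumes M: "prob_space M" and l: "l > 0" and D: "gcp_interarrivals M l D" and s: "s \<ge> 0"
  shows "emeasure M {\<omega> \<in> space M. (\<Sum>k<n. D k \<omega>) \<le> s} = ennreal ((l * s / (1 + l * s)) ^ n)"
proof (cases n)
  case 0
  interpret prob_space M by fact
  show ?thesis using 0 s by (simp add: emeasure_space_1)
next
  case (Suc m)
  interpret prob_space M by fact
  have [measurable]: "\<And>k. D k \<in> borel_measurable M" using D by (simp add: gcp_interarrivals_def)
  let ?I = "{..<n}"
  let ?P = "PiM ?I (\<lambda>_. exp_law 1)"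
  interpret E: prob_space "exp_law 1" by (rule prob_space_exponential_density) simp
  interpret A: prob_space "exp_law (1 / l)" by (rule prob_space_exponential_density) (use l in simp)
  interpret P: prob_space ?P by (intro prob_space_PiM E.prob_space_axioms)
  interpret ps: product_sigma_finite "\<lambda>_ :: nat. exp_law 1" by unfold_locales
  define X where "X = (\<lambda>\<omega>. \<lambda>k\<in>?I. D k \<omega>)"
  define Y where "Y = (\<lambda>(a :: real) (z :: nat \<Rightarrow> real). \<lambda>k\<in>?I. z k / a)"
  have X[measurable]: "X \<in> M \<rightarrow>\<^sub>M PiM ?I (\<lambda>_. borel)" unfolding X_def by measurable
  have Y: "(\<lambda>(a, z). Y a z) \<in> exp_law (1 / l) \<Otimes>\<^sub>M ?P \<rightarrow>\<^sub>M PiM ?I (\<lambda>_. borel)"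
    unfolding Y_def by measurable
  note slices = emeasure_distr_pair[OF P.sigma_finite_measure_axioms Y]
  have "distr M (PiM ?I (\<lambda>_. borel)) X = distr (exp_law (1 / l) \<Otimes>\<^sub>M ?P) (PiM ?I (\<lambda>_. borel)) (\<lambda>(a, z). Y a z)"
  proof (rule measure_eqI_PiM_borel)
    fix B :: "nat \<Rightarrow> real set" assume B: "\<And>i. i \<in> ?I \<Longrightarrow> B i \<in> sets borel"
    have PB[measurable]: "Pi\<^sub>E ?I B \<in> sets (PiM ?I (\<lambda>_. borel))"
      using B by (intro sets_PiM_I_finite) auto
    have "emeasure (distr (exp_law (1 / l) \<Otimes>\<^sub>M ?P) (PiM ?I (\<lambda>_. borel)) (\<lambda>(a, z). Y a z)) (Pi\<^sub>E ?I B)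
        = (\<integral>\<^sup>+ a. emeasure ?P {z \<in> space ?P. Y a z \<in> Pi\<^sub>E ?I B} \<partial>exp_law (1 / l))"
      by (rule slices[OF PB])
    also have "\<dots> = (\<integral>\<^sup>+ a. (\<Prod>k<n. emeasure (exp_law a) (B k)) \<partial>exp_law (1 / l))"
    proof (rule nn_integral_cong_AE)
      have slice: "emeasure ?P {z \<in> space ?P. Y a z \<in> Pi\<^sub>E ?I B}
         = (\<Prod>k<n. emeasure (exp_law a) (B k))" if a: "a > 0" for a
      proof -
        have "z \<in> {z \<in> space ?P. Y a z \<in> Pi\<^sub>E ?I B}
            \<longleftrightarrow> z \<in> Pi\<^sub>E ?I (\<lambda>k. {z. z / a \<in> B k})" for z
          unfolding Y_def space_PiM PiE_iff by simp blast
        then have eq: "{z \<in> space ?P. Y a z \<in> Pi\<^sub>E ?I B} = Pi\<^sub>E ?I (\<lambda>k. {z. z / a \<in> B k})"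
          by (rule set_eqI)
        have m: "{z. z / a \<in> B k} \<in> sets borel" if "k < n" for k
          using measurable_sets[of "\<lambda>z :: real. z / a" borel borel "B k"] B[of k] that
          by (simp add: vimage_def)
        have "emeasure ?P {z \<in> space ?P. Y a z \<in> Pi\<^sub>E ?I B}
           = (\<Prod>k<n. emeasure (exp_law 1) {z. z / a \<in> B k})"
          unfolding eq by (rule ps.emeasure_PiM) (simp_all add: m)
        also have "\<dots> = (\<Prod>k<n. emeasure (exp_law a) (B k))"
          using B by (intro prod.cong refl emeasure_exp_law_scale[OF a, symmetric]) auto
        finally show ?thesis .
      qed
      show "AE a in exp_law (1 / l). emeasure ?P {z \<in> space ?P. Y a z \<in> Pi\<^sub>E ?I B}
         = (\<Prod>k<n. emeasure (exp_law a) (B k))"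
        by (rule eventually_mono[OF AE_exp_law_pos slice])
    qed
    also have "\<dots> = emeasure M {\<omega> \<in> space M. \<forall>k<n. D k \<omega> \<in> B k}"
    proof (rule sym, rule emeasure_gcp_box[OF M l D, of n B])
      show "B k \<in> sets borel" if "k < n" for k by (rule B) (simp only: lessThan_iff that)
    qed
    also have "{\<omega> \<in> space M. \<forall>k<n. D k \<omega> \<in> B k} = X -` Pi\<^sub>E ?I B \<inter> space M"
      unfolding X_def PiE_iff by fastforce
    also have "emeasure M \<dots> = emeasure (distr M (PiM ?I (\<lambda>_. borel)) X) (Pi\<^sub>E ?I B)"
      by (rule emeasure_distr[OF X PB, symmetric])
    finally show "emeasure (distr M (PiM ?I (\<lambda>_. borel)) X) (Pi\<^sub>E ?I B)
       = emeasure (distr (exp_law (1 / l) \<Otimes>\<^sub>M ?P) (PiM ?I (\<lambda>_. borel)) (\<lambda>(a, z). Y a z)) (Pi\<^sub>E ?I B)" ..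
  next
    show "finite_measure (distr M (PiM ?I (\<lambda>_. borel)) X)"
      by (rule finite_measure_distr[OF X])
  qed simp_all
  note law = this
  let ?S = "{x \<in> space (PiM ?I (\<lambda>_. borel :: real measure)). (\<Sum>k<n. x k) \<le> s}"
  have S[measurable]: "?S \<in> sets (PiM ?I (\<lambda>_. borel :: real measure))" by measurable
  have "{\<omega> \<in> space M. (\<Sum>k<n. D k \<omega>) \<le> s} = X -` ?S \<inter> space M"
    using measurable_space[OF X] by (auto simp: X_def)
  then have "emeasure M {\<omega> \<in> space M. (\<Sum>k<n. D k \<omega>) \<le> s}
      = emeasure (distr M (PiM ?I (\<lambda>_. borel)) X) ?S"
    by (simp only: emeasure_distr[OF X S])
  also have "\<dots> = (\<integral>\<^sup>+ a. emeasure ?P {z \<in> space ?P. Y a z \<in> ?S} \<partial>exp_law (1 / l))"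
    unfolding law by (rule slices[OF S])
  also have "\<dots> = (\<integral>\<^sup>+ a. ennreal (erlang_CDF m 1 (a * s)) \<partial>exp_law (1 / l))"
  proof (rule nn_integral_cong_AE)
    have slice: "emeasure ?P {z \<in> space ?P. Y a z \<in> ?S} = ennreal (erlang_CDF m 1 (a * s))"
      if a: "a > 0" for a
    proof -
      have "(\<Sum>k<n. z k / a) \<le> s \<longleftrightarrow> (\<Sum>k<n. z k) \<le> a * s" for z :: "nat \<Rightarrow> real"
        using a by (simp add: field_simps flip: sum_divide_distrib)
      then have "{z \<in> space ?P. Y a z \<in> ?S} = {z \<in> space ?P. (\<Sum>k<n. z k) \<le> a * s}"
        by (auto simp: Y_def space_PiM PiE_iff)
      then show ?thesis using emeasure_exp_sum_le[of n "a * s"] Suc a s by simp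
    qed
    show "AE a in exp_law (1 / l). emeasure ?P {z \<in> space ?P. Y a z \<in> ?S}
        = ennreal (erlang_CDF m 1 (a * s))"
      by (rule eventually_mono[OF AE_exp_law_pos slice])
  qed
  also have "\<dots> = ennreal ((l * s / (1 + l * s)) ^ n)"
    unfolding Suc by (rule nn_integral_mixed_erlang_CDF[OF l s])
  finally show ?thesis .
qed

section \<open>Paths of the cyclic motion\<close>

definition leg :: "nat \<Rightarrow> 4" where
  "leg m = of_nat (m mod 4 + 1)"

text \<open>
  The number of displacements along \<open>dir i\<close> among the first \<open>m\<close> displacements of the cyclic motion.
\<close>
definition visits :: "4 \<Rightarrow> nat \<Rightarrow> nat" where
  "visits i m = (if i = 1 then (m + 3) div 4 else if i = 2 then (m + 2) div 4
                 else if i = 3 then (m + 1) div 4 else m div 4)"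

lemma Suc_div_mod_4:
  "Suc (4 * n) div 4 = n" "Suc (Suc (4 * n)) div 4 = n" "Suc (Suc (Suc (4 * n))) div 4 = n"
  "Suc (4 * n) mod 4 = 1" "Suc (Suc (4 * n)) mod 4 = 2" "Suc (Suc (Suc (4 * n))) mod 4 = 3"
  by presburger+

lemma leg_simps: "leg (4 * n) = 1" "leg (4 * n + 1) = 2" "leg (4 * n + 2) = 3" "leg (4 * n + 3) = 4"
  by (simp_all add: leg_def Suc_div_mod_4)

lemma mod_4_cases:
  fixes m :: nat
  obtains n where "m = 4 * n" | n where "m = 4 * n + 1" | n where "m = 4 * n + 2" | n where "m = 4 * n + 3"
proof -
  have "m = 4 * (m div 4) + m mod 4" by simp
  moreover have "m mod 4 < 4" by simp
  ultimately have "m = 4 * (m div 4) \<or> m = 4 * (m div 4) + 1 \<or> m = 4 * (m div 4) + 2 \<or> m = 4 * (m div 4) + 3"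
    by linarith
  then show thesis using that by blast
qed

lemma visits_Suc: "visits i (Suc m) = visits i m + (if i = leg m then 1 else 0)"
  by (rule mod_4_cases[of m]; insert exhaust_4[of i]; elim disjE; simp add: visits_def leg_def Suc_div_mod_4)

lemma visits_0 [simp]: "visits i 0 = 0"
  by (simp add: visits_def)

lemma switch_time_eq_visits: "switch_time D m \<omega> = (\<Sum>i\<in>UNIV. total_dur D i (visits i m) \<omega>)"
proof (cases m)
  case 0
  then show ?thesis by (simp add: switch_time_def total_dur_def)
next
  case (Suc k)
  have I: "{Suc (Suc 0)..4} = {2, 3, 4}" "{Suc (Suc (Suc 0))..4} = {3, 4}"
    "{Suc (Suc (Suc (Suc 0)))..4} = {4}"
    by auto
  show ?thesis
    by (rule mod_4_cases[of k])
       (simp_all add: Suc switch_time_def Let_def sum_4 visits_def I Suc_div_mod_4 ac_simps(1-3))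
qed

lemma switch_time_0 [simp]: "switch_time D 0 \<omega> = 0"
  by (simp add: switch_time_def)

lemma total_dur_Suc: "total_dur D i (Suc k) \<omega> = total_dur D i k \<omega> + D i k \<omega>"
  by (simp add: total_dur_def)

lemma switch_time_Suc:
  "switch_time D (Suc m) \<omega> = switch_time D m \<omega> + D (leg m) (visits (leg m) m) \<omega>"
proof -
  have "total_dur D i (visits i (Suc m)) \<omega>
      = total_dur D i (visits i m) \<omega> + (if leg m = i then D i (visits i m) \<omega> else 0)" for i
    by (simp add: visits_Suc total_dur_Suc)
  then show ?thesis by (simp add: switch_time_eq_visits sum.distrib)
qed

text \<open>
  Positive durations make the switching times strictly increasing, so the index that defines the velocity is unique.
\<close>
lemma velocity_eq_dir:
  assumes pos: "\<And>i k. 0 < D i k \<omega>" and m: "switch_time D m \<omega> \<le> t" "t < switch_time D (Suc m) \<omega>"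
  shows "velocity D t \<omega> = dir (leg m)"
proof -
  have mono: "strict_mono (\<lambda>m. switch_time D m \<omega>)"
    by (simp add: strict_mono_Suc_iff switch_time_Suc pos)
  have "(LEAST m. switch_time D m \<omega> \<le> t \<and> t < switch_time D (m + 1) \<omega>) = m"
  proof (rule Least_equality)
    fix k assume "switch_time D k \<omega> \<le> t \<and> t < switch_time D (k + 1) \<omega>"
    with m have "switch_time D m \<omega> < switch_time D (Suc k) \<omega>" by simp
    then show "m \<le> k" using strict_mono_less[OF mono] by simp
  qed (use m in simp)
  then show ?thesis by (simp add: velocity_def leg_def)
qed

lemma switch_time_covers:
  assumes "0 \<le> t" "t < switch_time D k \<omega>"
  shows "\<exists>m. switch_time D m \<omega> \<le> t \<and> t < switch_time D (Suc m) \<omega>"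
proof -
  define k' where "k' = (LEAST k. t < switch_time D k \<omega>)"
  have k': "t < switch_time D k' \<omega>" unfolding k'_def using assms(2) by (rule LeastI)
  then obtain m where m: "k' = Suc m" using assms(1) by (cases k') auto
  then have "\<not> t < switch_time D m \<omega>" unfolding k'_def by (metis lessI not_less_Least)
  with k' m show ?thesis by (auto simp: not_less)
qed

text \<open>
  Up to a switching time, each direction contributes its completed durations; the induction adds one constant
  piece at a time.
\<close>
lemma has_integral_velocity_switch_time:
  assumes pos: "\<And>i k. 0 < D i k \<omega>"
  shows "has_bochner_integral lborel (\<lambda>s. indicator {0..<switch_time D m \<omega>} s *\<^sub>R velocity D s \<omega>)
           (\<Sum>i\<in>UNIV. total_dur D i (visits i m) \<omega> *\<^sub>R dir i)"
proof (induction m)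
  case 0
  then show ?case by (simp add: total_dur_def has_bochner_integral_zero)
next
  case (Suc m)
  let ?a = "switch_time D m \<omega>" and ?b = "switch_time D (Suc m) \<omega>"
  have a: "0 \<le> ?a"
    using pos by (simp add: switch_time_eq_visits total_dur_def sum_nonneg less_imp_le)
  have ab: "?a \<le> ?b" using pos by (simp add: switch_time_Suc less_imp_le)
  have "has_bochner_integral lborel (\<lambda>s. indicator {?a..<?b} s *\<^sub>R dir (leg m)) ((?b - ?a) *\<^sub>R dir (leg m))"
    using has_bochner_integral_real_indicator[of "{?a..<?b}" lborel] ab
    by (intro has_bochner_integral_scaleR_left) simp
  from has_bochner_integral_add[OF Suc this]
  have "has_bochner_integral lborel
     (\<lambda>s. indicator {0..<?a} s *\<^sub>R velocity D s \<omega> + indicator {?a..<?b} s *\<^sub>R dir (leg m))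
     ((\<Sum>i\<in>UNIV. total_dur D i (visits i m) \<omega> *\<^sub>R dir i) + (?b - ?a) *\<^sub>R dir (leg m))" .
  moreover have "indicator {0..<?a} s *\<^sub>R velocity D s \<omega> + indicator {?a..<?b} s *\<^sub>R dir (leg m)
      = indicator {0..<?b} s *\<^sub>R velocity D s \<omega>" for s
    using a ab velocity_eq_dir[of D \<omega> m s, OF pos] by (auto simp: indicator_def)
  moreover have "(\<Sum>i\<in>UNIV. total_dur D i (visits i m) \<omega> *\<^sub>R dir i) + (?b - ?a) *\<^sub>R dir (leg m)
      = (\<Sum>i\<in>UNIV. total_dur D i (visits i (Suc m)) \<omega> *\<^sub>R dir i)"
  proof -
    have "total_dur D i (visits i (Suc m)) \<omega> *\<^sub>R dir i = total_dur D i (visits i m) \<omega> *\<^sub>R dir i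
        + (if leg m = i then D i (visits i m) \<omega> *\<^sub>R dir i else 0)" for i
      by (simp add: visits_Suc total_dur_Suc scaleR_add_left)
    then show ?thesis by (simp add: sum.distrib switch_time_Suc)
  qed
  ultimately show ?case by simp
qed

text \<open>
  Time spent in direction \<open>i\<close> up to \<open>t\<close>, when \<open>t\<close> falls into the displacement that follows \<open>m\<close> completed ones.
\<close>
definition occupation :: "(4 \<Rightarrow> nat \<Rightarrow> 'a \<Rightarrow> real) \<Rightarrow> nat \<Rightarrow> real \<Rightarrow> 'a \<Rightarrow> 4 \<Rightarrow> real" where
  "occupation D m t \<omega> i = total_dur D i (visits i m) \<omega> + (if i = leg m then t - switch_time D m \<omega> else 0)"

lemma sum_occupation: "(\<Sum>i\<in>UNIV. occupation D m t \<omega> i) = t"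
  by (simp add: occupation_def sum.distrib flip: switch_time_eq_visits)

lemma position_eq_occupation:
  assumes pos: "\<And>i k. 0 < D i k \<omega>" and m: "switch_time D m \<omega> \<le> t" "t < switch_time D (Suc m) \<omega>"
  shows "position c D t \<omega> = (\<Sum>i\<in>UNIV. (c * occupation D m t \<omega> i) *\<^sub>R dir i)"
proof -
  let ?a = "switch_time D m \<omega>"
  have a: "0 \<le> ?a"
    using pos by (simp add: switch_time_eq_visits total_dur_def sum_nonneg less_imp_le)
  have "has_bochner_integral lborel (\<lambda>s. indicator {?a..t} s *\<^sub>R dir (leg m)) ((t - ?a) *\<^sub>R dir (leg m))"
    using has_bochner_integral_real_indicator[of "{?a..t}" lborel] m
    by (intro has_bochner_integral_scaleR_left) simp
  from has_bochner_integral_add[OF has_integral_velocity_switch_time[of D \<omega> m, OF pos] this]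
  have "has_bochner_integral lborel
     (\<lambda>s. indicator {0..<?a} s *\<^sub>R velocity D s \<omega> + indicator {?a..t} s *\<^sub>R dir (leg m))
     ((\<Sum>i\<in>UNIV. total_dur D i (visits i m) \<omega> *\<^sub>R dir i) + (t - ?a) *\<^sub>R dir (leg m))" .
  moreover have "indicator {0..<?a} s *\<^sub>R velocity D s \<omega> + indicator {?a..t} s *\<^sub>R dir (leg m)
      = indicator {0..t} s *\<^sub>R velocity D s \<omega>" for s
    using a m velocity_eq_dir[of D \<omega> m s, OF pos] by (auto simp: indicator_def)
  moreover have "(\<Sum>i\<in>UNIV. total_dur D i (visits i m) \<omega> *\<^sub>R dir i) + (t - ?a) *\<^sub>R dir (leg m)
      = (\<Sum>i\<in>UNIV. occupation D m t \<omega> i *\<^sub>R dir i)"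
  proof -
    have "occupation D m t \<omega> i *\<^sub>R dir i = total_dur D i (visits i m) \<omega> *\<^sub>R dir i
        + (if leg m = i then (t - ?a) *\<^sub>R dir i else 0)" for i
      by (simp add: occupation_def scaleR_add_left)
    then show ?thesis by (simp add: sum.distrib)
  qed
  ultimately have "(LINT s:{0..t}|lborel. velocity D s \<omega>) = (\<Sum>i\<in>UNIV. occupation D m t \<omega> i *\<^sub>R dir i)"
    unfolding set_lebesgue_integral_def by (simp add: has_bochner_integral_integral_eq)
  then show ?thesis by (simp add: position_def scaleR_sum_right)
qed

lemma tau_position:
  assumes pos: "\<And>i k. 0 < D i k \<omega>" and m: "switch_time D m \<omega> \<le> t" "t < switch_time D (Suc m) \<omega>" and "c \<noteq> 0"
  shows "tau c i (position c D t \<omega>) t = occupation D m t \<omega> i"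
  unfolding position_eq_occupation[OF assms(1-3)]
  by (rule tau_barycentric[OF \<open>c \<noteq> 0\<close> sum_occupation])

section \<open>Densities of arrival times and of the counting number\<close>

text \<open>
  The derivative of the distribution function \<open>(l s / (1 + l s))\<^sup>n\<close> of the \<open>n\<close>-th arrival time, for \<open>s \<ge> 0\<close>.
\<close>
definition gcp_density :: "real \<Rightarrow> nat \<Rightarrow> real \<Rightarrow> real" where
  "gcp_density l n s = (if s < 0 then 0 else real n * (l * s / (1 + l * s)) ^ (n - 1) * (l / (1 + l * s)\<^sup>2))"

text \<open>
  The probability that exactly \<open>n\<close> arrivals have occurred at time \<open>s\<close>: a geometric distribution, whence the
  name of the process.
\<close>
definition gcp_count_prob :: "real \<Rightarrow> nat \<Rightarrow> real \<Rightarrow> real" where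
  "gcp_count_prob l n s = (if s < 0 then 0 else (l * s / (1 + l * s)) ^ n / (1 + l * s))"

lemma gcp_density_nonneg: "l > 0 \<Longrightarrow> 0 \<le> gcp_density l n s"
  by (simp add: gcp_density_def)

lemma gcp_count_prob_nonneg: "l > 0 \<Longrightarrow> 0 \<le> gcp_count_prob l n s"
  by (simp add: gcp_count_prob_def)

lemma borel_measurable_gcp_density [measurable]: "gcp_density l n \<in> borel_measurable borel"
  unfolding gcp_density_def[abs_def] by measurable

lemma borel_measurable_gcp_count_prob [measurable]: "gcp_count_prob l n \<in> borel_measurable borel"
  unfolding gcp_count_prob_def[abs_def] by measurable

lemma nn_integral_gcp_density:
  assumes l: "l > 0" and a: "a \<ge> 0" and n: "n > 0"
  shows "(\<integral>\<^sup>+ s. ennreal (gcp_density l n s) * indicator {..a} s \<partial>lborel)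
      = ennreal ((l * a / (1 + l * a)) ^ n)"
proof -
  have pos: "0 < 1 + l * s" if "0 \<le> s" for s using l that by (simp add: add_pos_nonneg)
  have "(\<integral>\<^sup>+ s. ennreal (gcp_density l n s) * indicator {..a} s \<partial>lborel)
      = (\<integral>\<^sup>+ s. ennreal (gcp_density l n s) * indicator {0..a} s \<partial>lborel)"
    by (intro nn_integral_cong) (simp add: gcp_density_def split: split_indicator)
  also have "\<dots> = ennreal ((l * a / (1 + l * a)) ^ n - (l * 0 / (1 + l * 0)) ^ n)"
  proof (rule nn_integral_FTC_Icc)
    fix s :: real assume s: "s \<in> {0..a}"
    have "((\<lambda>s. (l * s / (1 + l * s)) ^ n) has_real_derivative
        real n * ((l * (1 + l * s) - l * s * l) / ((1 + l * s) * (1 + l * s))) * (l * s / (1 + l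
            * s)) ^ (n - 1)) (at s)"
      using pos[of s] s by (auto intro!: derivative_eq_intros)
    also have "real n * ((l * (1 + l * s) - l * s * l) / ((1 + l * s) * (1 + l * s))) * (l * s / (1 + l
        * s)) ^ (n - 1)
        = gcp_density l n s"
      using s by (simp add: gcp_density_def power2_eq_square algebra_simps)
    finally show "((\<lambda>s. (l * s / (1 + l * s)) ^ n) has_real_derivative gcp_density l n s) (at s)" .
    show "0 \<le> gcp_density l n s" by (rule gcp_density_nonneg[OF l])
  qed (use a in simp_all)
  finally show ?thesis using n by (simp add: zero_power)
qed

lemma nn_integral_gcp_arrival:
  assumes M: "prob_space M" and l: "l > 0" and D: "gcp_interarrivals M l D" and n: "n > 0"
    and f[measurable]: "f \<in> borel_measurable borel"
  shows "(\<integral>\<^sup>+ \<omega>. f (\<Sum>k<n. D k \<omega>) \<partial>M) = (\<integral>\<^sup>+ s. ennreal (gcp_density l n s) * f s \<partial>lborel)"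
proof -
  interpret prob_space M by fact
  have [measurable]: "\<And>k. D k \<in> borel_measurable M" using D by (simp add: gcp_interarrivals_def)
  have "distributed M lborel (\<lambda>\<omega>. \<Sum>k<n. D k \<omega>) (\<lambda>s. ennreal (gcp_density l n s))"
  proof (rule distributedI_borel_atMost)
    fix a :: real
    let ?g = "\<lambda>a. if a < 0 then 0 else (l * a / (1 + l * a)) ^ n"
    show "(\<integral>\<^sup>+ s. ennreal (gcp_density l n s * indicator {..a} s) \<partial>lborel) = ennreal (?g a)"
    proof (cases "a < 0")
      case True
      then have "(\<integral>\<^sup>+ s. ennreal (gcp_density l n s * indicator {..a} s) \<partial>lborel)
          = (\<integral>\<^sup>+ s. 0 \<partial>(lborel :: real measure))"
        by (intro nn_integral_cong) (simp add: gcp_density_def split: split_indicator)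
      then show ?thesis using True by simp
    next
      case False
      have "(\<integral>\<^sup>+ s. ennreal (gcp_density l n s * indicator {..a} s) \<partial>lborel)
          = (\<integral>\<^sup>+ s. ennreal (gcp_density l n s) * indicator {..a} s \<partial>lborel)"
        by (intro nn_integral_cong) (simp split: split_indicator)
      then show ?thesis using False nn_integral_gcp_density[OF l _ n, of a] by simp
    qed
    show "emeasure M {\<omega> \<in> space M. (\<Sum>k<n. D k \<omega>) \<le> a} = ennreal (?g a)"
    proof (cases "a < 0")
      case True
      have "emeasure M {\<omega> \<in> space M. (\<Sum>k<n. D k \<omega>) \<le> a} \<le> emeasure M {\<omega> \<in> space M. (\<Sum>k<n. D k \<omega>) \<le> 0}"
        using True by (intro emeasure_mono) auto
      also have "\<dots> = 0" using emeasure_gcp_arrival_le[OF M l D, of 0 n] n by (simp add: zero_power)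
      finally show ?thesis using True by simp
    next
      case False
      then show ?thesis using emeasure_gcp_arrival_le[OF M l D, of a n] by simp
    qed
  qed (simp_all add: gcp_density_nonneg[OF l])
  from distributed_nn_integral[OF this, of f] show ?thesis by simp
qed

lemma AE_gcp_all_positive:
  assumes M: "prob_space M" and l: "l > 0" and D: "gcp_interarrivals M l D"
  shows "AE \<omega> in M. \<forall>k. 0 < D k \<omega>"
  using AE_gcp_positive[OF assms] by (simp add: AE_all_countable)

text \<open>
  For positive durations the event is the difference of the events that the \<open>n\<close>-th and the \<open>(n + 1)\<close>-st arrival
  occur no later than \<open>s\<close>, so its probability is \<open>y\<^sup>n - y\<^sup>n\<^sup>+\<^sup>1\<close> with \<open>y = l s / (1 + l s)\<close>.
\<close>
lemma emeasure_gcp_count: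
  assumes M: "prob_space M" and l: "l > 0" and D: "gcp_interarrivals M l D"
  shows "emeasure M {\<omega> \<in> space M. (\<Sum>k<n. D k \<omega>) \<le> s \<and> s < (\<Sum>k<Suc n. D k \<omega>)} = ennreal (gcp_count_prob l n s)"
proof -
  interpret prob_space M by fact
  have [measurable]: "\<And>k. D k \<in> borel_measurable M" using D by (simp add: gcp_interarrivals_def)
  note pos = AE_gcp_all_positive[OF assms]
  define A where "A n = {\<omega> \<in> space M. (\<Sum>k<n. D k \<omega>) \<le> s}" for n
  have A[measurable]: "A n \<in> sets M" for n unfolding A_def by measurable
  have "emeasure M {\<omega> \<in> space M. (\<Sum>k<n. D k \<omega>) \<le> s \<and> s < (\<Sum>k<Suc n. D k \<omega>)} = emeasure M (A n - A (Suc n))"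
    by (rule arg_cong[where f = "emeasure M"]) (auto simp: A_def)
  also have "\<dots> = emeasure M (A n) - emeasure M (A (Suc n))"
  proof -
    have "AE \<omega> in M. \<omega> \<in> A (Suc n) \<longleftrightarrow> \<omega> \<in> A n \<inter> A (Suc n)"
      using pos
    proof eventually_elim
      case (elim \<omega>)
      then have "0 < D n \<omega>" by blast
      then show ?case by (auto simp: A_def)
    qed
    then have "emeasure M (A (Suc n)) = emeasure M (A n \<inter> A (Suc n))"
      by (rule emeasure_eq_AE) simp_all
    moreover have "emeasure M (A n - A n \<inter> A (Suc n)) = emeasure M (A n) - emeasure M (A n \<inter> A (Suc n))"
      by (rule emeasure_Diff) simp_all
    moreover have "A n - A n \<inter> A (Suc n) = A n - A (Suc n)" by blast
    ultimately show ?thesis by (simp only:)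
  qed
  also have "\<dots> = ennreal (gcp_count_prob l n s)"
  proof (cases "s < 0")
    case True
    have "AE \<omega> in M. \<omega> \<in> A n \<longleftrightarrow> \<omega> \<in> {}" for n
      using pos
    proof eventually_elim
      case (elim \<omega>)
      then have "0 \<le> (\<Sum>k<n. D k \<omega>)" by (simp add: sum_nonneg less_imp_le)
      then show ?case using True by (simp add: A_def)
    qed
    then have "emeasure M (A n) = emeasure M {}" for n
      by (rule emeasure_eq_AE) simp_all
    then show ?thesis using True by (simp add: gcp_count_prob_def)
  next
    case False
    let ?y = "l * s / (1 + l * s)"
    have p: "0 < 1 + l * s" using l False by (simp add: add_pos_nonneg)
    have "emeasure M (A n) = ennreal (?y ^ n)" for n
      unfolding A_def using emeasure_gcp_arrival_le[OF assms, of s n] False by simp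
    then have "emeasure M (A n) - emeasure M (A (Suc n)) = ennreal (?y ^ n - ?y ^ Suc n)"
      using l False by (simp add: ennreal_minus)
    also have "?y ^ n - ?y ^ Suc n = ?y ^ n * (1 - ?y)"
      by (simp only: power_Suc2 right_diff_distrib mult_1_right)
    also have "1 - ?y = 1 / (1 + l * s)" using p by (simp add: field_simps)
    finally show ?thesis using False by (simp add: gcp_count_prob_def)
  qed
  finally show ?thesis .
qed

text \<open>
  Iterated integrals over the probability space itself, rather than over the laws of the variables, let each
  variable be replaced separately by whatever is known about its distribution.
\<close>
lemma (in prob_space) nn_integral_indep_four:
  fixes Z :: "4 \<Rightarrow> 'a \<Rightarrow> real \<times> real"
  assumes ind: "indep_vars (\<lambda>_. borel) Z UNIV"
    and U: "UNIV = {a, b, d, j}" "distinct [a, b, d, j]"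
    and F[measurable]: "F \<in> borel_measurable (borel \<Otimes>\<^sub>M borel \<Otimes>\<^sub>M borel \<Otimes>\<^sub>M borel)"
  shows "(\<integral>\<^sup>+ \<omega>. F (Z a \<omega>, Z b \<omega>, Z d \<omega>, Z j \<omega>) \<partial>M)
    = (\<integral>\<^sup>+ \<omega>1. \<integral>\<^sup>+ \<omega>2. \<integral>\<^sup>+ \<omega>3. \<integral>\<^sup>+ \<omega>4. F (Z a \<omega>1, Z b \<omega>2, Z d \<omega>3, Z j \<omega>4) \<partial>M \<partial>M \<partial>M \<partial>M)"
proof -
  have Z[measurable]: "Z i \<in> borel_measurable M" for i using ind by (auto simp: indep_vars_def)
  define \<mu> where "\<mu> i = distr M borel (Z i)" for i
  have p: "prob_space (\<mu> i)" for i unfolding \<mu>_def by (rule prob_space_distr) simp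
  interpret \<mu>: product_prob_space \<mu> UNIV using p by (simp add: product_prob_spaceI)
  have sets_\<mu>[measurable_cong, simp]: "sets (\<mu> i) = sets borel" for i by (simp add: \<mu>_def)
  have law: "distr M (PiM UNIV (\<lambda>_. borel)) (\<lambda>\<omega> i. Z i \<omega>) = PiM UNIV \<mu>"
    using indep_vars_iff_distr_eq_PiM'[where I = UNIV and M' = "\<lambda>_. borel" and X
        = Z] ind by (simp add: \<mu>_def[abs_def] restrict_def)
  have path[measurable]: "(\<lambda>\<omega> i. Z i \<omega>) \<in> M \<rightarrow>\<^sub>M PiM UNIV (\<lambda>_. borel)"
    by (rule measurable_abs_UNIV) simp
  have ne: "a \<noteq> b" "a \<noteq> d" "a \<noteq> j" "b \<noteq> d" "b \<noteq> j" "d \<noteq> j" "b \<noteq> a" "d \<noteq> a" "j \<noteq> a" "d \<noteq> b" "j \<noteq> b" "j \<noteq> d"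
    using U(2) by auto
  let ?f = "\<lambda>x :: 4 \<Rightarrow> real \<times> real. F (x a, x b, x d, x j)"
  have f[measurable]: "?f \<in> borel_measurable (PiM {a, b, d, j} \<mu>)"
    by measurable
  have "(\<integral>\<^sup>+ \<omega>. F (Z a \<omega>, Z b \<omega>, Z d \<omega>, Z j \<omega>) \<partial>M)
      = (\<integral>\<^sup>+ x. ?f x \<partial>distr M (PiM UNIV (\<lambda>_. borel)) (\<lambda>\<omega> i. Z i \<omega>))"
    by (subst nn_integral_distr) simp_all
  also have "\<dots> = (\<integral>\<^sup>+ x. ?f x \<partial>PiM {a, b, d, j} \<mu>)" by (simp only: law U(1)[symmetric])
  also have "\<dots> = (\<integral>\<^sup>+ u. \<integral>\<^sup>+ x. F (u, x b, x d, x j) \<partial>PiM {b, d, j} \<mu> \<partial>\<mu> a)"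
    by (subst \<mu>.product_nn_integral_insert_rev) (simp_all add: ne)
  also have "\<dots> = (\<integral>\<^sup>+ u. \<integral>\<^sup>+ v. \<integral>\<^sup>+ x. F (u, v, x d, x j) \<partial>PiM {d, j} \<mu> \<partial>\<mu> b \<partial>\<mu> a)"
    by (intro nn_integral_cong, subst \<mu>.product_nn_integral_insert_rev) (simp_all add: ne)
  also have "\<dots> = (\<integral>\<^sup>+ u. \<integral>\<^sup>+ v. \<integral>\<^sup>+ w. \<integral>\<^sup>+ x. F (u, v, w, x j) \<partial>PiM {j} \<mu> \<partial>\<mu> d \<partial>\<mu> b \<partial>\<mu> a)"
    by (intro nn_integral_cong, subst \<mu>.product_nn_integral_insert_rev) (simp_all add: ne)
  also have "\<dots> = (\<integral>\<^sup>+ u. \<integral>\<^sup>+ v. \<integral>\<^sup>+ w. \<integral>\<^sup>+ x. F (u, v, w, x) \<partial>\<mu> j \<partial>\<mu> d \<partial>\<mu> b \<partial>\<mu> a)"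
    by (intro nn_integral_cong \<mu>.product_nn_integral_singleton) simp
  also have "\<dots> = (\<integral>\<^sup>+ \<omega>1. \<integral>\<^sup>+ \<omega>2. \<integral>\<^sup>+ \<omega>3. \<integral>\<^sup>+ \<omega>4. F (Z a \<omega>1, Z b \<omega>2, Z d \<omega>3, Z j \<omega>4) \<partial>M \<partial>M \<partial>M \<partial>M)"
    unfolding \<mu>_def by (simp add: nn_integral_distr)
  finally show ?thesis .
qed

section \<open>The law of the position after a given number of displacements\<close>

text \<open>
  The contribution of the event that exactly \<open>m\<close> displacements are completed at time \<open>t\<close>. The elapsed time in the
  current direction has no density of its own; it enters through the probability of its counting number.
\<close>
definition path_density :: "real ^ 4 \<Rightarrow> real \<Rightarrow> real \<Rightarrow> nat \<Rightarrow> real ^ 3 \<Rightarrow> real" where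
  "path_density l c t m x =
     gcp_count_prob (l $ leg m) (visits (leg m) m) (tau c (leg m) x t) *
     (\<Prod>i\<in>UNIV - {leg m}. gcp_density (l $ i) (visits i m) (tau c i x t)) / det (matA c)"

lemma dir_inj: "dir i = dir j \<longleftrightarrow> i = j"
  using inner_dir[of i j] inner_dir[of j j] by (auto split: if_splits)

lemma borel_measurable_total_dur [measurable]:
  assumes [measurable]: "\<And>i k. D i k \<in> borel_measurable M"
  shows "total_dur D i n \<in> borel_measurable M"
  unfolding total_dur_def[abs_def] by measurable

lemma borel_measurable_switch_time [measurable]:
  assumes [measurable]: "\<And>i k. D i k \<in> borel_measurable M"
  shows "switch_time D m \<in> borel_measurable M"
  unfolding switch_time_eq_visits[abs_def] by measurable

lemma borel_measurable_velocity:
  assumes [measurable]: "\<And>i k. D i k \<in> borel_measurable M"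
  shows "(\<lambda>(\<omega>, s). velocity D s \<omega>) \<in> borel_measurable (M \<Otimes>\<^sub>M borel)"
proof -
  have sw: "(\<lambda>z. switch_time D m (fst z)) \<in> borel_measurable (M \<Otimes>\<^sub>M (borel :: real measure))" for m
    by measurable
  have "(\<lambda>z. LEAST m. switch_time D m (fst z) \<le> snd z \<and> snd z < switch_time D (m + 1) (fst z))
      \<in> M \<Otimes>\<^sub>M (borel :: real measure) \<rightarrow>\<^sub>M count_space UNIV"
    using sw by measurable
  from measurable_compose[OF this, of "\<lambda>m. dir (of_nat (m mod 4 + 1))" borel]
  show ?thesis
    by (simp add: velocity_def Let_def split_beta')
qed

lemma borel_measurable_velocity_at [measurable]:
  assumes D: "\<And>i k. D i k \<in> borel_measurable M"
  shows "velocity D s \<in> borel_measurable M"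
  using measurable_compose[OF measurable_Pair2'[of s borel M] borel_measurable_velocity[OF D]] by simp

lemma borel_measurable_position [measurable]:
  assumes D: "\<And>i k. D i k \<in> borel_measurable M"
  shows "position c D t \<in> borel_measurable M"
proof -
  have [measurable]: "(\<lambda>(\<omega>, s). velocity D s \<omega>) \<in> borel_measurable (M \<Otimes>\<^sub>M lborel)"
    using borel_measurable_velocity[OF D] by (simp cong: measurable_cong_sets sets_pair_measure_cong)
  show ?thesis
    unfolding position_def[abs_def] set_lebesgue_integral_def by measurable
qed

text \<open>
  The number of displacements that precede direction \<open>j\<close> in the first cycle.
\<close>
definition leg_offset :: "4 \<Rightarrow> nat" where
  "leg_offset j = (if j = 1 then 0 else if j = 2 then 1 else if j = 3 then 2 else 3)"

lemma leg_eq_iff: "leg m = j \<longleftrightarrow> (\<exists>n. m = 4 * n + leg_offset j)"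
proof
  assume "leg m = j"
  then show "\<exists>n. m = 4 * n + leg_offset j"
    by (cases rule: mod_4_cases[of m]) (auto simp: leg_simps[simplified] leg_offset_def)
next
  assume "\<exists>n. m = 4 * n + leg_offset j"
  then show "leg m = j"
    using exhaust_4[of j] by (auto simp: leg_offset_def leg_simps[simplified])
qed

context
  fixes M :: "'a measure" and l :: "real ^ 4" and D :: "4 \<Rightarrow> nat \<Rightarrow> 'a \<Rightarrow> real"
  assumes dur: "gcp_durations M l D" and l: "\<And>i. 0 < l $ i"
begin

lemma durations_prob_space: "prob_space M"
  using dur by (simp add: gcp_durations_def)

lemma durations_gcp: "gcp_interarrivals M (l $ i) (D i)"
  using dur by (simp add: gcp_durations_def)

lemma durations_measurable [measurable]: "D i k \<in> borel_measurable M"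
  using durations_gcp by (simp add: gcp_interarrivals_def)

lemma AE_durations_positive: "AE \<omega> in M. \<forall>i k. 0 < D i k \<omega>"
  using AE_gcp_all_positive[OF durations_prob_space l durations_gcp] by (simp add: AE_all_countable)

text \<open>
  The durations along the first direction alone exceed any time: the probability that their first \<open>n\<close> fit
  into \<open>[0, s]\<close> is \<open>y\<^sup>n\<close> with \<open>y < 1\<close>. Hence almost surely every time lies between two switching times.
\<close>
lemma AE_switch_time_unbounded: "AE \<omega> in M. \<exists>m. t < switch_time D m \<omega>"
proof -
  interpret prob_space M by (rule durations_prob_space)
  \<comment> \<open>the formula for the distribution function needs a nonnegative time\<close>
  define s where "s = max t 0"
  define N where "N = {\<omega> \<in> space M. \<forall>n. (\<Sum>k<n. D 1 k \<omega>) \<le> s}"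
  have [measurable]: "N \<in> sets M" unfolding N_def by measurable
  define y where "y = l $ 1 * s / (1 + l $ 1 * s)"
  have s: "0 \<le> s" by (simp add: s_def)
  have p: "0 < 1 + l $ 1 * s" using s l[of 1] by (simp add: add_pos_nonneg)
  have y: "0 \<le> y" "y < 1" using s l[of 1] p by (simp_all add: y_def)
  have "emeasure M N \<le> ennreal (y ^ n)" for n
  proof -
    have "emeasure M N \<le> emeasure M {\<omega> \<in> space M. (\<Sum>k<n. D 1 k \<omega>) \<le> s}"
      by (rule emeasure_mono) (auto simp: N_def)
    then show ?thesis
      using emeasure_gcp_arrival_le[OF durations_prob_space l durations_gcp s, of 1 n] by (simp add: y_def)
  qed
  moreover have "(\<lambda>n. ennreal (y ^ n)) \<longlonglongrightarrow> ennreal 0"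
    using y by (intro tendsto_ennrealI LIMSEQ_realpow_zero)
  ultimately have "emeasure M N \<le> ennreal 0"
    by (intro LIMSEQ_le_const[of "\<lambda>n. ennreal (y ^ n)"]) auto
  then have N0: "emeasure M N = 0" by simp
  have "AE \<omega> in M. \<omega> \<notin> N" by (rule AE_I[OF _ N0]) auto
  then show ?thesis
    using AE_durations_positive AE_space
  proof eventually_elim
    case (elim \<omega>)
    then obtain n where n: "s < (\<Sum>k<n. D 1 k \<omega>)" by (auto simp: N_def not_le)
    have "total_dur D 1 (visits 1 (4 * n)) \<omega> \<le> (\<Sum>i\<in>UNIV. total_dur D i (visits i (4 * n)) \<omega>)"
      using elim(2) by (intro member_le_sum) (auto simp: total_dur_def sum_nonneg less_imp_le)
    then have "(\<Sum>k<n. D 1 k \<omega>) \<le> switch_time D (4 * n) \<omega>"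
      by (simp add: switch_time_eq_visits visits_def total_dur_def)
    with n show ?case by (intro exI[of _ "4 * n"]) (simp add: s_def)
  qed
qed

text \<open>
  Here \<open>j\<close> is the current direction and \<open>a\<close>, \<open>b\<close>, \<open>d\<close> are the other three. Given their occupation times \<open>u\<close>, \<open>v\<close>, \<open>w\<close>, the
  position is determined, and the event only asks that \<open>t - u - v - w\<close> lies between two consecutive arrival
  times of the process of direction \<open>j\<close>. Integrating out that process first leaves a three-fold integral
  against arrival densities, to which the assumed change of coordinates applies.
\<close>
lemma path_law_coordinates:
  assumes c: "c > 0" and t: "t > 0"
    and U: "UNIV = {a, b, d, j}" "distinct [a, b, d, j]" and j: "j = leg m"
    and cov: "\<And>G :: real \<times> real \<times> real \<Rightarrow> ennreal. G \<in> borel_measurable borel \<Longrightarrow>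
      (\<integral>\<^sup>+ x. G (tau c a x t, tau c b x t, tau c d x t) \<partial>lborel) =
       ennreal (det (matA c)) * (\<integral>\<^sup>+ u. \<integral>\<^sup>+ v. \<integral>\<^sup>+ w. G (u, v, w) \<partial>lborel \<partial>lborel \<partial>lborel)"
    and B[measurable]: "B \<in> sets borel" and BT: "B \<subseteq> interior (tetra c t)"
  shows "emeasure M {\<omega> \<in> space M. switch_time D m \<omega> \<le> t \<and> t < switch_time D (Suc m) \<omega> \<and> position c D t \<omega> \<in> B}
    = (\<integral>\<^sup>+ x \<in> B. ennreal (path_density l c t m x) \<partial>lborel)"
proof -
  interpret prob_space M by (rule durations_prob_space)
  let ?A = "{\<omega> \<in> space M. switch_time D m \<omega> \<le> t \<and> t < switch_time D (Suc m) \<omega> \<and> position c D t \<omega> \<in> B}"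
  have [measurable]: "?A \<in> sets M" by measurable
  have ne: "a \<noteq> b" "a \<noteq> d" "a \<noteq> j" "b \<noteq> d" "b \<noteq> j" "d \<noteq> j" "b \<noteq> a" "d \<noteq> a" "j \<noteq> a" "d \<noteq> b" "j \<noteq> b" "j \<noteq> d"
    using U(2) by auto
  have sumU: "(\<Sum>i\<in>UNIV. f i) = f a + f b + f d + f j" for f :: "4 \<Rightarrow> 'z :: real_vector"
    using ne by (simp add: U(1) add.assoc)
  have detA: "0 < det (matA c)" using c by (simp add: det_matA)
  have "UNIV - {j} = {a, b, d}" using U ne by auto
  then have pd: "path_density l c t m x = gcp_count_prob (l $ j) (visits j m) (tau c j x t) *
      (gcp_density (l $ a) (visits a m) (tau c a x t) * (gcp_density (l $ b) (visits b m) (tau c b x t) *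
       gcp_density (l $ d) (visits d m) (tau c d x t))) / det (matA c)" for x
    using ne by (simp add: path_density_def j[symmetric])
  show ?thesis
  proof (cases "visits a m = 0 \<or> visits b m = 0 \<or> visits d m = 0")
    case True
    \<comment> \<open>a direction that has not been used yet keeps the particle on a face of the tetrahedron\<close>
    then obtain i where i: "i \<noteq> j" "visits i m = 0" using ne by blast
    have "AE \<omega> in M. \<omega> \<in> ?A \<longleftrightarrow> \<omega> \<in> {}"
      using AE_durations_positive
    proof eventually_elim
      case (elim \<omega>)
      have False if "\<omega> \<in> ?A"
      proof -
        have A: "switch_time D m \<omega> \<le> t" "t < switch_time D (Suc m) \<omega>" "position c D t \<omega> \<in> B"
          using that by simp_all
        have "tau c i (position c D t \<omega>) t = 0"
          using elim c A i by (subst tau_position[of D \<omega> m]) (auto simp: occupation_def j total_dur_def)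
        moreover have "0 < tau c i (position c D t \<omega>) t"
          using subsetD[OF BT A(3)] unfolding interior_tetra[OF c t] by simp
        ultimately show False by simp
      qed
      then show ?case by blast
    qed
    then have "emeasure M ?A = emeasure M {}" by (rule emeasure_eq_AE) simp_all
    moreover have "path_density l c t m x = 0" for x
      using True by (auto simp: pd gcp_density_def)
    ultimately show ?thesis by simp
  next
    case False
    let ?S = "\<lambda>i. total_dur D i (visits i m)"
    define Z where "Z i \<omega> = (?S i \<omega>, total_dur D i (Suc (visits i m)) \<omega>)" for i \<omega>
    define place where "place u v w = (c * u) *\<^sub>R dir a + (c * v) *\<^sub>R dir b + (c * w) *\<^sub>R dir d
        + (c * (t - u - v - w)) *\<^sub>R dir j" for u v w
    define H where "H u v w = indicator B (place u v w)
        * ennreal (gcp_count_prob (l $ j) (visits j m) (t - u - v - w))" for u v w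
    have [measurable]: "(\<lambda>x. place (f x) (g x) (h x)) \<in> borel_measurable N"
      if [measurable]: "f \<in> borel_measurable N" "g \<in> borel_measurable N" "h \<in> borel_measurable N"
      for f g h and N :: "'z measure"
      unfolding place_def by measurable
    have [measurable]: "(\<lambda>x. H (f x) (g x) (h x)) \<in> borel_measurable N"
      if [measurable]: "f \<in> borel_measurable N" "g \<in> borel_measurable N" "h \<in> borel_measurable N"
      for f g h and N :: "'z measure"
      unfolding H_def by measurable
    let ?F = "\<lambda>(p :: real \<times> real, q :: real \<times> real, r :: real \<times> real, z :: real \<times> real).
       indicator B (place (fst p) (fst q) (fst r)) *
       (if fst p + fst q + fst r + fst z \<le> t \<and> t < fst p + fst q + fst r + snd z then 1 else 0 :: ennreal)"
    have fst_snd[measurable]: "(\<lambda>x. fst (f x)) \<in> borel_measurable N" "(\<lambda>x. snd (f x)) \<in> borel_measurable N"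
      if "f \<in> borel_measurable N" for f :: "'z \<Rightarrow> real \<times> real" and N
      by (rule measurable_compose[OF that], simp add: borel_measurable_continuous_onI continuous_on_fst
          continuous_on_snd)+
    \<comment> \<open>each \<open>Z i\<close> is a function of the whole \<open>i\<close>-th sequence of durations\<close>
    have ind: "indep_vars (\<lambda>_. borel) Z UNIV"
    proof -
      have "indep_vars (\<lambda>_. Pi\<^sub>M UNIV (\<lambda>_ :: nat. borel)) (\<lambda>i \<omega> k. D i k \<omega>) UNIV"
        using dur by (simp add: gcp_durations_def)
      then have "indep_vars (\<lambda>_. borel) (\<lambda>i \<omega>. (\<lambda>p. (\<Sum>k<visits i m. p k, \<Sum>k<Suc (visits i m). p k)) (\<lambda>k. D i
          k \<omega>)) UNIV"
        by (rule indep_vars_compose2) measurable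
      then show ?thesis by (simp add: Z_def[abs_def] total_dur_def)
    qed
    have "emeasure M ?A = (\<integral>\<^sup>+ \<omega>. indicator ?A \<omega> \<partial>M)" by simp
    also have "\<dots> = (\<integral>\<^sup>+ \<omega>. ?F (Z a \<omega>, Z b \<omega>, Z d \<omega>, Z j \<omega>) \<partial>M)"
    proof (rule nn_integral_cong_AE)
      show "AE \<omega> in M. indicator ?A \<omega> = ?F (Z a \<omega>, Z b \<omega>, Z d \<omega>, Z j \<omega>)"
        using AE_durations_positive AE_space
      proof eventually_elim
        case (elim \<omega>)
        have T: "switch_time D m \<omega> = ?S a \<omega> + ?S b \<omega> + ?S d \<omega> + ?S j \<omega>"
          by (simp add: switch_time_eq_visits sumU)
        have T': "switch_time D (Suc m) \<omega> = ?S a \<omega> + ?S b \<omega> + ?S d \<omega> + total_dur D j (Suc (visits j m)) \<omega>"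
          by (simp add: switch_time_Suc T total_dur_Suc flip: j)
        have "position c D t \<omega> = place (?S a \<omega>) (?S b \<omega>) (?S d \<omega>)"
          if "switch_time D m \<omega> \<le> t" "t < switch_time D (Suc m) \<omega>"
          using elim(1) that ne
          by (subst position_eq_occupation[of D \<omega> m]) (simp_all add: sumU occupation_def place_def T
              algebra_simps flip: j)
        then show ?case using elim(2) by (auto simp: Z_def T T' indicator_def)
      qed
    qed
    also have "\<dots> = (\<integral>\<^sup>+ \<omega>1. \<integral>\<^sup>+ \<omega>2. \<integral>\<^sup>+ \<omega>3. \<integral>\<^sup>+ \<omega>4. ?F (Z a \<omega>1, Z b \<omega>2, Z d \<omega>3, Z j \<omega>4) \<partial>M \<partial>M \<partial>M \<partial>M)"
      by (rule nn_integral_indep_four[OF ind U]) (unfold case_prod_beta, measurable)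
    also have "\<dots> = (\<integral>\<^sup>+ \<omega>1. \<integral>\<^sup>+ \<omega>2. \<integral>\<^sup>+ \<omega>3. H (?S a \<omega>1) (?S b \<omega>2) (?S d \<omega>3) \<partial>M \<partial>M \<partial>M)"
    proof (intro nn_integral_cong)
      fix \<omega>1 \<omega>2 \<omega>3
      let ?u = "?S a \<omega>1" and ?v = "?S b \<omega>2" and ?w = "?S d \<omega>3"
      let ?E = "{\<omega> \<in> space M. ?S j \<omega> \<le> t - ?u - ?v - ?w
          \<and> t - ?u - ?v - ?w < total_dur D j (Suc (visits j m)) \<omega>}"
      have [measurable]: "?E \<in> sets M" by measurable
      have "(\<integral>\<^sup>+ \<omega>4. ?F (Z a \<omega>1, Z b \<omega>2, Z d \<omega>3, Z j \<omega>4) \<partial>M)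
          = (\<integral>\<^sup>+ \<omega>4. indicator B (place ?u ?v ?w) * indicator ?E \<omega>4 \<partial>M)"
        by (rule nn_integral_cong) (auto simp: Z_def indicator_def)
      also have "\<dots> = indicator B (place ?u ?v ?w) * emeasure M ?E"
        by (simp add: nn_integral_cmult)
      also have "emeasure M ?E = ennreal (gcp_count_prob (l $ j) (visits j m) (t - ?u - ?v - ?w))"
        unfolding total_dur_def by (rule emeasure_gcp_count[OF durations_prob_space l durations_gcp])
      finally show "(\<integral>\<^sup>+ \<omega>4. ?F (Z a \<omega>1, Z b \<omega>2, Z d \<omega>3, Z j \<omega>4) \<partial>M) = H ?u ?v ?w"
        by (simp add: H_def)
    qed
    also have "\<dots> = (\<integral>\<^sup>+ \<omega>1. \<integral>\<^sup>+ \<omega>2. (\<integral>\<^sup>+ w. ennreal (gcp_density (l $ d) (visits d m) w)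
        * H (?S a \<omega>1) (?S b \<omega>2) w \<partial>lborel) \<partial>M \<partial>M)"
      unfolding total_dur_def using False
      by (intro nn_integral_cong nn_integral_gcp_arrival[OF durations_prob_space l durations_gcp]) auto
    also have "\<dots> = (\<integral>\<^sup>+ \<omega>1. (\<integral>\<^sup>+ v. ennreal (gcp_density (l $ b) (visits b m) v) *
        (\<integral>\<^sup>+ w. ennreal (gcp_density (l $ d) (visits d m) w) * H (?S a \<omega>1) v w \<partial>lborel) \<partial>lborel) \<partial>M)"
      unfolding total_dur_def using False
      by (intro nn_integral_cong nn_integral_gcp_arrival[OF durations_prob_space l durations_gcp]) auto
    also have "\<dots> = (\<integral>\<^sup>+ u. ennreal (gcp_density (l $ a) (visits a m) u)
        * (\<integral>\<^sup>+ v. ennreal (gcp_density (l $ b) (visits b m) v) *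
        (\<integral>\<^sup>+ w. ennreal (gcp_density (l $ d) (visits d m) w) * H u v w \<partial>lborel) \<partial>lborel) \<partial>lborel)"
      unfolding total_dur_def using False
      by (intro nn_integral_gcp_arrival[OF durations_prob_space l durations_gcp]) auto
    also have "\<dots> = (\<integral>\<^sup>+ u. \<integral>\<^sup>+ v. \<integral>\<^sup>+ w. ennreal (gcp_density (l $ a) (visits a m) u) *
        (ennreal (gcp_density (l $ b) (visits b m) v) * (ennreal (gcp_density (l $ d) (visits d m) w)
            * H u v w))
        \<partial>lborel \<partial>lborel \<partial>lborel)"
      by (simp add: nn_integral_cmult)
    finally have I: "emeasure M ?A = (\<integral>\<^sup>+ u. \<integral>\<^sup>+ v. \<integral>\<^sup>+ w. ennreal (gcp_density (l $ a) (visits a m) u) *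
        (ennreal (gcp_density (l $ b) (visits b m) v) * (ennreal (gcp_density (l $ d) (visits d m) w)
            * H u v w))
        \<partial>lborel \<partial>lborel \<partial>lborel)" .
    let ?G = "\<lambda>p. ennreal (gcp_density (l $ a) (visits a m) (fst p)) *
        (ennreal (gcp_density (l $ b) (visits b m) (fst (snd p))) *
         (ennreal (gcp_density (l $ d) (visits d m) (snd (snd p))) * H (fst p) (fst (snd p)) (snd (snd p))))"
    have G: "?G \<in> borel_measurable borel"
      unfolding borel_prod[symmetric] by measurable
    have "ennreal (det (matA c)) * emeasure M ?A
        = (\<integral>\<^sup>+ x. ?G (tau c a x t, tau c b x t, tau c d x t) \<partial>lborel)"
      unfolding I using cov[OF G] by simp
    also have "\<dots> = (\<integral>\<^sup>+ x. ennreal (det (matA c)) * (ennreal (path_density l c t m x)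
        * indicator B x) \<partial>lborel)"
    proof (rule nn_integral_cong)
      fix x
      have "t - tau c a x t - tau c b x t - tau c d x t = tau c j x t"
        using sum_tau[of c x t] c by (simp add: sumU)
      moreover from this have "place (tau c a x t) (tau c b x t) (tau c d x t) = x"
        using sum_tau_dir[of c x t] c by (simp add: sumU place_def)
      ultimately show "?G (tau c a x t, tau c b x t, tau c d x t)
         = ennreal (det (matA c)) * (ennreal (path_density l c t m x) * indicator B x)"
        using l detA
        by (simp add: H_def pd gcp_density_nonneg gcp_count_prob_nonneg
            ennreal_mult[symmetric] split: split_indicator)
    qed
    also have "\<dots> = ennreal (det (matA c)) * (\<integral>\<^sup>+ x \<in> B. ennreal (path_density l c t m x) \<partial>lborel)"
      by (rule nn_integral_cmult) (simp add: pd)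
    finally show ?thesis using detA by (simp add: ennreal_mult_cancel_left)
  qed
qed

lemma path_law:
  assumes c: "c > 0" and t: "t > 0"
    and B: "B \<in> sets borel" and BT: "B \<subseteq> interior (tetra c t)"
  shows "emeasure M {\<omega> \<in> space M. switch_time D m \<omega> \<le> t \<and> t < switch_time D (Suc m) \<omega> \<and> position c D t \<omega> \<in> B}
    = (\<integral>\<^sup>+ x \<in> B. ennreal (path_density l c t m x) \<partial>lborel)"
proof -
  have U: "(UNIV :: 4 set) = {2, 3, 4, 1}" "(UNIV :: 4 set) = {1, 3, 4, 2}" "(UNIV :: 4 set) = {1, 2, 4, 3}"
    "(UNIV :: 4 set) = {1, 2, 3, 4}"
    unfolding UNIV_4 by auto
  consider "1 = leg m" | "2 = leg m" | "3 = leg m" | "4 = leg m" using exhaust_4[of "leg m"] by metis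
  then show ?thesis
  proof cases
    case 1
    show ?thesis
      by (rule path_law_coordinates[OF c t U(1) _ 1 nn_integral_tau234[OF _ c] B BT]) simp_all
  next
    case 2
    show ?thesis
      by (rule path_law_coordinates[OF c t U(2) _ 2 nn_integral_tau134[OF _ c] B BT]) simp_all
  next
    case 3
    show ?thesis
      by (rule path_law_coordinates[OF c t U(3) _ 3 nn_integral_tau124[OF _ c] B BT]) simp_all
  next
    case 4
    show ?thesis
      by (rule path_law_coordinates[OF c t U(4) _ 4 nn_integral_tau123[OF _ c] B BT]) simp_all
  qed
qed

text \<open>
  The current direction is \<open>dir j\<close> iff the number of completed displacements is \<open>leg_offset j\<close> modulo 4, which
  splits the event according to the number of completed cycles.
\<close>
lemma position_velocity_law:
  assumes c: "c > 0" and t: "t > 0"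
    and B[measurable]: "B \<in> sets borel" and BT: "B \<subseteq> interior (tetra c t)"
  shows "emeasure M {\<omega> \<in> space M. position c D t \<omega> \<in> B \<and> velocity D t \<omega> = dir j}
    = (\<integral>\<^sup>+ x \<in> B. (\<Sum>n. ennreal (path_density l c t (4 * n + leg_offset j) x)) \<partial>lborel)"
proof -
  interpret prob_space M by (rule durations_prob_space)
  define E where "E m = {\<omega> \<in> space M. switch_time D m \<omega> \<le> t \<and> t < switch_time D (Suc m) \<omega>
      \<and> position c D t \<omega> \<in> B}" for m
  \<comment> \<open>the events \<open>E m\<close> are disjoint only where all durations are positive\<close>
  define G where "G = {\<omega> \<in> space M. \<forall>i k. 0 < D i k \<omega>}"
  define A where "A = {\<omega> \<in> space M. position c D t \<omega> \<in> B \<and> velocity D t \<omega> = dir j}"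
  have [measurable]: "E m \<in> sets M" for m unfolding E_def by measurable
  have [measurable]: "G \<in> sets M" unfolding G_def by measurable
  have [measurable]: "A \<in> sets M" unfolding A_def by measurable
  have G: "AE \<omega> in M. \<omega> \<in> G"
    using AE_durations_positive AE_space by eventually_elim (simp add: G_def)
  let ?m = "\<lambda>n. 4 * n + leg_offset j"
  have "disjoint_family (\<lambda>n. E (?m n) \<inter> G)"
    unfolding disjoint_family_on_def
  proof (intro ballI impI)
    fix n n' :: nat assume "n \<noteq> n'"
    have False if "\<omega> \<in> E (?m n) \<inter> G" "\<omega> \<in> E (?m n') \<inter> G" for \<omega>
    proof -
      have pos: "0 < D i k \<omega>" for i k using that by (simp add: G_def)
      have mono: "strict_mono (\<lambda>m. switch_time D m \<omega>)"
        by (simp add: strict_mono_Suc_iff switch_time_Suc pos)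
      have "switch_time D (?m n) \<omega> < switch_time D (Suc (?m n')) \<omega>"
        "switch_time D (?m n') \<omega> < switch_time D (Suc (?m n)) \<omega>"
        using that by (auto simp: E_def)
      then have "?m n < Suc (?m n')" "?m n' < Suc (?m n)"
        by (simp_all only: strict_mono_less[OF mono])
      then show False using \<open>n \<noteq> n'\<close> by simp
    qed
    then show "(E (?m n) \<inter> G) \<inter> (E (?m n') \<inter> G) = {}" by blast
  qed
  then have "(\<Sum>n. emeasure M (E (?m n) \<inter> G)) = emeasure M (\<Union>n. E (?m n) \<inter> G)"
    by (intro suminf_emeasure) auto
  also have "\<dots> = emeasure M A"
  proof (rule emeasure_eq_AE)
    show "AE \<omega> in M. \<omega> \<in> (\<Union>n. E (?m n) \<inter> G) \<longleftrightarrow> \<omega> \<in> A"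
      using G AE_switch_time_unbounded[of t]
    proof eventually_elim
      case (elim \<omega>)
      then have \<omega>: "\<omega> \<in> space M" and pos: "0 < D i k \<omega>" for i k by (simp_all add: G_def)
      obtain k where "t < switch_time D k \<omega>" using elim by blast
      then obtain m where m: "switch_time D m \<omega> \<le> t" "t < switch_time D (Suc m) \<omega>"
        using switch_time_covers[of t D k \<omega>] t by auto
      have v: "velocity D t' \<omega> = dir (leg m')" if "switch_time D m' \<omega> \<le> t'" "t' < switch_time D (Suc m') \<omega>"
          for m' t'
        using velocity_eq_dir[of D \<omega> m' t'] pos that by blast
      show ?case
      proof
        assume "\<omega> \<in> (\<Union>n. E (?m n) \<inter> G)"
        then obtain n where n: "\<omega> \<in> E (?m n)" by blast
        moreover have "leg (?m n) = j" using leg_eq_iff by blast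
        ultimately show "\<omega> \<in> A" using v[of "?m n" t] by (simp add: E_def A_def)
      next
        assume A: "\<omega> \<in> A"
        then have "leg m = j" using v[OF m] by (simp add: A_def dir_inj)
        then obtain n where "m = ?m n" using leg_eq_iff by blast
        moreover have "\<omega> \<in> E m" using m A by (simp add: E_def A_def)
        ultimately show "\<omega> \<in> (\<Union>n. E (?m n) \<inter> G)" using elim by blast
      qed
    qed
  qed simp_all
  finally have "emeasure M A = (\<Sum>n. emeasure M (E (?m n) \<inter> G))" ..
  also have "\<dots> = (\<Sum>n. \<integral>\<^sup>+ x \<in> B. ennreal (path_density l c t (?m n) x) \<partial>lborel)"
  proof (rule suminf_cong)
    fix n
    have "AE \<omega> in M. \<omega> \<in> E (?m n) \<inter> G \<longleftrightarrow> \<omega> \<in> E (?m n)"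
      using G by eventually_elim simp
    then have "emeasure M (E (?m n) \<inter> G) = emeasure M (E (?m n))"
      by (rule emeasure_eq_AE) simp_all
    then show "emeasure M (E (?m n) \<inter> G) = (\<integral>\<^sup>+ x \<in> B. ennreal (path_density l c t (?m n) x) \<partial>lborel)"
      unfolding E_def by (simp only: path_law[OF c t B BT])
  qed
  also have "\<dots> = (\<integral>\<^sup>+ x. (\<Sum>n. ennreal (path_density l c t (?m n) x) * indicator B x) \<partial>lborel)"
    unfolding path_density_def by (rule nn_integral_suminf[symmetric]) measurable
  also have "\<dots> = (\<integral>\<^sup>+ x \<in> B. (\<Sum>n. ennreal (path_density l c t (?m n) x)) \<partial>lborel)"
    by simp
  finally show ?thesis by (simp only: A_def)
qed

lemma AE_initial: "AE \<omega> in M. position c D 0 \<omega> = 0 \<and> velocity D 0 \<omega> = dir 1"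
  using AE_durations_positive
proof eventually_elim
  case (elim \<omega>)
  then have pos: "0 < D i k \<omega>" for i k by blast
  have "switch_time D 0 \<omega> \<le> 0" "0 < switch_time D (Suc 0) \<omega>"
    using pos by (simp_all add: switch_time_Suc)
  moreover have "occupation D 0 0 \<omega> i = 0" for i
    by (cases "i = leg 0") (simp_all add: occupation_def total_dur_def)
  ultimately show ?case
    using velocity_eq_dir[of D \<omega> 0 0, OF pos] position_eq_occupation[of D \<omega> 0 0 c, OF pos]
        by (simp add: leg_def)
qed

lemma conditional_position_velocity_law:
  assumes "c > 0" and "t > 0"
    and B[measurable]: "B \<in> sets borel" and "B \<subseteq> interior (tetra c t)"
  shows "ennreal (\<P>(\<omega> in M. position c D t \<omega> \<in> B \<and> velocity D t \<omega> = dir j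
             \<bar> position c D 0 \<omega> = 0 \<and> velocity D 0 \<omega> = dir 1))
    = (\<integral>\<^sup>+ x \<in> B. (\<Sum>n. ennreal (path_density l c t (4 * n + leg_offset j) x)) \<partial>lborel)"
proof -
  interpret prob_space M by (rule durations_prob_space)
  define Q where "Q \<omega> \<longleftrightarrow> position c D 0 \<omega> = 0 \<and> velocity D 0 \<omega> = dir 1" for \<omega>
  define P where "P \<omega> \<longleftrightarrow> position c D t \<omega> \<in> B \<and> velocity D t \<omega> = dir j" for \<omega>
  have Q: "AE \<omega> in M. Q \<omega>" using AE_initial by (simp add: Q_def)
  have [measurable]: "{\<omega> \<in> space M. Q \<omega>} \<in> sets M" unfolding Q_def by measurable
  have [measurable]: "{\<omega> \<in> space M. P \<omega>} \<in> sets M" unfolding P_def by measurable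
  have [measurable]: "{\<omega> \<in> space M. P \<omega> \<and> Q \<omega>} \<in> sets M" unfolding P_def Q_def by measurable
  have "prob {\<omega> \<in> space M. Q \<omega>} = 1" using Q by (simp add: prob_Collect_eq_1)
  moreover have "prob {\<omega> \<in> space M. P \<omega> \<and> Q \<omega>} = prob {\<omega> \<in> space M. P \<omega>}"
    using Q by (intro measure_eq_AE) (auto elim: eventually_mono)
  ultimately have "cond_prob M P Q = prob {\<omega> \<in> space M. P \<omega>}"
    by (simp add: cond_prob_def)
  then have "ennreal (cond_prob M P Q) = emeasure M {\<omega> \<in> space M. P \<omega>}"
    by (simp add: emeasure_eq_measure)
  then show ?thesis
    unfolding P_def[abs_def] Q_def[abs_def] position_velocity_law[OF assms] .
qed

end

section \<open>Summation over the number of cycles\<close>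

text \<open>
  Cauchy product with the geometric series.
\<close>
lemma power_series_partial_sums:
  fixes Y :: real
  assumes Y: "0 \<le> Y" "Y < 1" and \<alpha>: "\<And>n. 0 \<le> \<alpha> n" and S: "(\<lambda>n. \<alpha> n * Y ^ n) sums A"
  shows "(\<lambda>n. (\<Sum>i\<le>n. \<alpha> i) * Y ^ n) sums (A / (1 - Y))"
proof -
  have g: "(\<lambda>n. Y ^ n) sums (1 / (1 - Y))" using Y by (intro geometric_sums) simp
  have "(\<lambda>k. \<Sum>i\<le>k. (\<alpha> i * Y ^ i) * Y ^ (k - i)) sums ((\<Sum>k. \<alpha> k * Y ^ k) * (\<Sum>k. Y ^ k))"
    using S g Y \<alpha> by (intro Cauchy_product_sums) (simp_all add: sums_iff)
  also have "(\<lambda>k. \<Sum>i\<le>k. (\<alpha> i * Y ^ i) * Y ^ (k - i)) = (\<lambda>k. (\<Sum>i\<le>k. \<alpha> i) * Y ^ k)"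
    by (auto simp: sum_distrib_right mult.assoc simp flip: power_add intro!: ext sum.cong)
  also have "(\<Sum>k. \<alpha> k * Y ^ k) * (\<Sum>k. Y ^ k) = A / (1 - Y)"
    using S g by (simp add: sums_iff)
  finally show ?thesis .
qed

text \<open>
  Every cubic polynomial \<open>p\<close> with leading coefficient 1 and \<open>p (-1) = 0\<close>, where \<open>p k\<close> weighs \<open>Y\<^sup>k\<close>, has a generating
  function of this form: write it in terms of \<open>(k + 1)(k + 2)(k + 3)\<close>, \<open>(k + 1)(k + 2) / 2\<close> and \<open>k + 1\<close>.
\<close>
definition cubic_series :: "real \<Rightarrow> real \<Rightarrow> real \<Rightarrow> real" where
  "cubic_series e f Y = 6 / (1 - Y) ^ 4 - e / (1 - Y) ^ 3 + f / (1 - Y)\<^sup>2"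

lemma cubic_series_sums:
  fixes Y :: real
  assumes Y: "0 \<le> Y" "Y < 1"
  shows "(\<lambda>k. (real (k + 1) * real (k + 2) * real (k + 3) - e * (real (k + 1) * real (k + 2) / 2) + f
      * real (k + 1)) * Y ^ k)
      sums cubic_series e f Y"
proof -
  have s0: "(\<lambda>k. 1 * Y ^ k) sums (1 / (1 - Y))" using Y geometric_sums[of Y] by simp
  have "(\<lambda>k. (\<Sum>i\<le>k. 1) * Y ^ k) sums (1 / (1 - Y) / (1 - Y))"
    by (rule power_series_partial_sums[OF Y _ s0]) simp
  then have s1: "(\<lambda>k. real (k + 1) * Y ^ k) sums (1 / (1 - Y)\<^sup>2)"
    by (simp add: power2_eq_square add.commute)
  have "(\<lambda>k. (\<Sum>i\<le>k. real (i + 1)) * Y ^ k) sums (1 / (1 - Y)\<^sup>2 / (1 - Y))"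
    by (rule power_series_partial_sums[OF Y _ s1]) simp
  also have "(\<lambda>k. \<Sum>i\<le>k. real (i + 1)) = (\<lambda>k. real (k + 1) * real (k + 2) / 2)"
  proof
    show "(\<Sum>i\<le>k. real (i + 1)) = real (k + 1) * real (k + 2) / 2" for k
      by (induction k) (simp_all add: field_simps)
  qed
  finally have s2: "(\<lambda>k. real (k + 1) * real (k + 2) / 2 * Y ^ k) sums (1 / (1 - Y) ^ 3)"
    by (simp add: power2_eq_square power3_eq_cube mult.assoc)
  have "(\<lambda>k. (\<Sum>i\<le>k. real (i + 1) * real (i + 2) / 2) * Y ^ k) sums (1 / (1 - Y) ^ 3 / (1 - Y))"
    by (rule power_series_partial_sums[OF Y _ s2]) simp
  also have "(\<lambda>k. \<Sum>i\<le>k. real (i + 1) * real (i + 2) / 2)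
      = (\<lambda>k. real (k + 1) * real (k + 2) * real (k + 3) / 6)"
  proof
    show "(\<Sum>i\<le>k. real (i + 1) * real (i + 2) / 2) = real (k + 1) * real (k + 2) * real (k + 3) / 6" for k
      by (induction k) (simp_all add: field_simps)
  qed
  finally have s3: "(\<lambda>k. real (k + 1) * real (k + 2) * real (k + 3) / 6 * Y ^ k) sums (1 / (1 - Y) ^ 4)"
    by (simp add: power4_eq_xxxx power3_eq_cube mult.assoc)
  have "(\<lambda>k. 6 * (real (k + 1) * real (k + 2) * real (k + 3) / 6 * Y ^ k) - e * (real (k + 1)
      * real (k + 2) / 2 * Y ^ k)
      + f * (real (k + 1) * Y ^ k)) sums (6 * (1 / (1 - Y) ^ 4) - e * (1 / (1 - Y) ^ 3) + f
          * (1 / (1 - Y)\<^sup>2))"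
    by (intro sums_add sums_diff sums_mult s1 s2 s3)
  moreover have "6 * (A / 6 * P) - e * (B * P) + f * (C * P) = (A - e * B + f * C) * P" for A B C P :: real
    by (simp add: algebra_simps)
  ultimately show ?thesis
    by (simp only: cubic_series_def times_divide_eq_right mult_1_right)
qed

definition time_ratio :: "real \<Rightarrow> real \<Rightarrow> real" where
  "time_ratio l s = l * s / (1 + l * s)"

text \<open>
  If direction \<open>j\<close> is current after \<open>n\<close> complete cycles, the factors \<open>n\<close> of the arrival densities combine to
  \<open>n\<^sup>3\<close>, \<open>(n + 1) n\<^sup>2\<close>, \<open>(n + 1)\<^sup>2 n\<close> and \<open>(n + 1)\<^sup>3\<close> for \<open>j = 1, 2, 3, 4\<close>. The first three vanish at \<open>n = 0\<close>, where the particle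
  is still on the boundary; the substitution \<open>n = k + 1\<close> gives the coefficients below and the
  additional powers of the \<open>y\<^sub>i\<close>.
\<close>
definition cycle_series :: "4 \<Rightarrow> (4 \<Rightarrow> real) \<Rightarrow> real" where
  "cycle_series j y = (if j = 1 then y 1 * cubic_series 6 1 (y 1 * y 2 * y 3 * y 4)
     else if j = 2 then y 1 * y 2 * cubic_series 4 0 (y 1 * y 2 * y 3 * y 4)
     else if j = 3 then y 1 * y 2 * y 3 * cubic_series 2 0 (y 1 * y 2 * y 3 * y 4)
     else cubic_series 6 1 (y 1 * y 2 * y 3 * y 4))"

text \<open>
  The sum of the path densities over all paths whose current direction is \<open>dir j\<close>.
\<close>
definition direction_density :: "real ^ 4 \<Rightarrow> real \<Rightarrow> real \<Rightarrow> 4 \<Rightarrow> real ^ 3 \<Rightarrow> real" where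
  "direction_density l c t j x = 1 / (1 + l $ j * tau c j x t) *
     (\<Prod>i\<in>UNIV - {j}. l $ i / (1 + l $ i * tau c i x t)\<^sup>2) *
     cycle_series j (\<lambda>i. time_ratio (l $ i) (tau c i x t)) / det (matA c)"

lemma time_ratio_bounds:
  assumes "l > 0" "s > 0"
  shows "0 < time_ratio l s" "time_ratio l s < 1"
proof -
  have "0 < 1 + l * s" using assms by (simp add: add_pos_pos)
  then show "0 < time_ratio l s" "time_ratio l s < 1" using assms by (simp_all add: time_ratio_def)
qed

lemma prod4_less_1:
  fixes a b d e :: real
  assumes "0 < a" "a < 1" "0 < b" "b < 1" "0 < d" "d < 1" "0 < e" "e < 1"
  shows "0 < a * b * d * e" "a * b * d * e < 1"
proof -
  have less: "p * q < 1" if "0 < p" "p < 1" "0 < q" "q < 1" for p q :: real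
    using mult_strict_mono[of p 1 q 1] that by simp
  have "a * b * d < 1" using assms less[of "a * b" d] less[of a b] by simp
  then show "a * b * d * e < 1" using assms less[of "a * b * d" e] by simp
  show "0 < a * b * d * e" using assms by simp
qed

lemma UNIV_minus_4:
  "UNIV - {1 :: 4} = {2, 3, 4}" "UNIV - {2 :: 4} = {1, 3, 4}" "UNIV - {3 :: 4} = {1, 2, 4}" "UNIV - {4 :: 4}
      = {1, 2, 3}"
  unfolding UNIV_4 by auto

lemma sums_shift_scale:
  fixes a b :: "nat \<Rightarrow> real"
  assumes "\<And>k. a (Suc k) = K * (w * b k)" "a 0 = 0" "b sums s"
  shows "a sums (K * (w * s))"
proof -
  have "(\<lambda>k. a (Suc k)) sums (K * (w * s))"
    unfolding assms(1) by (intro sums_mult assms(3))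
  from sums_Suc[OF this] show ?thesis using assms(2) by simp
qed

lemma path_density_sums:
  assumes l: "\<And>i. 0 < l $ i" and x: "\<And>i. 0 < tau c i x t"
  shows "(\<lambda>n. path_density l c t (4 * n + leg_offset j) x) sums direction_density l c t j x"
proof -
  define y where "y i = time_ratio (l $ i) (tau c i x t)" for i
  define \<delta> where "\<delta> i = 1 / (1 + l $ i * tau c i x t)" for i
  define \<rho> where "\<rho> i = l $ i / (1 + l $ i * tau c i x t)\<^sup>2" for i
  define Y where "Y = y 1 * y 2 * y 3 * y 4"
  have nn: "\<not> tau c i x t < 0" for i using x[of i] by simp
  have cnt: "gcp_count_prob (l $ i) n (tau c i x t) = y i ^ n * \<delta> i" for i n
    using nn by (simp add: gcp_count_prob_def y_def time_ratio_def \<delta>_def)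
  have den: "gcp_density (l $ i) n (tau c i x t) = real n * y i ^ (n - 1) * \<rho> i" for i n
    using nn by (simp add: gcp_density_def y_def time_ratio_def \<rho>_def)
  have Y: "0 \<le> Y" "Y < 1"
    unfolding Y_def y_def using prod4_less_1[OF time_ratio_bounds[OF l x] time_ratio_bounds[OF l x]
        time_ratio_bounds[OF l x] time_ratio_bounds[OF l x], of 1 1 2 2 3 3 4 4]
            by (simp_all add: less_imp_le)
  note S = cubic_series_sums[OF Y]
  \<comment> \<open>the part of every term that does not depend on the number of cycles\<close>
  define C where "C j = \<delta> j * (\<Prod>i\<in>UNIV - {j}. \<rho> i) / det (matA c)" for j
  have dens: "direction_density l c t j x = C j * cycle_series j y" for j
    by (simp add: direction_density_def C_def \<delta>_def \<rho>_def y_def[abs_def])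
  have path: "path_density l c t m x = gcp_count_prob (l $ leg m) (visits (leg m) m) (tau c (leg m) x t) *
     (\<Prod>i\<in>UNIV - {leg m}. gcp_density (l $ i) (visits i m) (tau c i x t)) / det (matA c)" for m
    by (rule path_density_def)
  consider "j = 1" | "j = 2" | "j = 3" | "j = 4" using exhaust_4 by metis
  then show ?thesis
  proof cases
    case 1
    then have off: "leg_offset j = 0" by (simp add: leg_offset_def)
    have "path_density l c t (4 * Suc k + leg_offset j) x
       = C 1 * (y 1 * ((real (k + 1) * real (k + 2) * real (k + 3) - 6 * (real (k + 1)
           * real (k + 2) / 2) + 1 * real (k + 1)) * Y ^ k))" for k
    proof -
      have v: "visits i (4 * Suc k) = Suc k" for i by (simp add: visits_def)
      have "path_density l c t (4 * Suc k) x
        = y 1 ^ Suc k * \<delta> 1 * (\<Prod>i\<in>UNIV - {1}. real (Suc k) * y i ^ k * \<rho> i) / det (matA c)"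
        unfolding path leg_simps(1) v cnt den by simp
      also have "\<dots> = C 1 * (y 1 * (real (Suc k) ^ 3 * Y ^ k))"
        by (simp add: C_def Y_def UNIV_minus_4 power_mult_distrib power3_eq_cube ac_simps)
      also have "real (Suc k) ^ 3 = real (k + 1) * real (k + 2) * real (k + 3) - 6 * (real (k + 1)
          * real (k + 2) / 2) + 1 * real (k + 1)"
        by (simp add: power3_eq_cube algebra_simps)
      finally show ?thesis unfolding off add_0_right .
    qed
    moreover have "path_density l c t (4 * 0 + leg_offset j) x = 0"
      using 1 by (simp add: path leg_offset_def leg_def den UNIV_minus_4)
    ultimately have "(\<lambda>n. path_density l c t (4 * n + leg_offset j) x) sums (C 1 * (y 1
        * cubic_series 6 1 Y))"
      by (rule sums_shift_scale[where a = "\<lambda>n. path_density l c t (4 * n + leg_offset j) x"]) (rule S)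
    then show ?thesis using 1 by (simp add: dens cycle_series_def Y_def)
  next
    case 2
    then have off: "leg_offset j = 1" by (simp add: leg_offset_def)
    have "path_density l c t (4 * Suc k + leg_offset j) x
       = C 2 * (y 1 * y 2 * ((real (k + 1) * real (k + 2) * real (k + 3) - 4 * (real (k + 1)
           * real (k + 2) / 2) + 0 * real (k + 1)) * Y ^ k))" for k
    proof -
      have v: "visits 1 (4 * Suc k + 1) = Suc (Suc k)" "visits 2 (4 * Suc k + 1) = Suc k"
        "visits 3 (4 * Suc k + 1) = Suc k" "visits 4 (4 * Suc k + 1) = Suc k" by (simp_all add: visits_def)
      have "path_density l c t (4 * Suc k + 1) x
        = y 2 ^ Suc k * \<delta> 2 * ((real (Suc (Suc k)) * y 1 ^ Suc k * \<rho> 1) * ((real (Suc k) * y 3 ^ k * \<rho> 3)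
            * (real (Suc k) * y 4 ^ k * \<rho> 4))) / det (matA c)"
        unfolding path leg_simps(2) UNIV_minus_4 by (simp add: v[simplified] cnt den)
      also have "\<dots> = C 2 * (y 1 * y 2 * ((real (Suc (Suc k)) * real (Suc k) * real (Suc k)) * Y ^ k))"
        by (simp add: C_def Y_def UNIV_minus_4 power_mult_distrib ac_simps)
      also have "real (Suc (Suc k)) * real (Suc k) * real (Suc k)
          = real (k + 1) * real (k + 2) * real (k + 3) - 4 * (real (k + 1) * real (k + 2) / 2) + 0
              * real (k + 1)"
        by (simp add: algebra_simps)
      finally show ?thesis unfolding off .
    qed
    moreover have "path_density l c t (4 * 0 + leg_offset j) x = 0"
      using 2 by (simp add: path leg_offset_def leg_def den UNIV_minus_4 visits_def)
    ultimately have "(\<lambda>n. path_density l c t (4 * n + leg_offset j) x) sums (C 2 * (y 1 * y 2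
        * cubic_series 4 0 Y))"
      by (rule sums_shift_scale[where a = "\<lambda>n. path_density l c t (4 * n + leg_offset j) x"]) (rule S)
    then show ?thesis using 2 by (simp add: dens cycle_series_def Y_def)
  next
    case 3
    then have off: "leg_offset j = 2" by (simp add: leg_offset_def)
    have "path_density l c t (4 * Suc k + leg_offset j) x
       = C 3 * (y 1 * y 2 * y 3 * ((real (k + 1) * real (k + 2) * real (k + 3) - 2 * (real (k + 1)
           * real (k + 2) / 2) + 0 * real (k + 1)) * Y ^ k))" for k
    proof -
      have v: "visits 1 (4 * Suc k + 2) = Suc (Suc k)" "visits 2 (4 * Suc k + 2) = Suc (Suc k)"
        "visits 3 (4 * Suc k + 2) = Suc k" "visits 4 (4 * Suc k + 2) = Suc k" by (simp_all add: visits_def)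
      have "path_density l c t (4 * Suc k + 2) x
        = y 3 ^ Suc k * \<delta> 3 * ((real (Suc (Suc k)) * y 1 ^ Suc k * \<rho> 1) * ((real (Suc (Suc k)) * y 2 ^ Suc k
            * \<rho> 2)
            * (real (Suc k) * y 4 ^ k * \<rho> 4))) / det (matA c)"
        unfolding path leg_simps(3) UNIV_minus_4 by (simp add: v[simplified] cnt den)
      also have "\<dots> = C 3 * (y 1 * y 2 * y 3 * ((real (Suc (Suc k)) * real (Suc (Suc k)) * real (Suc k))
          * Y ^ k))"
        by (simp add: C_def Y_def UNIV_minus_4 power_mult_distrib ac_simps)
      also have "real (Suc (Suc k)) * real (Suc (Suc k)) * real (Suc k)
          = real (k + 1) * real (k + 2) * real (k + 3) - 2 * (real (k + 1) * real (k + 2) / 2) + 0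
              * real (k + 1)"
        by (simp add: algebra_simps)
      finally show ?thesis unfolding off .
    qed
    moreover have "path_density l c t (4 * 0 + leg_offset j) x = 0"
      using 3 by (simp add: path leg_offset_def leg_def den UNIV_minus_4 visits_def)
    ultimately have "(\<lambda>n. path_density l c t (4 * n + leg_offset j) x) sums (C 3 * (y 1 * y 2 * y 3
        * cubic_series 2 0 Y))"
      by (rule sums_shift_scale[where a = "\<lambda>n. path_density l c t (4 * n + leg_offset j) x"]) (rule S)
    then show ?thesis using 3 by (simp add: dens cycle_series_def Y_def)
  next
    case 4
    then have off: "leg_offset j = 3" by (simp add: leg_offset_def)
    have "path_density l c t (4 * k + leg_offset j) x
       = C 4 * ((real (k + 1) * real (k + 2) * real (k + 3) - 6 * (real (k + 1) * real (k + 2) / 2) + 1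
           * real (k + 1)) * Y ^ k)" for k
    proof -
      have v: "visits 1 (4 * k + 3) = Suc k" "visits 2 (4 * k + 3) = Suc k"
        "visits 3 (4 * k + 3) = Suc k" "visits 4 (4 * k + 3) = k" by (simp_all add: visits_def)
      have "path_density l c t (4 * k + 3) x
        = y 4 ^ k * \<delta> 4 * ((real (Suc k) * y 1 ^ k * \<rho> 1) * ((real (Suc k) * y 2 ^ k * \<rho> 2)
            * (real (Suc k) * y 3 ^ k * \<rho> 3))) / det (matA c)"
        unfolding path leg_simps(4) UNIV_minus_4 by (simp add: v[simplified] cnt den)
      also have "\<dots> = C 4 * (real (Suc k) ^ 3 * Y ^ k)"
        by (simp add: C_def Y_def UNIV_minus_4 power_mult_distrib power3_eq_cube ac_simps)
      also have "real (Suc k) ^ 3 = real (k + 1) * real (k + 2) * real (k + 3) - 6 * (real (k + 1)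
          * real (k + 2) / 2) + 1 * real (k + 1)"
        by (simp add: power3_eq_cube algebra_simps)
      finally show ?thesis unfolding off .
    qed
    then have "(\<lambda>n. path_density l c t (4 * n + leg_offset j) x) sums (C 4 * cubic_series 6 1 Y)"
      using sums_mult[OF S[of 6 1], of "C 4"] by (simp only:)
    then show ?thesis using 4 by (simp add: dens cycle_series_def Y_def)
  qed
qed

section \<open>Identification of the continuous density\<close>

text \<open>
  If \<open>f x < g x\<close>, then \<open>f < p < q < g\<close> on a ball around \<open>x\<close> for some constants, and the integrals over the ball
  differ.
\<close>
lemma continuous_density_le:
  fixes f g :: "'b :: euclidean_space \<Rightarrow> real"
  assumes S: "open S" and f: "continuous_on S f" and g: "continuous_on S g"
    and nonneg: "\<And>x. x \<in> S \<Longrightarrow> 0 \<le> f x"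
    and eq: "\<And>B. B \<in> sets borel \<Longrightarrow> B \<subseteq> S \<Longrightarrow>
      (\<integral>\<^sup>+ x \<in> B. ennreal (f x) \<partial>lborel) = (\<integral>\<^sup>+ x \<in> B. ennreal (g x) \<partial>lborel)"
    and x: "x \<in> S"
  shows "g x \<le> f x"
proof (rule ccontr)
  assume "\<not> g x \<le> f x"
  then have lt: "f x < g x" by simp
  \<comment> \<open>two separating levels: one level would only give \<open>\<le>\<close> between the integrals\<close>
  define p where "p = (2 * f x + g x) / 3"
  define q where "q = (f x + 2 * g x) / 3"
  have pq: "f x < p" "p < q" "q < g x" using lt by (simp_all add: p_def q_def)
  have p0: "0 < p" using pq nonneg[OF x] by simp
  have "open (f -` {..<p} \<inter> S)" "open (g -` {q<..} \<inter> S)"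
    using continuous_open_preimage[OF f S, of "{..<p}"] continuous_open_preimage[OF g S, of "{q<..}"]
    by (simp_all add: Int_commute)
  then have "open ((f -` {..<p} \<inter> S) \<inter> (g -` {q<..} \<inter> S))" by (rule open_Int)
  moreover have "x \<in> (f -` {..<p} \<inter> S) \<inter> (g -` {q<..} \<inter> S)" using x pq by simp
  ultimately obtain e where e: "e > 0" "ball x e \<subseteq> (f -` {..<p} \<inter> S) \<inter> (g -` {q<..} \<inter> S)"
    using openE by blast
  have b: "q < g y" "f y < p" "y \<in> S" if "y \<in> ball x e" for y using e(2) that by blast+
  have meas: "emeasure lborel (ball x e) = ennreal (measure lborel (ball x e))"
    by (rule emeasure_eq_ennreal_measure) (use emeasure_bounded_finite[OF bounded_ball] in \<open>simp add:
        less_top\<close>)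
  have c: "0 < measure lborel (ball x e)"
    using content_ball_pos[OF e(1), of x] by simp
  have "ennreal q * emeasure lborel (ball x e) = (\<integral>\<^sup>+ y \<in> ball x e. ennreal q \<partial>lborel)"
    by (simp add: nn_integral_cmult_indicator)
  also have "\<dots> \<le> (\<integral>\<^sup>+ y \<in> ball x e. ennreal (g y) \<partial>lborel)"
    by (intro nn_integral_mono) (simp add: ennreal_leI less_imp_le b split: split_indicator)
  also have "\<dots> = (\<integral>\<^sup>+ y \<in> ball x e. ennreal (f y) \<partial>lborel)"
    by (intro eq[symmetric]) (simp, use b(3) in blast)
  also have "\<dots> \<le> (\<integral>\<^sup>+ y \<in> ball x e. ennreal p \<partial>lborel)"
    by (intro nn_integral_mono) (simp add: ennreal_leI less_imp_le b split: split_indicator)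
  also have "\<dots> = ennreal p * emeasure lborel (ball x e)"
    by (simp add: nn_integral_cmult_indicator)
  finally have "ennreal (q * measure lborel (ball x e)) \<le> ennreal (p * measure lborel (ball x e))"
    using pq p0 by (simp add: meas ennreal_mult)
  then have "q * measure lborel (ball x e) \<le> p * measure lborel (ball x e)"
    using p0 c by (simp add: ennreal_le_iff)
  then show False using pq c by simp
qed

lemma is_dens1_unique:
  assumes f: "is_dens1 M c D j t f" and g: "is_dens1 M c D j t g"
  shows "f = g"
proof
  fix x
  have *: "(\<integral>\<^sup>+ x \<in> B. ennreal (f x) \<partial>lborel) = (\<integral>\<^sup>+ x \<in> B. ennreal (g x) \<partial>lborel)"
    if "B \<in> sets borel" "B \<subseteq> interior (tetra c t)" for B
    using f[unfolded is_dens1_def, THEN conjunct2, THEN conjunct2, THEN conjunct2, rule_format, OF that]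
      g[unfolded is_dens1_def, THEN conjunct2, THEN conjunct2, THEN conjunct2, rule_format, OF that]
    by (rule trans[OF sym])
  show "f x = g x"
  proof (cases "x \<in> interior (tetra c t)")
    case True
    have "g x \<le> f x"
      by (rule continuous_density_le[OF open_interior _ _ _ * True]) (use f g in \<open>auto simp: is_dens1_def\<close>)
    moreover have "f x \<le> g x"
      by (rule continuous_density_le[OF open_interior _ _ _ *[symmetric] True]) (use f g in \<open>auto simp:
          is_dens1_def\<close>)
    ultimately show ?thesis by simp
  next
    case False
    then show ?thesis using f g by (simp add: is_dens1_def)
  qed
qed

lemma prod_time_ratio_less_1:
  assumes "\<And>i. 0 < l $ i" "\<And>i. 0 < tau c i x t"
  shows "time_ratio (l $ 1) (tau c 1 x t) * time_ratio (l $ 2) (tau c 2 x t) *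
    time_ratio (l $ 3) (tau c 3 x t) * time_ratio (l $ 4) (tau c 4 x t) < 1"
  by (intro prod4_less_1 time_ratio_bounds assms)

lemma continuous_on_direction_density:
  assumes c: "c > 0" and l: "\<And>i. 0 < l $ i"
  shows "continuous_on {x. \<forall>i. 0 < tau c i x t} (direction_density l c t j)"
proof -
  let ?T = "{x. \<forall>i. 0 < tau c i x t}"
  have ne: "1 + l $ i * tau c i x t \<noteq> 0" if "x \<in> ?T" for i x
  proof -
    have "0 < l $ i * tau c i x t" using that l by simp
    then show ?thesis by linarith
  qed
  have ratio: "continuous_on ?T (\<lambda>x. time_ratio (l $ i) (tau c i x t))" for i
    unfolding time_ratio_def by (intro continuous_intros continuous_tau) (use ne in blast)
  have Y: "1 - time_ratio (l $ 1) (tau c 1 x t) * time_ratio (l $ 2) (tau c 2 x t) *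
    time_ratio (l $ 3) (tau c 3 x t) * time_ratio (l $ 4) (tau c 4 x t) \<noteq> 0" if "x \<in> ?T" for x
    using prod_time_ratio_less_1[OF l, of c x t] that by simp
  have series: "continuous_on ?T (\<lambda>x. cubic_series e f (time_ratio (l $ 1) (tau c 1 x t)
      * time_ratio (l $ 2) (tau c 2 x t) *
    time_ratio (l $ 3) (tau c 3 x t) * time_ratio (l $ 4) (tau c 4 x t)))" for e f
    unfolding cubic_series_def by (intro continuous_intros ratio) (use Y in auto)
  have coeff: "continuous_on ?T (\<lambda>x. cycle_series j (\<lambda>i. time_ratio (l $ i) (tau c i x t)))"
    using exhaust_4[of j] by (elim disjE) (simp_all add: cycle_series_def, (intro continuous_intros ratio
        series)+)
  have rho: "continuous_on ?T (\<lambda>x. l $ i / (1 + l $ i * tau c i x t)\<^sup>2)" for i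
    by (intro continuous_intros continuous_tau) (use ne in auto)
  have delta: "continuous_on ?T (\<lambda>x. 1 / (1 + l $ j * tau c j x t))"
    by (intro continuous_intros continuous_tau) (use ne in auto)
  have d: "det (matA c) \<noteq> 0" using c by (simp add: det_matA)
  show ?thesis
    unfolding direction_density_def[abs_def]
    by (intro delta rho coeff continuous_on_mult continuous_on_prod continuous_on_divide continuous_on_const
        ballI d)
qed

lemma path_density_nonneg:
  assumes "c > 0" and l: "\<And>i. 0 < l $ i"
  shows "0 \<le> path_density l c t m x"
  using assms
  by (auto simp: path_density_def det_matA intro!: mult_nonneg_nonneg divide_nonneg_nonneg prod_nonneg
      gcp_density_nonneg gcp_count_prob_nonneg)

lemma direction_density_nonneg:
  assumes "c > 0" and l: "\<And>i. 0 < l $ i" and x: "\<And>i. 0 < tau c i x t"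
  shows "0 \<le> direction_density l c t j x"
  using sums_le[OF _ sums_zero path_density_sums[OF l x, of j]] path_density_nonneg[OF assms(1,2)] by simp

lemma dens1_eq_sum_direction_density:
  assumes c: "c > 0" and t: "t > 0" and dur: "gcp_durations M l D" and l: "\<And>i. 0 < l $ i"
    and x: "x \<in> interior (tetra c t)"
  shows "dens1 M c D x t = (\<Sum>j\<in>UNIV. direction_density l c t j x)"
proof -
  have "dens1j M c D j x t = direction_density l c t j x" for j
  proof -
    let ?T = "interior (tetra c t)"
    let ?f = "\<lambda>x. if x \<in> ?T then direction_density l c t j x else 0"
    have T: "?T = {x. \<forall>i. 0 < tau c i x t}" by (rule interior_tetra[OF c t])
    have f: "is_dens1 M c D j t ?f"
      unfolding is_dens1_def
    proof (intro conjI ballI impI allI)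
      show "continuous_on ?T ?f"
        using continuous_on_direction_density[OF c l] unfolding T by (rule continuous_on_eq) simp
      show "0 \<le> ?f x" for x using direction_density_nonneg[OF c l] by (simp add: T)
      show "?f x = 0" if "x \<notin> ?T" for x using that by simp
      fix B :: "(real ^ 3) set" assume B: "B \<in> sets borel" "B \<subseteq> ?T"
      have "(\<Sum>n. ennreal (path_density l c t (4 * n + leg_offset j) x)) * indicator B x
          = ennreal (?f x) * indicator B x" for x
      proof (cases "x \<in> B")
        case True
        then have "x \<in> ?T" using B by blast
        then have x: "0 < tau c i x t" for i unfolding T by simp
        have "(\<Sum>n. ennreal (path_density l c t (4 * n + leg_offset j) x))
            = ennreal (direction_density l c t j x)"
          by (rule suminf_ennreal_eq[OF path_density_nonneg[OF c l] path_density_sums[OF l x]])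
        then show ?thesis using \<open>x \<in> ?T\<close> by simp
      qed simp
      then show "ennreal (\<P>(\<omega> in M. position c D t \<omega> \<in> B \<and> velocity D t \<omega> = dir j
             \<bar> position c D 0 \<omega> = 0 \<and> velocity D 0 \<omega> = dir 1)) = (\<integral>\<^sup>+ x \<in> B. ennreal (?f x) \<partial>lborel)"
        unfolding conditional_position_velocity_law[OF dur l c t B] by simp
    qed
    have "(THE f. is_dens1 M c D j t f) = ?f"
      using f is_dens1_unique[OF _ f] by (rule the_equality)
    then show ?thesis using x by (simp add: dens1j_def)
  qed
  then show ?thesis by (simp add: dens1_def)
qed

section \<open>The limit of large intensities\<close>

lemma intensities_limits:
  shows intensities_at_top_component: "filterlim (\<lambda>l. l $ i) at_top intensities_at_top"
    and intensities_at_top_ratio: "((\<lambda>l. l $ 1 / l $ i) \<longlongrightarrow> 1) intensities_at_top"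
  unfolding filterlim_iff_le_filtercomap intensities_at_top_def
  by (rule le_infI1, rule INF_lower, simp) (rule le_infI2, rule INF_lower, simp)

lemma eventually_intensities_pos: "eventually (\<lambda>l. \<forall>i. 0 < l $ i) intensities_at_top"
proof -
  have "eventually (\<lambda>l. 0 < l $ i) intensities_at_top" for i
    using intensities_at_top_component[of i] by (rule filterlim_at_top_dense[THEN iffD1, rule_format])
  then show ?thesis by (simp add: eventually_all_finite)
qed

text \<open>
  With \<open>L = l\<^sub>1\<close>, the factors \<open>\<delta>\<^sub>i = 1 - y\<^sub>i\<close> and \<open>\<rho>\<^sub>i = l\<^sub>i \<delta>\<^sub>i\<^sup>2\<close> satisfy \<open>L \<delta>\<^sub>i \<rightarrow> 1 / u\<^sub>i\<close> and \<open>L \<rho>\<^sub>i \<rightarrow> 1 / u\<^sub>i\<^sup>2\<close>: one power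
  of \<open>L\<close> for the current direction and one for each of the other three. These four powers of \<open>L\<close> are exactly
  what the pole of order four of the series at \<open>Y = 1\<close> absorbs, because \<open>L (1 - Y) \<rightarrow> K = \<Sum>\<^sub>i 1 / u\<^sub>i\<close>.
\<close>
lemma tendsto_sum_direction_density:
  assumes c: "c > 0" and t: "t > 0" and u: "\<And>i. 0 < tau c i x t"
  shows "((\<lambda>l. \<Sum>j\<in>UNIV. direction_density l c t j x) \<longlongrightarrow> xi c x t) intensities_at_top"
proof -
  define u where "u i = tau c i x t" for i
  have u: "0 < u i" for i using assms(3) by (simp add: u_def)
  let ?F = "intensities_at_top"
  define \<delta> where "\<delta> i l = 1 / (1 + l $ i * u i)" for i and l :: "real ^ 4"
  define \<rho> where "\<rho> i l = l $ i / (1 + l $ i * u i)\<^sup>2" for i and l :: "real ^ 4"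
  define y where "y i l = time_ratio (l $ i) (u i)" for i and l :: "real ^ 4"
  define Y where "Y l = y 1 l * y 2 l * y 3 l * y 4 l" for l
  define K where "K = 1 / u 1 + 1 / u 2 + 1 / u 3 + 1 / u 4"
  have K: "0 < K" using u unfolding K_def by (intro add_pos_pos divide_pos_pos) simp_all
  have inv: "((\<lambda>l. inverse (l $ i)) \<longlongrightarrow> 0) ?F" for i
    by (rule filterlim_compose[OF tendsto_inverse_0_at_top intensities_at_top_component]) (simp add:
        filterlim_ident)
  note ratio = intensities_at_top_ratio
  have den: "1 + l $ i * u i \<noteq> 0" if "\<forall>i. 0 < l $ i" for l i
    using that u by (metis add_pos_pos mult_pos_pos less_irrefl zero_less_one)
  have L\<delta>: "((\<lambda>l. l $ 1 * \<delta> i l) \<longlongrightarrow> 1 / u i) ?F" for i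
  proof (rule Lim_transform_eventually)
    have "((\<lambda>l. (l $ 1 / l $ i) / (inverse (l $ i) + u i)) \<longlongrightarrow> 1 / (0 + u i)) ?F"
      using u[of i] by (intro tendsto_intros inv ratio) simp
    then show "((\<lambda>l. (l $ 1 / l $ i) / (inverse (l $ i) + u i)) \<longlongrightarrow> 1 / u i) ?F" by simp
    show "\<forall>\<^sub>F l in ?F. (l $ 1 / l $ i) / (inverse (l $ i) + u i) = l $ 1 * \<delta> i l"
      using eventually_intensities_pos
    proof eventually_elim
      case (elim l)
      then have "l $ i \<noteq> 0" by (metis less_irrefl)
      then show ?case using den[OF elim, of i] by (simp add: \<delta>_def field_simps)
    qed
  qed
  have L\<rho>: "((\<lambda>l. l $ 1 * \<rho> i l) \<longlongrightarrow> 1 / (u i)\<^sup>2) ?F" for i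
  proof (rule Lim_transform_eventually)
    have "((\<lambda>l. (l $ 1 / l $ i) / (inverse (l $ i) + u i)\<^sup>2) \<longlongrightarrow> 1 / (0 + u i)\<^sup>2) ?F"
      using u[of i] by (intro tendsto_intros inv ratio) simp
    then show "((\<lambda>l. (l $ 1 / l $ i) / (inverse (l $ i) + u i)\<^sup>2) \<longlongrightarrow> 1 / (u i)\<^sup>2) ?F" by simp
    show "\<forall>\<^sub>F l in ?F. (l $ 1 / l $ i) / (inverse (l $ i) + u i)\<^sup>2 = l $ 1 * \<rho> i l"
      using eventually_intensities_pos
    proof eventually_elim
      case (elim l)
      then have 0: "l $ i \<noteq> 0" by (metis less_irrefl)
      then have "inverse (l $ i) + u i = (1 + l $ i * u i) / l $ i" by (simp add: field_simps)
      then show ?case using 0 den[OF elim, of i] by (simp add: \<rho>_def power_divide power2_eq_square)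
    qed
  qed
  have y1: "(y i \<longlongrightarrow> 1) ?F" for i
  proof (rule Lim_transform_eventually)
    have "((\<lambda>l. u i / (inverse (l $ i) + u i)) \<longlongrightarrow> u i / (0 + u i)) ?F"
      using u[of i] by (intro tendsto_intros inv) simp
    then show "((\<lambda>l. u i / (inverse (l $ i) + u i)) \<longlongrightarrow> 1) ?F" using u[of i] by simp
    show "\<forall>\<^sub>F l in ?F. u i / (inverse (l $ i) + u i) = y i l"
      using eventually_intensities_pos
    proof eventually_elim
      case (elim l)
      then have "l $ i \<noteq> 0" by (metis less_irrefl)
      then show ?case using den[OF elim, of i] by (simp add: y_def time_ratio_def field_simps)
    qed
  qed
  have LY: "((\<lambda>l. l $ 1 * (1 - Y l)) \<longlongrightarrow> K) ?F"
  proof (rule Lim_transform_eventually)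
    \<comment> \<open>telescoping: \<open>1 - y\<^sub>1 y\<^sub>2 y\<^sub>3 y\<^sub>4 = \<delta>\<^sub>1 + y\<^sub>1 \<delta>\<^sub>2 + y\<^sub>1 y\<^sub>2 \<delta>\<^sub>3 + y\<^sub>1 y\<^sub>2 y\<^sub>3 \<delta>\<^sub>4\<close>\<close>
    have "((\<lambda>l. l $ 1 * \<delta> 1 l + y 1 l * (l $ 1 * \<delta> 2 l) + y 1 l * y 2 l * (l $ 1 * \<delta> 3 l) +
        y 1 l * y 2 l * y 3 l * (l $ 1 * \<delta> 4 l)) \<longlongrightarrow>
        1 / u 1 + 1 * (1 / u 2) + 1 * 1 * (1 / u 3) + 1 * 1 * 1 * (1 / u 4)) ?F"
      by (intro tendsto_intros L\<delta> y1)
    then show "((\<lambda>l. l $ 1 * \<delta> 1 l + y 1 l * (l $ 1 * \<delta> 2 l) + y 1 l * y 2 l * (l $ 1 * \<delta> 3 l) +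
        y 1 l * y 2 l * y 3 l * (l $ 1 * \<delta> 4 l)) \<longlongrightarrow> K) ?F"
      by (simp add: K_def)
    show "\<forall>\<^sub>F l in ?F. l $ 1 * \<delta> 1 l + y 1 l * (l $ 1 * \<delta> 2 l) + y 1 l * y 2 l * (l $ 1 * \<delta> 3 l) +
        y 1 l * y 2 l * y 3 l * (l $ 1 * \<delta> 4 l) = l $ 1 * (1 - Y l)"
      using eventually_intensities_pos
    proof eventually_elim
      case (elim l)
      have d: "\<delta> i l = 1 - y i l" for i
        using den[OF elim, of i] by (simp add: \<delta>_def y_def time_ratio_def field_simps)
      show ?case unfolding d by (simp add: Y_def algebra_simps)
    qed
  qed
  have Y1: "((\<lambda>l. 1 - Y l) \<longlongrightarrow> 0) ?F"
  proof -
    have "(Y \<longlongrightarrow> 1 * 1 * 1 * 1) ?F" unfolding Y_def[abs_def] by (intro tendsto_intros y1)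
    from tendsto_diff[OF tendsto_const[of 1] this] show ?thesis by simp
  qed
  have series: "((\<lambda>l. cubic_series e f (Y l) / (l $ 1) ^ 4) \<longlongrightarrow> 6 / K ^ 4) ?F" for e f
  proof (rule Lim_transform_eventually)
    have "((\<lambda>l. (6 - e * (1 - Y l) + f * (1 - Y l)\<^sup>2) / (l $ 1 * (1 - Y l)) ^ 4)
        \<longlongrightarrow> (6 - e * 0 + f * 0\<^sup>2) / K ^ 4) ?F"
      using K by (intro tendsto_intros Y1 LY) simp
    then show "((\<lambda>l. (6 - e * (1 - Y l) + f * (1 - Y l)\<^sup>2) / (l $ 1 * (1 - Y l)) ^ 4) \<longlongrightarrow> 6 / K ^ 4) ?F"
      by simp
    show "\<forall>\<^sub>F l in ?F. (6 - e * (1 - Y l) + f * (1 - Y l)\<^sup>2) / (l $ 1 * (1 - Y l)) ^ 4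
        = cubic_series e f (Y l) / (l $ 1) ^ 4"
      using eventually_intensities_pos
    proof eventually_elim
      case (elim l)
      have "Y l < 1" using prod_time_ratio_less_1[of l c x t] elim assms(3) by (simp add: Y_def y_def u_def)
      then have z: "1 - Y l \<noteq> 0" by simp
      have "(6 - e * z + f * z\<^sup>2) / (p * z) ^ 4
          = (6 / z ^ 4 - e / z ^ 3 + f / z\<^sup>2) / p ^ 4" if "z \<noteq> 0" for z p :: real
        using that by (simp add: power_mult_distrib diff_divide_distrib add_divide_distrib power2_eq_square
            power3_eq_cube power4_eq_xxxx ac_simps)
      from this[OF z] show ?case by (simp add: cubic_series_def)
    qed
  qed
  have w: "((\<lambda>l. cycle_series j (\<lambda>i. y i l) / (l $ 1) ^ 4) \<longlongrightarrow> 6 / K ^ 4) ?F" for j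
  proof -
    have Y': "y 1 l * y 2 l * y 3 l * y 4 l = Y l" for l by (simp add: Y_def)
    have "((\<lambda>l. y 1 l * (cubic_series 6 1 (Y l) / (l $ 1) ^ 4)) \<longlongrightarrow> 1 * (6 / K ^ 4)) ?F"
      "((\<lambda>l. y 1 l * y 2 l * (cubic_series 4 0 (Y l) / (l $ 1) ^ 4)) \<longlongrightarrow> 1 * 1 * (6 / K ^ 4)) ?F"
      "((\<lambda>l. y 1 l * y 2 l * y 3 l * (cubic_series 2 0 (Y l) / (l $ 1) ^ 4)) \<longlongrightarrow> 1 * 1 * 1 * (6 / K ^ 4)) ?F"
      by (intro tendsto_intros y1 series)+
    then show ?thesis
      using exhaust_4[of j] series[of 6 1] by (elim disjE) (simp_all add: cycle_series_def Y')
  qed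
  have dens: "((\<lambda>l. direction_density l c t j x)
      \<longlongrightarrow> 1 / u j * (\<Prod>i\<in>UNIV - {j}. 1 / (u i)\<^sup>2) * (6 / K ^ 4) / det (matA c)) ?F" for j
  proof (rule Lim_transform_eventually)
    show "((\<lambda>l. (l $ 1 * \<delta> j l) * (\<Prod>i\<in>UNIV - {j}. l $ 1 * \<rho> i l)
        * (cycle_series j (\<lambda>i. y i l) / (l $ 1) ^ 4) / det (matA c))
       \<longlongrightarrow> 1 / u j * (\<Prod>i\<in>UNIV - {j}. 1 / (u i)\<^sup>2) * (6 / K ^ 4) / det (matA c)) ?F"
      by (intro tendsto_intros L\<delta> L\<rho> w) (use c in \<open>simp add: det_matA\<close>)
    show "\<forall>\<^sub>F l in ?F. (l $ 1 * \<delta> j l) * (\<Prod>i\<in>UNIV - {j}. l $ 1 * \<rho> i l)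
        * (cycle_series j (\<lambda>i. y i l) / (l $ 1) ^ 4) / det (matA c)
        = direction_density l c t j x"
      using eventually_intensities_pos
    proof eventually_elim
      case (elim l)
      have cd: "card (UNIV - {j}) = 3" by (simp add: card_Diff_singleton)
      have "(\<Prod>i\<in>UNIV - {j}. l $ 1 * \<rho> i l) = (l $ 1) ^ 3 * (\<Prod>i\<in>UNIV - {j}. \<rho> i l)"
        by (simp add: prod.distrib cd)
      moreover have "(p * a) * (p ^ 3 * b) * (w / p ^ 4) / d = a * b * w / d" if "p \<noteq> 0" for p a b w d :: real
        using that by (simp add: power3_eq_cube power4_eq_xxxx)
      moreover have "l $ 1 \<noteq> 0" using elim by (metis less_irrefl)
      moreover have "direction_density l c t j x
          = \<delta> j l * (\<Prod>i\<in>UNIV - {j}. \<rho> i l) * cycle_series j (\<lambda>i. y i l) / det (matA c)"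
        by (simp add: direction_density_def \<delta>_def \<rho>_def y_def u_def)
      ultimately show ?case by (simp only: not_False_eq_True)
    qed
  qed
  have "(\<Sum>j\<in>UNIV. 1 / u j * (\<Prod>i\<in>UNIV - {j}. 1 / (u i)\<^sup>2) * (6 / K ^ 4) / det (matA c)) = xi c x t"
  proof -
    define P where "P = u 1 * u 2 * u 3 * u 4"
    define E where "E = u 1 * u 2 * u 3 + u 1 * u 2 * u 4 + u 1 * u 3 * u 4 + u 2 * u 3 * u 4"
    have n: "u i \<noteq> 0" for i using u[of i] by simp
    have P: "P \<noteq> 0" using n by (simp add: P_def)
    have "K * P = E" using n by (simp add: K_def E_def P_def distrib_right)
    then have KE: "K = E / P" using P by (simp add: eq_divide_eq)
    have "1 / u j * (\<Prod>i\<in>UNIV - {j}. 1 / (u i)\<^sup>2) = u j / P\<^sup>2" for j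
    proof -
      have "P = (\<Prod>i\<in>{1, 2, 3, 4}. u i)" by (simp add: P_def ac_simps)
      also have "\<dots> = (\<Prod>i\<in>UNIV. u i)" by (simp only: UNIV_4)
      also have "\<dots> = u j * (\<Prod>i\<in>UNIV - {j}. u i)" by (rule prod.remove) simp_all
      finally have "P\<^sup>2 = (u j)\<^sup>2 * (\<Prod>i\<in>UNIV - {j}. (u i)\<^sup>2)"
        by (simp add: power_mult_distrib prod_power_distrib)
      then show ?thesis using n[of j] by (simp add: prod_dividef power2_eq_square)
    qed
    then have "(\<Sum>j\<in>UNIV. 1 / u j * (\<Prod>i\<in>UNIV - {j}. 1 / (u i)\<^sup>2) * (6 / K ^ 4) / det (matA c))
        = (\<Sum>j\<in>UNIV. u j * (6 / (P\<^sup>2 * K ^ 4 * det (matA c))))"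
      by (intro sum.cong) (simp_all add: ac_simps)
    also have "\<dots> = t * (6 / (P\<^sup>2 * K ^ 4 * det (matA c)))"
    proof -
      have "(\<Sum>j\<in>UNIV. u j) = t" using sum_tau[of c x t] c by (simp add: u_def)
      then show ?thesis by (simp only: sum_distrib_right[symmetric])
    qed
    also have "P\<^sup>2 * K ^ 4 = E ^ 4 / P\<^sup>2"
      using P by (simp add: KE power_divide power2_eq_square power4_eq_xxxx)
    also have "t * (6 / (E ^ 4 / P\<^sup>2 * det (matA c))) = 6 * t * P\<^sup>2 / (det (matA c) * E ^ 4)"
      by (simp add: ac_simps)
    also have "\<dots> = xi c x t"
      by (simp add: xi_def Let_def P_def E_def u_def)
    finally show ?thesis .
  qed
  moreover have "((\<lambda>l. \<Sum>j\<in>UNIV. direction_density l c t j x) \<longlongrightarrow>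
      (\<Sum>j\<in>UNIV. 1 / u j * (\<Prod>i\<in>UNIV - {j}. 1 / (u i)\<^sup>2) * (6 / K ^ 4) / det (matA c))) ?F"
    by (rule tendsto_sum) (rule dens)
  ultimately show ?thesis by (simp only:)
qed

section \<open>The limit is a probability density\<close>

text \<open>
  The density of the reciprocal of a standard exponential variable.
\<close>
definition inv_exp_density :: "real \<Rightarrow> real" where
  "inv_exp_density w = (if w \<le> 0 then 0 else exp (- (1 / w)) / w\<^sup>2)"

lemma inv_exp_density_nonneg: "0 \<le> inv_exp_density w"
  by (simp add: inv_exp_density_def)

lemma borel_measurable_inv_exp_density [measurable]: "inv_exp_density \<in> borel_measurable borel"
  unfolding inv_exp_density_def[abs_def] by measurable

lemma nn_integral_0_infty_FTC:
  fixes f F :: "real \<Rightarrow> real"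
  assumes deriv: "\<And>s. 0 < s \<Longrightarrow> (F has_real_derivative f s) (at s)"
    and cont: "\<And>s. 0 < s \<Longrightarrow> isCont f s"
    and nonneg: "\<And>s. 0 < s \<Longrightarrow> 0 \<le> f s"
    and lim0: "(F \<longlongrightarrow> 0) (at_right 0)" and lim: "(F \<longlongrightarrow> L) at_top"
  shows "(\<integral>\<^sup>+ s \<in> {0<..}. ennreal (f s) \<partial>lborel) = ennreal L"
proof -
  have F0: "((F \<circ> real_of_ereal) \<longlongrightarrow> 0) (at_right 0)"
    using lim0 by (simp add: zero_ereal_def ereal_tendsto_simps)
  have FL: "((F \<circ> real_of_ereal) \<longlongrightarrow> L) (at_left \<infinity>)"
    using lim by (simp add: ereal_tendsto_simps)
  have I: "einterval 0 \<infinity> = {0 :: real<..}" by (auto simp: einterval_def zero_ereal_def)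
  note ftc = interval_integral_FTC_nonneg[of 0 \<infinity> F f, OF _ _ _ _ F0 FL]
  have int: "set_integrable lborel {0<..} f"
    using ftc(1) deriv cont nonneg unfolding I by (auto simp: zero_ereal_def)
  have val: "(LBINT s=0..\<infinity>. f s) = L"
    using ftc(2) deriv cont nonneg by (auto simp: zero_ereal_def)
  have "(\<integral>\<^sup>+ s \<in> {0<..}. ennreal (f s) \<partial>lborel) = ennreal (LINT s:{0<..}|lborel. f s)"
    unfolding set_lebesgue_integral_def
    using int nonneg
    by (subst nn_integral_eq_integral[symmetric])
       (auto simp: set_integrable_def indicator_def intro!: nn_integral_cong)
  also have "(LINT s:{0<..}|lborel. f s) = L"
    using val by (simp add: interval_lebesgue_integral_def I zero_ereal_def)
  finally show ?thesis .
qed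

lemma nn_integral_inv_exp_density: "(\<integral>\<^sup>+ w. ennreal (inv_exp_density w) \<partial>lborel) = 1"
proof -
  have "(\<integral>\<^sup>+ w. ennreal (inv_exp_density w) \<partial>lborel)
      = (\<integral>\<^sup>+ w \<in> {0<..}. ennreal (exp (- (1 / w)) / w\<^sup>2) \<partial>lborel)"
    by (intro nn_integral_cong) (simp add: inv_exp_density_def split: split_indicator)
  also have "\<dots> = ennreal 1"
  proof (rule nn_integral_0_infty_FTC)
    show "((\<lambda>w. exp (- (1 / w))) has_real_derivative exp (- (1 / s)) / s\<^sup>2) (at s)" if "0 < s" for s :: real
      using that by (auto intro!: derivative_eq_intros simp: power2_eq_square)
    show "isCont (\<lambda>w. exp (- (1 / w)) / w\<^sup>2) s" if "0 < s" for s :: real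
      using that by (auto intro!: continuous_intros)
    show "((\<lambda>w :: real. exp (- (1 / w))) \<longlongrightarrow> 0) (at_right 0)" by real_asymp
    show "((\<lambda>w :: real. exp (- (1 / w))) \<longlongrightarrow> 1) at_top" by real_asymp
  qed simp
  finally show ?thesis by simp
qed

text \<open>
  The primitive arises from that of \<open>u\<^sup>3 exp (- K u)\<close> by the substitution \<open>u = 1 / s\<close>.
\<close>
lemma nn_integral_inverse_gamma:
  fixes K :: real
  assumes K: "K > 0"
  shows "(\<integral>\<^sup>+ s \<in> {0<..}. ennreal (exp (- (K / s)) / s ^ 5) \<partial>lborel) = ennreal (6 / K ^ 4)"
proof (rule nn_integral_0_infty_FTC)
  let ?F = "\<lambda>s. exp (- (K / s)) * (6 / K ^ 4 + 6 / (K ^ 3 * s) + 3 / (K\<^sup>2 * s\<^sup>2) + 1 / (K * s ^ 3))"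
  fix s :: real assume s: "0 < s"
  have "(?F has_real_derivative
      exp (- (K / s)) * (K / s\<^sup>2) * (6 / K ^ 4 + 6 / (K ^ 3 * s) + 3 / (K\<^sup>2 * s\<^sup>2) + 1 / (K * s ^ 3)) +
      exp (- (K / s)) * (- (6 / (K ^ 3 * s\<^sup>2)) - 6 / (K\<^sup>2 * s ^ 3) - 3 / (K * s ^ 4))) (at s)"
    using s K by (auto intro!: derivative_eq_intros simp: power2_eq_square power3_eq_cube power4_eq_xxxx
        field_simps)
  also have "exp (- (K / s)) * (K / s\<^sup>2) * (6 / K ^ 4 + 6 / (K ^ 3 * s) + 3 / (K\<^sup>2 * s\<^sup>2) + 1 / (K * s ^ 3)) +
      exp (- (K / s)) * (- (6 / (K ^ 3 * s\<^sup>2)) - 6 / (K\<^sup>2 * s ^ 3) - 3 / (K * s ^ 4))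
      = exp (- (K / s)) * ((K / s\<^sup>2) * (6 / K ^ 4 + 6 / (K ^ 3 * s) + 3 / (K\<^sup>2 * s\<^sup>2) + 1 / (K * s ^ 3)) +
         (- (6 / (K ^ 3 * s\<^sup>2)) - 6 / (K\<^sup>2 * s ^ 3) - 3 / (K * s ^ 4)))"
    by (simp only: distrib_left mult.assoc)
  also have "(K / s\<^sup>2) * (6 / K ^ 4 + 6 / (K ^ 3 * s) + 3 / (K\<^sup>2 * s\<^sup>2) + 1 / (K * s ^ 3)) +
         (- (6 / (K ^ 3 * s\<^sup>2)) - 6 / (K\<^sup>2 * s ^ 3) - 3 / (K * s ^ 4)) = 1 / s ^ 5"
    using s K by (simp add: field_simps eval_nat_numeral)
  finally show "(?F has_real_derivative exp (- (K / s)) / s ^ 5) (at s)" by simp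
  show "isCont (\<lambda>s. exp (- (K / s)) / s ^ 5) s"
    using s by (auto intro!: continuous_intros)
  show "0 \<le> exp (- (K / s)) / s ^ 5" using s by simp
next
  show "((\<lambda>s. exp (- (K / s)) * (6 / K ^ 4 + 6 / (K ^ 3 * s) + 3 / (K\<^sup>2 * s\<^sup>2) + 1 / (K * s ^ 3)))
      \<longlongrightarrow> 0) (at_right 0)"
    using K by real_asymp
  show "((\<lambda>s. exp (- (K / s)) * (6 / K ^ 4 + 6 / (K ^ 3 * s) + 3 / (K\<^sup>2 * s\<^sup>2) + 1 / (K * s ^ 3)))
      \<longlongrightarrow> 6 / K ^ 4) at_top"
    using K by real_asymp
qed

text \<open>
  For independent reciprocals \<open>W\<^sub>i\<close> of standard exponential variables, the density of the first three of the
  normalised variables \<open>t W\<^sub>i / \<Sum>\<^sub>k W\<^sub>k\<close>: the vector \<open>W = s (a, b, d, t - a - b - d)\<close>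
  has the Jacobian \<open>t s\<^sup>3\<close> with respect to \<open>(a, b, d, s)\<close>, and the scale \<open>s\<close> is integrated out.
\<close>
definition simplex_density :: "real \<Rightarrow> real \<times> real \<times> real \<Rightarrow> ennreal" where
  "simplex_density t = (\<lambda>(a, b, d). \<integral>\<^sup>+ s \<in> {0<..}. ennreal (t * s ^ 3 * (inv_exp_density (s * a)
      * inv_exp_density (s * b) *
      inv_exp_density (s * d) * inv_exp_density (s * (t - a - b - d)))) \<partial>lborel)"

lemma simplex_density_eq:
  assumes t: "t > 0" and p: "0 < a" "0 < b" "0 < d" "0 < e" and e: "e = t - a - b - d"
  shows "simplex_density t (a, b, d) =
    ennreal (6 * t * (a * b * d * e)\<^sup>2 / (a * b * d + a * b * e + a * d * e + b * d * e) ^ 4)"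
proof -
  define K where "K = 1 / a + 1 / b + 1 / d + 1 / e"
  define P where "P = a * b * d * e"
  define E where "E = a * b * d + a * b * e + a * d * e + b * d * e"
  have P: "P > 0" using p by (simp add: P_def)
  have K: "K > 0" using p unfolding K_def by (intro add_pos_pos divide_pos_pos) simp_all
  have "K * P = E" using p by (simp add: K_def E_def P_def distrib_right)
  then have KE: "K = E / P" using P by (simp add: eq_divide_eq)
  have "simplex_density t (a, b, d) = (\<integral>\<^sup>+ s \<in> {0<..}. ennreal (t / P\<^sup>2 * (exp (- (K / s)) / s ^ 5)) \<partial>lborel)"
    unfolding simplex_density_def prod.case
  proof (intro nn_integral_cong)
    fix s :: real
    have "t * s ^ 3 * (inv_exp_density (s * a) * inv_exp_density (s * b) *
      inv_exp_density (s * d) * inv_exp_density (s * e)) = t / P\<^sup>2 * (exp (- (K / s)) / s ^ 5)" if s: "0 < s"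
    proof -
      have n: "\<not> s * a \<le> 0" "\<not> s * b \<le> 0" "\<not> s * d \<le> 0" "\<not> s * e \<le> 0"
        using s p by (simp_all add: mult_le_0_iff)
      have ex: "exp (- (K / s)) = exp (- (1 / (s * a))) * exp (- (1 / (s * b))) * exp (- (1 / (s * d)))
          * exp (- (1 / (s * e)))"
        by (simp add: K_def add_divide_distrib mult.commute flip: exp_add)
      show ?thesis
        using s p by (simp add: inv_exp_density_def n ex P_def power_mult_distrib) (simp add: field_simps
            eval_nat_numeral)
    qed
    then show "ennreal (t * s ^ 3 * (inv_exp_density (s * a) * inv_exp_density (s * b) *
      inv_exp_density (s * d) * inv_exp_density (s * (t - a - b - d)))) * indicator {0<..} s
      = ennreal (t / P\<^sup>2 * (exp (- (K / s)) / s ^ 5)) * indicator {0<..} s"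
      by (simp add: e split: split_indicator)
  qed
  also have "\<dots> = (\<integral>\<^sup>+ s. ennreal (t / P\<^sup>2) * (ennreal (exp (- (K / s)) / s ^ 5)
      * indicator {0<..} s) \<partial>lborel)"
    using t by (intro nn_integral_cong) (simp add: ennreal_mult[symmetric] split: split_indicator)
  also have "\<dots> = ennreal (t / P\<^sup>2) * ennreal (6 / K ^ 4)"
    by (simp add: nn_integral_cmult nn_integral_inverse_gamma[OF K])
  also have "\<dots> = ennreal (t / P\<^sup>2 * (6 / K ^ 4))"
    using t K by (subst ennreal_mult[symmetric]) simp_all
  also have "t / P\<^sup>2 * (6 / K ^ 4) = 6 * t * P\<^sup>2 / E ^ 4"
    using P by (simp add: KE power_divide power2_eq_square power4_eq_xxxx)
  finally show ?thesis by (simp add: P_def E_def)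
qed

lemma simplex_density_outside:
  assumes "a \<le> 0 \<or> b \<le> 0 \<or> d \<le> 0 \<or> t - a - b - d \<le> 0"
  shows "simplex_density t (a, b, d) = 0"
proof -
  have "inv_exp_density (s * r) = 0" if "0 < s" "r \<le> 0" for s r
    using that by (simp add: inv_exp_density_def mult_le_0_iff)
  then have "simplex_density t (a, b, d) = (\<integral>\<^sup>+ s. 0 \<partial>(lborel :: real measure))"
    unfolding simplex_density_def prod.case using assms
    by (intro nn_integral_cong) (auto split: split_indicator)
  then show ?thesis by simp
qed

lemma nn_integral_scale:
  fixes f :: "real \<Rightarrow> ennreal"
  assumes [measurable]: "f \<in> borel_measurable borel" and k: "k > 0"
  shows "(\<integral>\<^sup>+ x. f x \<partial>lborel) = (\<integral>\<^sup>+ x. ennreal k * f (k * x) \<partial>lborel)"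
  using nn_integral_real_affine[OF assms(1), of k 0] k by (simp add: nn_integral_cmult)

text \<open>
  Starting from the product of four densities with integral 1, the fourth variable is traded for the sum
  \<open>S\<close> of all four, then \<open>S = t s\<close> and the remaining three variables are scaled by \<open>s\<close>. Only
  translations, scalings and exchanges of the order of integration occur.
\<close>
lemma nn_integral_simplex_density:
  assumes t: "t > 0"
  shows "(\<integral>\<^sup>+ a. \<integral>\<^sup>+ b. \<integral>\<^sup>+ d. simplex_density t (a, b, d) \<partial>lborel \<partial>lborel \<partial>lborel) = 1"
proof -
  define \<phi> where "\<phi> w = ennreal (inv_exp_density w)" for w
  have [measurable]: "\<phi> \<in> borel_measurable borel" unfolding \<phi>_def[abs_def] by measurable
  have \<phi>0: "\<phi> w = 0" if "w \<le> 0" for w using that by (simp add: \<phi>_def inv_exp_density_def)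
  have \<phi>1: "(\<integral>\<^sup>+ w. \<phi> w \<partial>lborel) = 1" unfolding \<phi>_def by (rule nn_integral_inv_exp_density)
  have shift: "(\<integral>\<^sup>+ S. \<phi> (S - r) \<partial>lborel) = 1" for r
    using nn_integral_real_affine[of \<phi> 1 "- r"] \<phi>1 by (simp add: add.commute)
  let ?f = "\<lambda>S a b d. \<phi> a * (\<phi> b * (\<phi> d * \<phi> (S - a - b - d)))"
  have "1 = (\<integral>\<^sup>+ a. \<integral>\<^sup>+ b. \<integral>\<^sup>+ d. \<integral>\<^sup>+ S. ?f S a b d \<partial>lborel \<partial>lborel \<partial>lborel \<partial>lborel)"
  proof -
    have "(\<integral>\<^sup>+ S. \<phi> (S - a - b - d) \<partial>lborel) = 1" for a b d
      using shift[of "a + b + d"] by (simp add: diff_diff_eq add.assoc)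
    then show ?thesis by (simp add: nn_integral_cmult \<phi>1)
  qed
  also have "\<dots> = (\<integral>\<^sup>+ a. \<integral>\<^sup>+ b. \<integral>\<^sup>+ S. \<integral>\<^sup>+ d. ?f S a b d \<partial>lborel \<partial>lborel \<partial>lborel \<partial>lborel)"
    by (intro nn_integral_cong lborel_pair.Fubini') measurable
  also have "\<dots> = (\<integral>\<^sup>+ a. \<integral>\<^sup>+ S. \<integral>\<^sup>+ b. \<integral>\<^sup>+ d. ?f S a b d \<partial>lborel \<partial>lborel \<partial>lborel \<partial>lborel)"
    by (intro nn_integral_cong lborel_pair.Fubini') measurable
  also have "\<dots> = (\<integral>\<^sup>+ S. \<integral>\<^sup>+ a. \<integral>\<^sup>+ b. \<integral>\<^sup>+ d. ?f S a b d \<partial>lborel \<partial>lborel \<partial>lborel \<partial>lborel)"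
    by (intro lborel_pair.Fubini') measurable
  also have "\<dots> = (\<integral>\<^sup>+ s. ennreal t * (\<integral>\<^sup>+ a. \<integral>\<^sup>+ b. \<integral>\<^sup>+ d. ?f (t * s) a b d \<partial>lborel \<partial>lborel \<partial>lborel) \<partial>lborel)"
    by (rule nn_integral_scale[OF _ t]) measurable
  also have "\<dots> = (\<integral>\<^sup>+ s. \<integral>\<^sup>+ a. \<integral>\<^sup>+ b. \<integral>\<^sup>+ d. indicator {0<..} s * (ennreal (t * s ^ 3) * ?f (t * s) (s
      * a) (s * b) (s * d)) \<partial>lborel \<partial>lborel \<partial>lborel \<partial>lborel)"
  proof (rule nn_integral_cong)
    fix s :: real
    show "ennreal t * (\<integral>\<^sup>+ a. \<integral>\<^sup>+ b. \<integral>\<^sup>+ d. ?f (t * s) a b d \<partial>lborel \<partial>lborel \<partial>lborel)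
       = (\<integral>\<^sup>+ a. \<integral>\<^sup>+ b. \<integral>\<^sup>+ d. indicator {0<..} s * (ennreal (t * s ^ 3) * ?f (t * s) (s * a) (s * b) (s
           * d)) \<partial>lborel \<partial>lborel \<partial>lborel)"
    proof (cases "0 < s")
      case False
      \<comment> \<open>four numbers with nonpositive sum are not all positive\<close>
      have f0: "?f (t * s) a b d = 0" for a b d
      proof -
        have "t * s \<le> 0" using False t by (simp add: mult_le_0_iff)
        then have "a \<le> 0 \<or> b \<le> 0 \<or> d \<le> 0 \<or> t * s - a - b - d \<le> 0" by linarith
        then show ?thesis using \<phi>0 by auto
      qed
      show ?thesis unfolding f0 using False by simp
    next
      case True
      have "(\<integral>\<^sup>+ a. \<integral>\<^sup>+ b. \<integral>\<^sup>+ d. ?f (t * s) a b d \<partial>lborel \<partial>lborel \<partial>lborel)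
          = (\<integral>\<^sup>+ a. ennreal s * (\<integral>\<^sup>+ b. \<integral>\<^sup>+ d. ?f (t * s) (s * a) b d \<partial>lborel \<partial>lborel) \<partial>lborel)"
        by (rule nn_integral_scale[OF _ True]) measurable
      also have "\<dots> = (\<integral>\<^sup>+ a. ennreal s * (\<integral>\<^sup>+ b. ennreal s * (\<integral>\<^sup>+ d. ?f (t * s) (s * a) (s
          * b) d \<partial>lborel) \<partial>lborel) \<partial>lborel)"
        by (intro nn_integral_cong arg_cong2[where f = "(*)"] refl nn_integral_scale[OF _ True]) measurable
      also have "\<dots> = (\<integral>\<^sup>+ a. ennreal s * (\<integral>\<^sup>+ b. ennreal s * (\<integral>\<^sup>+ d. ennreal s * ?f (t * s) (s * a) (s
          * b) (s * d) \<partial>lborel) \<partial>lborel) \<partial>lborel)"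
        by (intro nn_integral_cong arg_cong2[where f = "(*)"] refl nn_integral_scale[OF _ True]) measurable
      finally have "ennreal t * (\<integral>\<^sup>+ a. \<integral>\<^sup>+ b. \<integral>\<^sup>+ d. ?f (t * s) a b d \<partial>lborel \<partial>lborel \<partial>lborel)
          = (\<integral>\<^sup>+ a. \<integral>\<^sup>+ b. \<integral>\<^sup>+ d. ennreal t * (ennreal s * (ennreal s * (ennreal s * ?f (t * s) (s * a) (s
              * b) (s * d)))) \<partial>lborel \<partial>lborel \<partial>lborel)"
        by (simp add: nn_integral_cmult)
      moreover have "ennreal (t * s ^ 3) * r = ennreal t * (ennreal s * (ennreal s * (ennreal s * r)))" for r
        using t True by (simp add: power3_eq_cube ennreal_mult mult.assoc)
      ultimately show ?thesis using True by simp
    qed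
  qed
  also have "\<dots> = (\<integral>\<^sup>+ a. \<integral>\<^sup>+ b. \<integral>\<^sup>+ d. \<integral>\<^sup>+ s. indicator {0<..} s * (ennreal (t * s ^ 3) * ?f (t * s) (s
      * a) (s * b) (s * d)) \<partial>lborel \<partial>lborel \<partial>lborel \<partial>lborel)"
  proof -
    let ?h = "\<lambda>s a b d. indicator {0<..} s * (ennreal (t * s ^ 3) * ?f (t * s) (s * a) (s * b) (s * d))"
    have "(\<integral>\<^sup>+ s. \<integral>\<^sup>+ a. \<integral>\<^sup>+ b. \<integral>\<^sup>+ d. ?h s a b d \<partial>lborel \<partial>lborel \<partial>lborel \<partial>lborel)
        = (\<integral>\<^sup>+ a. \<integral>\<^sup>+ s. \<integral>\<^sup>+ b. \<integral>\<^sup>+ d. ?h s a b d \<partial>lborel \<partial>lborel \<partial>lborel \<partial>lborel)"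
      by (intro lborel_pair.Fubini') measurable
    also have "\<dots> = (\<integral>\<^sup>+ a. \<integral>\<^sup>+ b. \<integral>\<^sup>+ s. \<integral>\<^sup>+ d. ?h s a b d \<partial>lborel \<partial>lborel \<partial>lborel \<partial>lborel)"
      by (intro nn_integral_cong lborel_pair.Fubini') measurable
    also have "\<dots> = (\<integral>\<^sup>+ a. \<integral>\<^sup>+ b. \<integral>\<^sup>+ d. \<integral>\<^sup>+ s. ?h s a b d \<partial>lborel \<partial>lborel \<partial>lborel \<partial>lborel)"
      by (intro nn_integral_cong lborel_pair.Fubini') measurable
    finally show ?thesis .
  qed
  also have "\<dots> = (\<integral>\<^sup>+ a. \<integral>\<^sup>+ b. \<integral>\<^sup>+ d. simplex_density t (a, b, d) \<partial>lborel \<partial>lborel \<partial>lborel)"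
    unfolding simplex_density_def prod.case
    using t by (intro nn_integral_cong)
      (simp add: \<phi>_def inv_exp_density_nonneg ennreal_mult[symmetric] algebra_simps split: split_indicator)
  finally show ?thesis ..
qed

lemma xi_eq_simplex_density:
  assumes c: "c > 0" and t: "t > 0"
  shows "ennreal (xi c x t) * indicator (interior (tetra c t)) x
     = ennreal (1 / det (matA c)) * simplex_density t (tau c 1 x t, tau c 2 x t, tau c 3 x t)"
proof -
  have t4: "tau c 4 x t = t - tau c 1 x t - tau c 2 x t - tau c 3 x t"
    using sum_tau[of c x t] c by (simp add: sum_4)
  have detA: "0 < det (matA c)" using c by (simp add: det_matA)
  show ?thesis
  proof (cases "\<forall>i. 0 < tau c i x t")
    case True
    then have "x \<in> interior (tetra c t)" by (simp add: interior_tetra[OF c t])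
    define W where "W = 6 * t * (tau c 1 x t * tau c 2 x t * tau c 3 x t * tau c 4 x t)\<^sup>2 /
      (tau c 1 x t * tau c 2 x t * tau c 3 x t + tau c 1 x t * tau c 2 x t * tau c 4 x t +
       tau c 1 x t * tau c 3 x t * tau c 4 x t + tau c 2 x t * tau c 3 x t * tau c 4 x t) ^ 4"
    have "simplex_density t (tau c 1 x t, tau c 2 x t, tau c 3 x t) = ennreal W"
      unfolding W_def using True by (intro simplex_density_eq[OF t _ _ _ _ t4]) simp_all
    moreover have "xi c x t = 1 / det (matA c) * W"
      by (simp add: xi_def Let_def W_def)
    moreover have "0 \<le> W" using t by (simp add: W_def)
    ultimately show ?thesis
      using detA \<open>x \<in> interior (tetra c t)\<close> by (simp only: ennreal_mult indicator_simps mult_1_right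
          zero_le_divide_1_iff less_imp_le)
  next
    case False
    then have "x \<notin> interior (tetra c t)" by (auto simp: interior_tetra[OF c t])
    moreover have "tau c 1 x t \<le> 0 \<or> tau c 2 x t \<le> 0 \<or> tau c 3 x t \<le> 0 \<or> tau c 4 x t \<le> 0"
      using False by (simp add: forall_4 not_less)
    ultimately show ?thesis using simplex_density_outside[of "tau c 1 x t" "tau c 2 x t" "tau c 3 x t" t] t4
        by simp
  qed
qed

lemma pdf_on_xi:
  assumes c: "c > 0" and t: "t > 0"
  shows "pdf_on (interior (tetra c t)) (\<lambda>x. xi c x t)"
proof -
  have detA: "0 < det (matA c)" using c by (simp add: det_matA)
  have [measurable]: "simplex_density t \<in> borel_measurable borel"
    unfolding simplex_density_def borel_prod[symmetric] by measurable
  have "(\<integral>\<^sup>+ x \<in> interior (tetra c t). ennreal (xi c x t) \<partial>lborel)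
      = ennreal (1 / det (matA c)) * (\<integral>\<^sup>+ x. simplex_density t (tau c 1 x t, tau c 2 x t, tau c 3 x t)
          \<partial>lborel)"
    unfolding xi_eq_simplex_density[OF c t] by (rule nn_integral_cmult) measurable
  also have "\<dots> = ennreal (1 / det (matA c)) * ennreal (det (matA c))"
    using nn_integral_tau123[of "simplex_density t" c t] c nn_integral_simplex_density[OF t] by simp
  also have "\<dots> = 1" using detA by (simp flip: ennreal_mult)
  finally have "(\<integral>\<^sup>+ x \<in> interior (tetra c t). ennreal (xi c x t) \<partial>lborel) = 1" .
  moreover have "set_borel_measurable lborel (interior (tetra c t)) (\<lambda>x. xi c x t)"
    unfolding set_borel_measurable_def xi_def Let_def by measurable
  moreover have "0 \<le> xi c x t" if "x \<in> interior (tetra c t)" for x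
  proof -
    have "0 \<le> tau c i x t" for i using that by (simp add: interior_tetra[OF c t] less_imp_le)
    then show ?thesis using detA t by (simp add: xi_def Let_def less_imp_le)
  qed
  ultimately show ?thesis by (simp add: pdf_on_def)
qed

theorem corollary1:
  fixes c t :: real
    and M :: "real ^ 4 \<Rightarrow> 'a measure"
    and D :: "real ^ 4 \<Rightarrow> 4 \<Rightarrow> nat \<Rightarrow> 'a \<Rightarrow> real"
  assumes "c > 0" and "t > 0"
    and "\<And>l. (\<forall>j. l $ j > 0) \<Longrightarrow> gcp_durations (M l) l (D l)"
  shows "(\<forall>x \<in> interior (tetra c t).
            ((\<lambda>l. dens1 (M l) c (D l) x t) \<longlongrightarrow> xi c x t) intensities_at_top)
       \<and> pdf_on (interior (tetra c t)) (\<lambda>x. xi c x t)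
       \<and> det (matA c) = 16 * sqrt 3 / 9 * c ^ 3"
proof (intro conjI ballI)
  show "det (matA c) = 16 * sqrt 3 / 9 * c ^ 3" by (rule det_matA)
  show "pdf_on (interior (tetra c t)) (\<lambda>x. xi c x t)" by (rule pdf_on_xi[OF assms(1,2)])
  fix x assume x: "x \<in> interior (tetra c t)"
  then have tau: "0 < tau c i x t" for i by (simp add: interior_tetra[OF assms(1,2)])
  show "((\<lambda>l. dens1 (M l) c (D l) x t) \<longlongrightarrow> xi c x t) intensities_at_top"
  proof (rule Lim_transform_eventually)
    show "((\<lambda>l. \<Sum>j\<in>UNIV. direction_density l c t j x) \<longlongrightarrow> xi c x t) intensities_at_top"
      by (rule tendsto_sum_direction_density[OF assms(1,2) tau])
    show "\<forall>\<^sub>F l in intensities_at_top. (\<Sum>j\<in>UNIV. direction_density l c t j x) = dens1 (M l) c (D l) x t"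
      using eventually_intensities_pos
      by eventually_elim (metis dens1_eq_sum_direction_density[OF assms(1,2) _ _ x] assms(3))
  qed
qed

end
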